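(* Let $\{X_t^i\}_{1\le i\le N}$, $X_t^i=(x_t^{i,1},\dots,x_t^{i,d})\in\mathbb R^d$, be a solution process of $$dX_t^i=\lambda\sum_{k=1}^N\psi_t^k(X_t^k-X_t^i)\,dt+\sigma\sum_{k=1}^N\sum_{l=1}^d\psi_t^k(x_t^{k,l}-x_t^{i,l})\,dW_t^l\,e_l,\quad t>0,\qquad \psi_t^k:=\frac{e^{-\beta L(X_t^k)}}{\sum_{l=1}^Ne^{-\beta L(X_t^l)}} .$$ Then for all $i\ne j$ in $\{1,\dots,N\}$ and all $k\in\{1,\dots,d\}$, $$\lim_{t\to\infty}|x_t^{i,k}-x_t^{j,k}|=0\ \text{ a.s.},\qquad\text{and}\qquad \lim_{t\to\infty}\mathbb P\big(|x_t^{i,k}-x_t^{j,k}|^2>\varepsilon\big)=0\ \text{ for every }\varepsilon>0 .$$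
   Context: $N,d\ge1$, $\lambda>0$ (drift rate), $\sigma\ge0$ (noise intensity), $\beta>0$; $L:\mathbb R^d\to\mathbb R$ is locally Lipschitz continuous. $W^1,\dots,W^d$ are independent standard one-dimensional Brownian motions on a probability space $(\Omega,\mathcal F,\mathbb P)$, the same ones for all particles $i$; $\{e_l\}$ is the standard basis of $\mathbb R^d$. The initial data $(X_0^1,\dots,X_0^N)$ are random vectors independent of the Brownian motions. Solutions are strong solutions with continuous paths on $[0,\infty)$. *)

theory Defs
  imports "HOL-Probability.Probability"
begin

section \<open>Brownian motion\<close>

definition standard_BM :: "'w measure \<Rightarrow> (real \<Rightarrow> 'w \<Rightarrow> real) \<Rightarrow> bool" where
  "standard_BM M W \<longleftrightarrow>
     (\<forall>t\<ge>0. W t \<in> borel_measurable M) \<and>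
     (AE \<omega> in M. W 0 \<omega> = 0) \<and>
     (\<forall>(n::nat) (\<tau>::nat \<Rightarrow> real). 0 \<le> \<tau> 0 \<and> (\<forall>k<n. \<tau> k \<le> \<tau> (Suc k)) \<longrightarrow>
        prob_space.indep_vars M (\<lambda>_. borel) (\<lambda>k \<omega>. W (\<tau> (Suc k)) \<omega> - W (\<tau> k) \<omega>) {..<n}) \<and>
     (\<forall>s t. 0 \<le> s \<and> s < t \<longrightarrow>
        distributed M lborel (\<lambda>\<omega>. W t \<omega> - W s \<omega>) (normal_density 0 (sqrt (t - s)))) \<and>
     (AE \<omega> in M. continuous_on {0..} (\<lambda>t. W t \<omega>))"

text \<open>Independence of the coordinates is independence of whole paths, i.e. of random variables with
  values in the product space \<open>\<real>\<^bsup>[0,\<infinity>)\<^esup>\<close>.\<close>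

definition independent_BMs :: "'w measure \<Rightarrow> ('d \<Rightarrow> real \<Rightarrow> 'w \<Rightarrow> real) \<Rightarrow> bool" where
  "independent_BMs M W \<longleftrightarrow>
     (\<forall>l. standard_BM M (W l)) \<and>
     prob_space.indep_vars M (\<lambda>_. \<Pi>\<^sub>M t\<in>{0..}. borel) (\<lambda>l \<omega>. \<lambda>t\<in>{0..}. W l t \<omega>) UNIV"

definition independent_of_BMs ::
  "'w measure \<Rightarrow> ('d \<Rightarrow> real \<Rightarrow> 'w \<Rightarrow> real) \<Rightarrow> ('w \<Rightarrow> 'a::topological_space) \<Rightarrow> bool" where
  "independent_of_BMs M W \<xi> \<longleftrightarrow>
     \<xi> \<in> borel_measurable M \<and>
     prob_space.indep_set M
       {\<xi> -` A \<inter> space M |A. A \<in> sets borel}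
       {(\<lambda>\<omega>. \<lambda>p\<in>UNIV \<times> {0..}. W (fst p) (snd p) \<omega>) -` A \<inter> space M |A.
          A \<in> sets (\<Pi>\<^sub>M p\<in>UNIV \<times> {0..}. borel)}"

text \<open>The filtration of strong solutions: generated by the initial value and the Brownian motions,
  augmented by the null sets. (For \<open>t < 0\<close>, which is irrelevant, no \<open>W\<close> contributes.)\<close>

definition strong_filtration ::
  "'w measure \<Rightarrow> ('d \<Rightarrow> real \<Rightarrow> 'w \<Rightarrow> real) \<Rightarrow> ('w \<Rightarrow> 'a::topological_space) \<Rightarrow> real \<Rightarrow> 'w measure"
  where
  "strong_filtration M W \<xi> t = sigma (space M)
     ({\<xi> -` A \<inter> space M |A. A \<in> sets borel} \<union>
      {W l s -` A \<inter> space M |l s A. 0 \<le> s \<and> s \<le> t \<and> A \<in> sets borel} \<union>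
      null_sets M)"

section \<open>The Ito integral\<close>

definition adapted_to :: "(real \<Rightarrow> 'w measure) \<Rightarrow> (real \<Rightarrow> 'w \<Rightarrow> 'a::topological_space) \<Rightarrow> bool" where
  "adapted_to F X \<longleftrightarrow> (\<forall>t\<ge>0. X t \<in> borel_measurable (F t))"

definition progressively_measurable ::
  "(real \<Rightarrow> 'w measure) \<Rightarrow> (real \<Rightarrow> 'w \<Rightarrow> 'a::topological_space) \<Rightarrow> bool" where
  "progressively_measurable F H \<longleftrightarrow>
     (\<forall>t\<ge>0. (\<lambda>(s, \<omega>). H s \<omega>) \<in> borel_measurable (restrict_space borel {0..t} \<Otimes>\<^sub>M F t))"

text \<open>A simple process \<open>\<Sum>k<n. \<xi> k * 1_(\<tau> k, \<tau> (k+1)]\<close> is given by its number of steps,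
  its partition points and its bounded coefficients; it is left-continuous.\<close>

definition simple_integrand ::
  "'w measure \<Rightarrow> (real \<Rightarrow> 'w measure) \<Rightarrow> nat \<Rightarrow> (nat \<Rightarrow> real) \<Rightarrow> (nat \<Rightarrow> 'w \<Rightarrow> real) \<Rightarrow> bool" where
  "simple_integrand M F n \<tau> \<xi> \<longleftrightarrow>
     0 \<le> \<tau> 0 \<and> (\<forall>k<n. \<tau> k < \<tau> (Suc k)) \<and>
     (\<forall>k<n. \<xi> k \<in> borel_measurable (F (\<tau> k)) \<and> (\<exists>C. \<forall>\<omega>\<in>space M. \<bar>\<xi> k \<omega>\<bar> \<le> C))"

definition simple_process ::
  "nat \<Rightarrow> (nat \<Rightarrow> real) \<Rightarrow> (nat \<Rightarrow> 'w \<Rightarrow> real) \<Rightarrow> real \<Rightarrow> 'w \<Rightarrow> real" where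
  "simple_process n \<tau> \<xi> s \<omega> = (\<Sum>k<n. \<xi> k \<omega> * indicator {\<tau> k<..\<tau> (Suc k)} s)"

definition simple_integral ::
  "(real \<Rightarrow> 'w \<Rightarrow> real) \<Rightarrow> nat \<Rightarrow> (nat \<Rightarrow> real) \<Rightarrow> (nat \<Rightarrow> 'w \<Rightarrow> real) \<Rightarrow> real \<Rightarrow> 'w \<Rightarrow> real" where
  "simple_integral W n \<tau> \<xi> t \<omega> =
     (\<Sum>k<n. \<xi> k \<omega> * (W (min t (\<tau> (Suc k))) \<omega> - W (min t (\<tau> k)) \<omega>))"

text \<open>\<open>J\<close> is (a continuous version of) the Ito integral process of \<open>H\<close> with respect to the
  \<open>F\<close>-Brownian motion \<open>W\<close>, for \<open>H\<close> progressively measurable and almost surely locally square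
  integrable: simple processes approximate \<open>H\<close> in \<open>L\<^sup>2([0,t])\<close> in probability, and their
  elementary integrals converge to \<open>J t\<close> in probability. Such \<open>J\<close> is unique up to
  indistinguishability. All events below are measurable, because \<open>H\<close> is progressively measurable
  and \<open>J\<close> adapted.\<close>

definition is_ito_integral ::
  "'w measure \<Rightarrow> (real \<Rightarrow> 'w measure) \<Rightarrow> (real \<Rightarrow> 'w \<Rightarrow> real) \<Rightarrow> (real \<Rightarrow> 'w \<Rightarrow> real) \<Rightarrow>
     (real \<Rightarrow> 'w \<Rightarrow> real) \<Rightarrow> bool" where
  "is_ito_integral M F W H J \<longleftrightarrow>
     progressively_measurable F H \<and>
     (\<forall>t\<ge>0. AE \<omega> in M. (\<integral>\<^sup>+ s\<in>{0..t}. ennreal ((H s \<omega>)\<^sup>2) \<partial>lborel) < \<infinity>) \<and>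
     adapted_to F J \<and>
     (AE \<omega> in M. continuous_on {0..} (\<lambda>t. J t \<omega>)) \<and>
     (\<exists>n \<tau> \<xi>.
        (\<forall>m::nat. simple_integrand M F (n m) (\<tau> m) (\<xi> m)) \<and>
        (\<forall>t\<ge>0. \<forall>\<epsilon>>0.
           (\<lambda>m. measure M {\<omega> \<in> space M.
              (\<integral>\<^sup>+ s\<in>{0..t}. ennreal ((simple_process (n m) (\<tau> m) (\<xi> m) s \<omega> - H s \<omega>)\<^sup>2) \<partial>lborel)
                > ennreal \<epsilon>}) \<longlonglongrightarrow> 0) \<and>
        (\<forall>t\<ge>0. \<forall>\<epsilon>>0.
           (\<lambda>m. measure M {\<omega> \<in> space M.
              \<bar>simple_integral W (n m) (\<tau> m) (\<xi> m) t \<omega> - J t \<omega>\<bar> > \<epsilon>}) \<longlonglongrightarrow> 0))"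

section \<open>The particle system\<close>

definition locally_lipschitz :: "('a::metric_space \<Rightarrow> 'b::metric_space) \<Rightarrow> bool" where
  "locally_lipschitz f \<longleftrightarrow> (\<forall>x. \<exists>r>0. \<exists>C. C-lipschitz_on (ball x r) f)"

text \<open>A state \<open>x :: real^'d^'n\<close> collects the positions \<open>x $ i :: real^'d\<close> of all particles \<open>i :: 'n\<close>.\<close>

definition cbo_weight ::
  "real \<Rightarrow> (real^'d \<Rightarrow> real) \<Rightarrow> real^'d^'n \<Rightarrow> 'n::finite \<Rightarrow> real" where
  "cbo_weight \<beta> L x k = exp (- \<beta> * L (x $ k)) / (\<Sum>l\<in>UNIV. exp (- \<beta> * L (x $ l)))"

text \<open>Strong solutions in integral form; \<open>J i k l\<close> is the integral of
  \<open>\<psi>\<^sup>k (x\<^sup>k\<^sup>l - x\<^sup>i\<^sup>l)\<close> against \<open>W l\<close>.\<close>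

definition cbo_strong_solution ::
  "'w measure \<Rightarrow> ('d \<Rightarrow> real \<Rightarrow> 'w \<Rightarrow> real) \<Rightarrow> real \<Rightarrow> real \<Rightarrow> real \<Rightarrow> (real^'d \<Rightarrow> real) \<Rightarrow>
     (real \<Rightarrow> 'w \<Rightarrow> real^'d::finite^'n::finite) \<Rightarrow> bool" where
  "cbo_strong_solution M W lam \<sigma> \<beta> L X \<longleftrightarrow>
     adapted_to (strong_filtration M W (X 0)) X \<and>
     (AE \<omega> in M. continuous_on {0..} (\<lambda>t. X t \<omega>)) \<and>
     (\<exists>J.
        (\<forall>i k l. is_ito_integral M (strong_filtration M W (X 0)) (W l)
           (\<lambda>s \<omega>. cbo_weight \<beta> L (X s \<omega>) k * (X s \<omega> $ k $ l - X s \<omega> $ i $ l)) (J i k l)) \<and>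
        (AE \<omega> in M. \<forall>t\<ge>0. \<forall>i.
           X t \<omega> $ i = X 0 \<omega> $ i
             + lam *\<^sub>R (LINT s:{0..t}|lborel.
                 (\<Sum>k\<in>UNIV. cbo_weight \<beta> L (X s \<omega>) k *\<^sub>R (X s \<omega> $ k - X s \<omega> $ i)))
             + \<sigma> *\<^sub>R (\<Sum>k\<in>UNIV. \<Sum>l\<in>UNIV. J i k l t \<omega> *\<^sub>R axis l 1)))"

end

theory Submission
  imports Defs
begin

text \<open>The weights sum to \<open>1\<close>, so a coordinate difference \<open>Z = x\<^sup>i\<^sup>,\<^sup>l - x\<^sup>j\<^sup>,\<^sup>l\<close> of two particles solves the
  linear equation \<open>dZ = - lam Z dt - \<sigma> Z dW\<close>, whence \<open>Z t = Z 0 exp (- (lam t + \<sigma> W t + \<sigma>\<^sup>2 t / 2))\<close>,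
  and this tends to \<open>0\<close> because \<open>W t / t\<close> does.

  The solution formula is obtained without Ito's formula. Over a dyadic grid of \<open>[0,T]\<close>, let
  \<open>x = lam h + \<sigma> \<Delta>W\<close> on each cell, so that \<open>Z\<close> is multiplied by \<open>1 - x\<close> up to a remainder. Multiplying \<open>Z\<close> by
  the product \<open>E\<close> of the factors \<open>exp (x + x\<^sup>2 / 2)\<close> makes it constant up to errors of order \<open>\<Sum> \<bar>x\<bar>\<^sup>3\<close>
  and the Ito remainders \<open>\<Sum> E (\<Delta>J - Z \<Delta>W)\<close> and \<open>\<Sum> (\<Delta>J - Z \<Delta>W)\<^sup>2\<close>. As \<open>E\<close> is adapted, the isometry for
  elementary integrals shows that these vanish in probability, hence almost surely along a
  subsequence, while \<open>\<Sum> x\<^sup>2\<close> tends to \<open>\<sigma>\<^sup>2 T\<close>.\<close>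

section \<open>Convergence to zero in probability\<close>

text \<open>The exponent \<open>x + x\<^sup>2 / 2\<close> is the second order Taylor polynomial of
  \<open>- ln (1 - x)\<close>, so the product of a factor with \<open>1 - x\<close> is
  \<open>1\<close> up to a cubic error; its square part produces the
  \<open>\<sigma>\<^sup>2 T / 2\<close> of the solution formula. The main obstacle is the lack of
  moments: the initial data are arbitrary and the integrands only almost surely locally square
  integrable. The isometry is therefore applied to coefficients that are stopped adaptedly at a
  small quadratic variation, and the stopping is invisible outside an event of small probability. A
  second obstacle is that the simple processes behind an Ito integral have breakpoints of their own
  and converge at single times only. They are chosen anew for each dyadic level, close to the
  integral at all grid points at once, and compared on a common refinement. All particles feel the
  same \<open>W l\<close>, and \<open>Z\<close> is a signed sum of the given integrands, so the
  remainders are estimated for each integrand and then added. The formula for single times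
  \<open>T\<close> reaches all times through rational times and continuity.\<close>

lemma (in prob_space) prob_zero_of_AE_tendsto:
  fixes Y :: "real \<Rightarrow> 'a \<Rightarrow> real"
  assumes [measurable]: "\<And>t. t \<ge> 0 \<Longrightarrow> Y t \<in> borel_measurable M"
    and lim: "AE \<omega> in M. ((\<lambda>t. Y t \<omega>) \<longlongrightarrow> 0) at_top" and "0 < e"
  shows "((\<lambda>t. prob {\<omega> \<in> space M. \<bar>Y t \<omega>\<bar> > e}) \<longlongrightarrow> 0) at_top"
proof -
  \<comment> \<open>Dominated convergence is applied to the indicators of the exceedance events.
    They are set to \<open>0\<close> at negative times, where \<open>Y t\<close> need not be
    measurable.\<close>
  let ?s = "\<lambda>t \<omega>. if 0 \<le> t then indicator {\<omega> \<in> space M. \<bar>Y t \<omega>\<bar> > e} \<omega> else 0 :: real"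
  have m: "{\<omega> \<in> space M. \<bar>Y t \<omega>\<bar> > e} \<in> events" if "t \<ge> 0" for t
    using that by measurable
  have "((\<lambda>t. integral\<^sup>L M (?s t)) \<longlongrightarrow> integral\<^sup>L M (\<lambda>_. 0)) at_top"
  proof (rule integral_dominated_convergence_at_top[where w = "\<lambda>_. 1"])
    show "AE \<omega> in M. ((\<lambda>t. ?s t \<omega>) \<longlongrightarrow> 0) at_top"
      using lim
    proof eventually_elim
      case (elim \<omega>)
      have "eventually (\<lambda>t. \<bar>Y t \<omega>\<bar> < e) at_top"
        using tendstoD[OF elim \<open>0 < e\<close>] by (simp add: dist_real_def)
      then have "eventually (\<lambda>t. ?s t \<omega> = 0) at_top"
        by eventually_elim auto
      then show ?case by (rule tendsto_eventually)
    qed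
    show "?s t \<in> borel_measurable M" for t using m[of t] by (cases "t \<ge> 0") auto
  qed (auto simp: indicator_def)
  moreover have "eventually (\<lambda>t. integral\<^sup>L M (?s t) = prob {\<omega> \<in> space M. \<bar>Y t \<omega>\<bar> > e}) at_top"
    using eventually_ge_at_top[of 0] by eventually_elim (simp add: m)
  ultimately show ?thesis using tendsto_cong by fastforce
qed

text \<open>Measurability is left out of the notion and is assumed separately wherever exceedance
  events are compared.\<close>

definition (in prob_space) null_in_prob :: "(nat \<Rightarrow> 'a \<Rightarrow> real) \<Rightarrow> bool" where
  "null_in_prob Y \<longleftrightarrow> (\<forall>e>0. (\<lambda>n. prob {\<omega> \<in> space M. \<bar>Y n \<omega>\<bar> > e}) \<longlonglongrightarrow> 0)"

context prob_space
begin

lemma null_in_prob_of_AE: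
  assumes [measurable]: "\<And>n. Y n \<in> borel_measurable M"
    and lim: "AE \<omega> in M. (\<lambda>n. Y n \<omega>) \<longlonglongrightarrow> 0"
  shows "null_in_prob Y"
  unfolding null_in_prob_def
proof (intro allI impI)
  fix e :: real assume "0 < e"
  let ?s = "\<lambda>n. indicator {\<omega> \<in> space M. \<bar>Y n \<omega>\<bar> > e} :: 'a \<Rightarrow> real"
  have "(\<lambda>n. integral\<^sup>L M (?s n)) \<longlonglongrightarrow> integral\<^sup>L M (\<lambda>_. 0)"
  proof (rule integral_dominated_convergence[where w = "\<lambda>_. 1"])
    show "AE \<omega> in M. (\<lambda>n. ?s n \<omega>) \<longlonglongrightarrow> 0"
      using lim
    proof eventually_elim
      case (elim \<omega>)
      have "eventually (\<lambda>n. \<bar>Y n \<omega>\<bar> < e) sequentially"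
        using tendstoD[OF elim \<open>0 < e\<close>] by (simp add: dist_real_def)
      then have "eventually (\<lambda>n. ?s n \<omega> = 0) sequentially"
        by eventually_elim auto
      then show ?case by (rule tendsto_eventually)
    qed
  qed (auto simp: indicator_def)
  then show "(\<lambda>n. prob {\<omega> \<in> space M. \<bar>Y n \<omega>\<bar> > e}) \<longlonglongrightarrow> 0"
    by simp
qed

lemma null_in_prob_mono:
  assumes U: "null_in_prob U" and [measurable]: "\<And>n. U n \<in> borel_measurable M"
    and le: "\<And>n. AE \<omega> in M. \<bar>Y n \<omega>\<bar> \<le> \<bar>U n \<omega>\<bar>"
  shows "null_in_prob Y"
  unfolding null_in_prob_def
proof (intro allI impI)
  fix e :: real assume "0 < e"
  show "(\<lambda>n. prob {\<omega> \<in> space M. \<bar>Y n \<omega>\<bar> > e}) \<longlonglongrightarrow> 0"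
  proof (rule tendsto_sandwich[OF _ _ tendsto_const])
    show "(\<lambda>n. prob {\<omega> \<in> space M. \<bar>U n \<omega>\<bar> > e}) \<longlonglongrightarrow> 0"
      using U \<open>0 < e\<close> by (simp add: null_in_prob_def)
    have "prob {\<omega> \<in> space M. \<bar>Y n \<omega>\<bar> > e} \<le> prob {\<omega> \<in> space M. \<bar>U n \<omega>\<bar> > e}" for n
    proof (rule finite_measure_mono_AE)
      show "AE \<omega> in M. \<omega> \<in> {\<omega> \<in> space M. \<bar>Y n \<omega>\<bar> > e} \<longrightarrow> \<omega> \<in> {\<omega> \<in> space M. \<bar>U n \<omega>\<bar> > e}"
        using le[of n] by eventually_elim auto
    qed measurable
    then show "\<forall>\<^sub>F n in sequentially. prob {\<omega> \<in> space M. \<bar>Y n \<omega>\<bar> > e} \<le> prob {\<omega> \<in> space M. \<bar>U n \<omega>\<bar> > e}"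
      by simp
  qed simp
qed

lemma null_in_prob_add:
  assumes Y: "null_in_prob Y" and U: "null_in_prob U"
    and [measurable]: "\<And>n. U n \<in> borel_measurable M" "\<And>n. Y n \<in> borel_measurable M"
  shows "null_in_prob (\<lambda>n \<omega>. Y n \<omega> + U n \<omega>)"
  unfolding null_in_prob_def
proof (intro allI impI)
  fix e :: real assume "0 < e"
  show "(\<lambda>n. prob {\<omega> \<in> space M. \<bar>Y n \<omega> + U n \<omega>\<bar> > e}) \<longlonglongrightarrow> 0"
  proof (rule tendsto_sandwich[OF _ _ tendsto_const])
    let ?b = "\<lambda>n. prob {\<omega> \<in> space M. \<bar>Y n \<omega>\<bar> > e/2} + prob {\<omega> \<in> space M. \<bar>U n \<omega>\<bar> > e/2}"
    have "?b \<longlonglongrightarrow> 0 + 0"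
      using U[unfolded null_in_prob_def, rule_format, of "e/2"] Y[unfolded null_in_prob_def, rule_format, of "e/2"] \<open>0 < e\<close>
      by (intro tendsto_add) auto
    then show "?b \<longlonglongrightarrow> 0" by simp
    have "prob {\<omega> \<in> space M. \<bar>Y n \<omega> + U n \<omega>\<bar> > e} \<le> ?b n" for n
    proof -
      have "prob {\<omega> \<in> space M. \<bar>Y n \<omega> + U n \<omega>\<bar> > e}
        \<le> prob ({\<omega> \<in> space M. \<bar>Y n \<omega>\<bar> > e/2} \<union> {\<omega> \<in> space M. \<bar>U n \<omega>\<bar> > e/2})"
        by (intro finite_measure_mono) auto
      also have "\<dots> \<le> ?b n" by (intro measure_Un_le) measurable
      finally show ?thesis .
    qed
    then show "\<forall>\<^sub>F n in sequentially. prob {\<omega> \<in> space M. \<bar>Y n \<omega> + U n \<omega>\<bar> > e} \<le> ?b n"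
      by simp
  qed simp
qed

lemma null_in_prob_cmult:
  assumes Y: "null_in_prob Y"
  shows "null_in_prob (\<lambda>n \<omega>. c * Y n \<omega>)"
proof (cases "c = 0")
  case False
  then show ?thesis
    using Y unfolding null_in_prob_def
  proof (intro allI impI)
    fix e :: real assume "0 < e"
    then have "(\<lambda>n. prob {\<omega> \<in> space M. \<bar>Y n \<omega>\<bar> > e / \<bar>c\<bar>}) \<longlonglongrightarrow> 0"
      using Y False by (simp add: null_in_prob_def)
    moreover have "\<bar>Y n \<omega>\<bar> > e / \<bar>c\<bar> \<longleftrightarrow> \<bar>c * Y n \<omega>\<bar> > e" for n \<omega>
      using False by (simp add: abs_mult field_simps)
    ultimately show "(\<lambda>n. prob {\<omega> \<in> space M. \<bar>c * Y n \<omega>\<bar> > e}) \<longlonglongrightarrow> 0" by simp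
  qed
qed (simp add: null_in_prob_def)

lemma null_in_prob_sum:
  assumes "finite I" "\<And>i. i \<in> I \<Longrightarrow> null_in_prob (Y i)" "\<And>i n. i \<in> I \<Longrightarrow> Y i n \<in> borel_measurable M"
  shows "null_in_prob (\<lambda>n \<omega>. \<Sum>i\<in>I. Y i n \<omega>)"
  using assms
proof (induction rule: finite_induct)
  case empty then show ?case by (simp add: null_in_prob_def)
next
  case (insert i I)
  have "null_in_prob (\<lambda>n \<omega>. Y i n \<omega> + (\<Sum>i\<in>I. Y i n \<omega>))"
    using insert by (intro null_in_prob_add) auto
  then show ?case using insert by simp
qed

text \<open>By Borel-Cantelli, almost surely \<open>\<bar>Y n\<bar> \<le> e n\<close> for all but
  finitely many \<open>n\<close>.\<close>

lemma AE_tendsto_zero_of_tails: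
  fixes Y :: "nat \<Rightarrow> 'a \<Rightarrow> real"
  assumes [measurable]: "\<And>n. Y n \<in> borel_measurable M"
    and "\<And>n. prob {\<omega> \<in> space M. \<bar>Y n \<omega>\<bar> > e n} \<le> b n" "summable b" "e \<longlonglongrightarrow> 0"
  shows "AE \<omega> in M. (\<lambda>n. Y n \<omega>) \<longlonglongrightarrow> 0"
proof -
  have "AE \<omega> in M. eventually (\<lambda>n. \<omega> \<in> space M - {\<omega> \<in> space M. \<bar>Y n \<omega>\<bar> > e n}) sequentially"
  proof (rule borel_cantelli_AE1)
    show "summable (\<lambda>n. prob {\<omega> \<in> space M. \<bar>Y n \<omega>\<bar> > e n})"
      by (rule summable_comparison_test'[OF assms(3), of 0]) (use assms(2) in auto)
    show "{\<omega> \<in> space M. \<bar>Y n \<omega>\<bar> > e n} \<in> events" for n by measurable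
  qed (simp add: emeasure_eq_measure)
  then show ?thesis
  proof eventually_elim
    case (elim \<omega>)
    show ?case
    proof (rule Lim_null_comparison[OF _ assms(4)])
      show "eventually (\<lambda>n. norm (Y n \<omega>) \<le> e n) sequentially"
        using elim by eventually_elim auto
    qed
  qed
qed

lemma null_in_prob_AE_subseq:
  assumes Y: "null_in_prob Y" and [measurable]: "\<And>n. Y n \<in> borel_measurable M"
  shows "\<exists>r. strict_mono r \<and> (AE \<omega> in M. (\<lambda>n. Y (r n) \<omega>) \<longlonglongrightarrow> 0)"
proof -
  \<comment> \<open>Beyond any index there is one whose tail past \<open>(1/2)^n\<close> has
    probability below \<open>(1/2)^n\<close>: both the threshold and the bound are then ready for
    \<open>AE_tendsto_zero_of_tails\<close>.\<close>
  have "\<exists>m>k. prob {\<omega> \<in> space M. \<bar>Y m \<omega>\<bar> > (1/2)^n} < (1/2)^n" for k n :: nat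
  proof -
    have "(\<lambda>m. prob {\<omega> \<in> space M. \<bar>Y m \<omega>\<bar> > (1/2)^n}) \<longlonglongrightarrow> 0"
      using Y by (simp add: null_in_prob_def)
    then have "eventually (\<lambda>m. prob {\<omega> \<in> space M. \<bar>Y m \<omega>\<bar> > (1/2)^n} < (1/2)^n) sequentially"
      by (rule order_tendstoD) simp
    with eventually_gt_at_top[of k] have "eventually (\<lambda>m. m > k \<and> prob {\<omega> \<in> space M. \<bar>Y m \<omega>\<bar> > (1/2)^n} < (1/2)^n) sequentially"
      by eventually_elim simp
    then show ?thesis using eventually_happens'[OF sequentially_bot] by blast
  qed
  then obtain g where g: "\<And>k n. g k n > k" "\<And>k n. prob {\<omega> \<in> space M. \<bar>Y (g k n) \<omega>\<bar> > (1/2)^n} < (1/2)^n"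
    by metis
  \<comment> \<open>Each index is chosen beyond the preceding one, which makes \<open>r\<close>
    strictly increasing.\<close>
  define r where "r = rec_nat (g 0 0) (\<lambda>n x. g x (Suc n))"
  have r: "r (Suc n) = g (r n) (Suc n)" "r 0 = g 0 0" for n by (simp_all add: r_def)
  have "strict_mono r" by (simp add: strict_mono_Suc_iff r g)
  have rb: "prob {\<omega> \<in> space M. \<bar>Y (r n) \<omega>\<bar> > (1/2)^n} \<le> (1/2)^n" for n
  proof (cases n)
    case 0 then show ?thesis by simp
  next
    case (Suc k) then show ?thesis using g(2)[of n "r k"] r(1)[of k] by (simp del: power_Suc)
  qed
  have "AE \<omega> in M. (\<lambda>n. Y (r n) \<omega>) \<longlonglongrightarrow> 0"
    by (rule AE_tendsto_zero_of_tails[OF _ rb]) (auto intro: summable_geometric LIMSEQ_power_zero)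
  with \<open>strict_mono r\<close> show ?thesis by blast
qed

end

section \<open>Brownian motion relative to a filtration\<close>

text \<open>The increments are independent of the whole of \<open>F s\<close>, not merely of the
  past of \<open>W\<close>: the integrands also depend on the initial data and on the other Brownian
  motions. Start and continuity hold only almost surely, as in \<open>standard_BM\<close>.\<close>

locale adapted_BM = prob_space M for M :: "'a measure" +
  fixes F :: "real \<Rightarrow> 'a measure" and W :: "real \<Rightarrow> 'a \<Rightarrow> real"
  assumes subalg: "0 \<le> t \<Longrightarrow> subalgebra M (F t)"
    and filtration: "0 \<le> s \<Longrightarrow> s \<le> t \<Longrightarrow> subalgebra (F t) (F s)"
    and adapted: "0 \<le> t \<Longrightarrow> W t \<in> borel_measurable (F t)"
    and increment_indep: "0 \<le> s \<Longrightarrow> s < t \<Longrightarrow>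
      indep_set (sets (F s)) {(\<lambda>\<omega>. W t \<omega> - W s \<omega>) -` B \<inter> space M |B. B \<in> sets borel}"
    and increment_normal: "0 \<le> s \<Longrightarrow> s < t \<Longrightarrow>
      distributed M lborel (\<lambda>\<omega>. W t \<omega> - W s \<omega>) (normal_density 0 (sqrt (t - s)))"
    and start: "AE \<omega> in M. W 0 \<omega> = 0"
    and cont: "AE \<omega> in M. continuous_on {0..} (\<lambda>t. W t \<omega>)"
begin

lemma measurable_F_mono:
  "f \<in> borel_measurable (F s) \<Longrightarrow> 0 \<le> s \<Longrightarrow> s \<le> t \<Longrightarrow> f \<in> borel_measurable (F t)"
  using measurable_from_subalg[OF filtration] by blast

lemma measurable_F_M: "f \<in> borel_measurable (F s) \<Longrightarrow> 0 \<le> s \<Longrightarrow> f \<in> borel_measurable M"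
  using measurable_from_subalg[OF subalg] by blast

lemma space_F: "0 \<le> s \<Longrightarrow> space (F s) = space M"
  using subalg by (simp add: subalgebra_def)

lemma measurable_W: "0 \<le> t \<Longrightarrow> W t \<in> borel_measurable M"
  using adapted measurable_F_M by blast

text \<open>The assumption \<open>increment_indep\<close> concerns events. Preimages of Borel sets
  are stable under intersection, so independence extends to the generated sigma-algebras, which is
  independence of the random variables.\<close>

lemma indep_var_increment:
  assumes st: "0 \<le> s" "s < t" and X: "X \<in> borel_measurable (F s)"
  shows "indep_var borel X borel (\<lambda>\<omega>. W t \<omega> - W s \<omega>)"
proof -
  have "indep_set {X -` A \<inter> space M |A. A \<in> sets borel} {(\<lambda>\<omega>. W t \<omega> - W s \<omega>) -` B \<inter> space M |B. B \<in> sets borel}"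
  proof (rule indep_setI)
    show "{X -` A \<inter> space M |A. A \<in> sets borel} \<subseteq> events"
      using measurable_F_M[OF X \<open>0 \<le> s\<close>] by (auto simp: measurable_sets)
    show "{(\<lambda>\<omega>. W t \<omega> - W s \<omega>) -` B \<inter> space M |B. B \<in> sets borel} \<subseteq> events"
      using measurable_W[of s] measurable_W[of t] st by (auto intro!: measurable_sets)
    have "X -` A \<inter> space M \<in> sets (F s)" if "A \<in> sets borel" for A
      using measurable_sets[OF X that] st by (simp add: space_F)
    then show "prob (a \<inter> b) = prob a * prob b" if "a \<in> {X -` A \<inter> space M |A. A \<in> sets borel}"
      "b \<in> {(\<lambda>\<omega>. W t \<omega> - W s \<omega>) -` B \<inter> space M |B. B \<in> sets borel}" for a b
      using that indep_setD[OF increment_indep[OF st]] by blast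
  qed
  moreover have "Int_stable {Y -` A \<inter> space M |A. A \<in> sets (borel :: real measure)}" for Y :: "'a \<Rightarrow> real"
  proof (rule Int_stableI)
    fix a b assume "a \<in> {Y -` A \<inter> space M |A. A \<in> sets borel}" "b \<in> {Y -` A \<inter> space M |A. A \<in> sets borel}"
    then obtain A B where "a = Y -` A \<inter> space M" "b = Y -` B \<inter> space M" "A \<in> sets borel" "B \<in> sets borel" by auto
    then show "a \<inter> b \<in> {Y -` A \<inter> space M |A. A \<in> sets borel}"
      by (auto intro!: exI[of _ "A \<inter> B"])
  qed
  ultimately show ?thesis
    unfolding indep_var_eq using measurable_F_M[OF X \<open>0 \<le> s\<close>] measurable_W[of s] measurable_W[of t] st
    by (auto intro!: indep_set_sigma_sets)
qed

lemma increment_moments: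
  assumes st: "0 \<le> s" "s < t"
  shows "integrable M (\<lambda>\<omega>. (W t \<omega> - W s \<omega>) ^ k)"
    and "expectation (\<lambda>\<omega>. W t \<omega> - W s \<omega>) = 0"
    and "expectation (\<lambda>\<omega>. (W t \<omega> - W s \<omega>)\<^sup>2) = t - s"
    and "expectation (\<lambda>\<omega>. (W t \<omega> - W s \<omega>) ^ 4) = 3 * (t - s)\<^sup>2"
proof -
  have p: "0 < sqrt (t - s)" using st by simp
  note D = increment_normal[OF st]
  show "integrable M (\<lambda>\<omega>. (W t \<omega> - W s \<omega>) ^ k)"
    using distributed_integrable[OF D, of "\<lambda>x. x ^ k"] integrable_normal_moment[OF p, of 0 k] by simp
  show "expectation (\<lambda>\<omega>. W t \<omega> - W s \<omega>) = 0"
    using distributed_integral[OF D, of "\<lambda>x. x"] integral_normal_moment_odd[OF p, of 0 0] by simp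
  show "expectation (\<lambda>\<omega>. (W t \<omega> - W s \<omega>)\<^sup>2) = t - s"
    using distributed_integral[OF D, of "\<lambda>x. x\<^sup>2"] integral_normal_moment_even[OF p, of 0 1] st
    by (simp add: fact_numeral)
  show "expectation (\<lambda>\<omega>. (W t \<omega> - W s \<omega>) ^ 4) = 3 * (t - s)\<^sup>2"
    using distributed_integral[OF D, of "\<lambda>x. x ^ 4"] integral_normal_moment_even[OF p, of 0 2] st
    by (simp add: fact_numeral power_divide field_simps)
qed

text \<open>Orthogonality by induction on \<open>b\<close>: the earlier sum times the new
  coefficient is known at time \<open>q n\<close>, hence independent of the new \<open>Y n\<close>,
  whose mean is \<open>0\<close>. The functions \<open>g i\<close> let the lemma serve both for
  increments (\<open>g\<close> the identity) and for centred squares of increments; the lower index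
  \<open>a\<close> lets it serve for single blocks. Measurability of the sum at time
  \<open>q b\<close> is part of the conclusion because the next induction step uses it.\<close>

lemma martingale_transform_isometry:
  fixes q :: "nat \<Rightarrow> real" and c Y :: "nat \<Rightarrow> 'a \<Rightarrow> real" and g :: "nat \<Rightarrow> real \<Rightarrow> real"
  assumes "a \<le> b" and q0: "0 \<le> q a" and q: "\<And>i. a \<le> i \<Longrightarrow> i < b \<Longrightarrow> q i < q (Suc i)"
    and c: "\<And>i. a \<le> i \<Longrightarrow> i < b \<Longrightarrow> c i \<in> borel_measurable (F (q i))"
    and bdd: "\<And>i \<omega>. a \<le> i \<Longrightarrow> i < b \<Longrightarrow> \<omega> \<in> space M \<Longrightarrow> \<bar>c i \<omega>\<bar> \<le> C i"
    and g: "\<And>i. g i \<in> borel_measurable borel"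
    and Y: "\<And>i. Y i = (\<lambda>\<omega>. g i (W (q (Suc i)) \<omega> - W (q i) \<omega>))"
    and Y1: "\<And>i. a \<le> i \<Longrightarrow> i < b \<Longrightarrow> expectation (Y i) = 0"
    and Y2: "\<And>i. a \<le> i \<Longrightarrow> i < b \<Longrightarrow> integrable M (\<lambda>\<omega>. (Y i \<omega>)\<^sup>2)"
  shows "0 \<le> q b \<and> (\<lambda>\<omega>. \<Sum>i=a..<b. c i \<omega> * Y i \<omega>) \<in> borel_measurable (F (q b)) \<and>
    integrable M (\<lambda>\<omega>. (\<Sum>i=a..<b. c i \<omega> * Y i \<omega>)\<^sup>2) \<and>
    expectation (\<lambda>\<omega>. (\<Sum>i=a..<b. c i \<omega> * Y i \<omega>)\<^sup>2)
      = (\<Sum>i=a..<b. expectation (\<lambda>\<omega>. (c i \<omega>)\<^sup>2) * expectation (\<lambda>\<omega>. (Y i \<omega>)\<^sup>2))"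
  using assms(1) q c bdd Y1 Y2
proof (induction b rule: dec_induct)
  case base
  then show ?case using q0 by simp
next
  case (step n)
  let ?S = "\<lambda>\<omega>. \<Sum>i=a..<n. c i \<omega> * Y i \<omega>"
  let ?D = "\<lambda>\<omega>. W (q (Suc n)) \<omega> - W (q n) \<omega>"
  have IH: "0 \<le> q n" "?S \<in> borel_measurable (F (q n))" "integrable M (\<lambda>\<omega>. (?S \<omega>)\<^sup>2)"
    "expectation (\<lambda>\<omega>. (?S \<omega>)\<^sup>2) = (\<Sum>i=a..<n. expectation (\<lambda>\<omega>. (c i \<omega>)\<^sup>2) * expectation (\<lambda>\<omega>. (Y i \<omega>)\<^sup>2))"
    using step by auto
  have qn: "q n < q (Suc n)" using step by simp
  have cn: "c n \<in> borel_measurable (F (q n))" using step by simp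
  have cM: "c n \<in> borel_measurable M" using cn IH(1) measurable_F_M by blast
  have SM: "?S \<in> borel_measurable M" using IH(1,2) measurable_F_M by blast
  have YF: "Y n \<in> borel_measurable (F (q (Suc n)))"
    unfolding Y using measurable_F_mono[OF adapted[OF IH(1)] IH(1), of "q (Suc n)"] adapted[of "q (Suc n)"] IH(1) qn
    by (intro measurable_compose[OF _ g]) simp
  have YM: "Y n \<in> borel_measurable M" using measurable_F_M[OF YF] IH(1) qn by simp
  have SF: "?S \<in> borel_measurable (F (q (Suc n)))" "c n \<in> borel_measurable (F (q (Suc n)))"
    using IH(1,2) cn qn by (auto intro: measurable_F_mono)
  have bn: "\<bar>c n \<omega>\<bar> \<le> C n" if "\<omega> \<in> space M" for \<omega> using step that by simp
  have c2: "integrable M (\<lambda>\<omega>. (c n \<omega>)\<^sup>2)"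
  proof (rule integrable_const_bound[where B = "(C n)\<^sup>2"])
    show "AE \<omega> in M. norm ((c n \<omega>)\<^sup>2) \<le> (C n)\<^sup>2"
      using power_mono[OF bn abs_ge_zero, of _ 2] by (intro AE_I2) simp
  qed (use cM in simp)
  have Y2n: "integrable M (\<lambda>\<omega>. (Y n \<omega>)\<^sup>2)" by (rule step.prems(5)) (use step.hyps in auto)
  have Y1n: "expectation (Y n) = 0" by (rule step.prems(4)) (use step.hyps in auto)
  have Yi: "integrable M (Y n)"
    by (rule square_integrable_imp_integrable[OF YM Y2n])
  have iv2: "indep_var borel (\<lambda>\<omega>. (c n \<omega>)\<^sup>2) borel (\<lambda>\<omega>. (Y n \<omega>)\<^sup>2)"
    using indep_var_compose[OF indep_var_increment[OF IH(1) qn cn], of "\<lambda>x. x\<^sup>2" borel "\<lambda>x. (g n x)\<^sup>2" borel] g[of n]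
    by (simp add: comp_def Y)
  \<comment> \<open>The old sum and the new coefficient are grouped, since it is their product that
    must be independent of \<open>Y n\<close> for the cross term to vanish.\<close>
  have scm: "(\<lambda>\<omega>. ?S \<omega> * c n \<omega>) \<in> borel_measurable (F (q n))" using IH(2) cn by simp
  have iv1: "indep_var borel (\<lambda>\<omega>. ?S \<omega> * c n \<omega>) borel (Y n)"
    using indep_var_compose[OF indep_var_increment[OF IH(1) qn scm], of "\<lambda>x. x" borel "g n" borel] g[of n]
    by (simp add: comp_def Y)
  have S1: "integrable M ?S"
    by (rule square_integrable_imp_integrable[OF SM IH(3)])
  \<comment> \<open>Here the bound on the coefficient is essential: a bounded factor keeps the
    integrable sum integrable.\<close>
  have Sc: "integrable M (\<lambda>\<omega>. ?S \<omega> * c n \<omega>)"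
  proof (rule Bochner_Integration.integrable_bound[where f = "\<lambda>\<omega>. C n * ?S \<omega>"])
    show "AE \<omega> in M. norm (?S \<omega> * c n \<omega>) \<le> norm (C n * ?S \<omega>)"
    proof (rule AE_I2)
      fix \<omega> assume "\<omega> \<in> space M"
      from bn[OF this] show "norm (?S \<omega> * c n \<omega>) \<le> norm (C n * ?S \<omega>)"
        by (simp add: abs_mult mult.commute mult_right_mono)
    qed
  qed (use S1 SM cM in auto)
  have i2: "integrable M (\<lambda>\<omega>. (c n \<omega>)\<^sup>2 * (Y n \<omega>)\<^sup>2)" by (rule indep_var_integrable[OF iv2 c2 Y2n])
  have i1: "integrable M (\<lambda>\<omega>. (?S \<omega> * c n \<omega>) * Y n \<omega>)" by (rule indep_var_integrable[OF iv1 Sc Yi])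
  have e2: "expectation (\<lambda>\<omega>. (c n \<omega>)\<^sup>2 * (Y n \<omega>)\<^sup>2) = expectation (\<lambda>\<omega>. (c n \<omega>)\<^sup>2) * expectation (\<lambda>\<omega>. (Y n \<omega>)\<^sup>2)"
    by (rule indep_var_lebesgue_integral[OF iv2 c2 Y2n])
  have e1: "expectation (\<lambda>\<omega>. (?S \<omega> * c n \<omega>) * Y n \<omega>) = 0"
    using indep_var_lebesgue_integral[OF iv1 Sc Yi] Y1n by simp
  have eq: "(\<lambda>\<omega>. (\<Sum>i=a..<Suc n. c i \<omega> * Y i \<omega>)\<^sup>2)
    = (\<lambda>\<omega>. (?S \<omega>)\<^sup>2 + 2 * ((?S \<omega> * c n \<omega>) * Y n \<omega>) + (c n \<omega>)\<^sup>2 * (Y n \<omega>)\<^sup>2)"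
    using step.hyps by (auto simp: fun_eq_iff power2_eq_square algebra_simps)
  have i21: "integrable M (\<lambda>\<omega>. 2 * ((?S \<omega> * c n \<omega>) * Y n \<omega>))" using i1 by simp
  have "expectation (\<lambda>\<omega>. (\<Sum>i=a..<Suc n. c i \<omega> * Y i \<omega>)\<^sup>2)
     = expectation (\<lambda>\<omega>. (?S \<omega>)\<^sup>2) + 2 * expectation (\<lambda>\<omega>. (?S \<omega> * c n \<omega>) * Y n \<omega>) + expectation (\<lambda>\<omega>. (c n \<omega>)\<^sup>2 * (Y n \<omega>)\<^sup>2)"
    unfolding eq
    by (subst Bochner_Integration.integral_add[OF Bochner_Integration.integrable_add[OF IH(3) i21] i2])
       (subst Bochner_Integration.integral_add[OF IH(3) i21], simp)
  moreover have "integrable M (\<lambda>\<omega>. (\<Sum>i=a..<Suc n. c i \<omega> * Y i \<omega>)\<^sup>2)"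
    unfolding eq using IH(3) i21 i2 by simp
  moreover have "(\<lambda>\<omega>. \<Sum>i=a..<Suc n. c i \<omega> * Y i \<omega>) \<in> borel_measurable (F (q (Suc n)))"
    using SF YF step.hyps by simp
  ultimately show ?case
    using IH(1) qn step.hyps unfolding e1 e2 IH(4) by simp
qed

end

section \<open>Elementary integrals with unbounded adapted coefficients\<close>

lemma sum_truncated_le:
  fixes a :: "nat \<Rightarrow> real"
  assumes "\<And>i. 0 \<le> a i" "0 \<le> \<delta>"
  shows "(\<Sum>i<n. if (\<Sum>j\<le>i. a j) \<le> \<delta> then a i else 0) \<le> \<delta>"
proof -
  let ?S = "\<lambda>n. \<Sum>i<n. if (\<Sum>j\<le>i. a j) \<le> \<delta> then a i else 0"
  \<comment> \<open>The second bound makes the induction work: when the new term is kept, the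
    truncated sum is at most the full sum up to and including it, which passes the test. As the test
    includes the current term, there is no overshoot beyond \<open>\<delta>\<close>.\<close>
  have "?S n \<le> \<delta> \<and> ?S n \<le> (\<Sum>i<n. a i)"
  proof (induction n)
    case (Suc n)
    have "(\<Sum>j\<le>n. a j) = (\<Sum>i<n. a i) + a n"
      by (simp flip: lessThan_Suc_atMost)
    with Suc assms(1)[of n] show ?case
      by (cases "(\<Sum>j\<le>n. a j) \<le> \<delta>") auto
  qed (use assms in simp)
  then show ?thesis by simp
qed

lemma sum_blocks:
  fixes f :: "nat \<Rightarrow> real"
  assumes "mono \<phi>" "\<phi> 0 = 0"
  shows "(\<Sum>k<K. \<Sum>i=\<phi> k..<\<phi> (Suc k). f i) = (\<Sum>i<\<phi> K. f i)"
proof (induction K)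
  case (Suc K)
  have "\<phi> K \<le> \<phi> (Suc K)" using assms by (simp add: mono_def)
  then have "(\<Sum>i<\<phi> (Suc K). f i) = (\<Sum>i<\<phi> K. f i) + (\<Sum>i=\<phi> K..<\<phi> (Suc K). f i)"
    by (metis lessThan_atLeast0 sum.atLeastLessThan_concat zero_le)
  then show ?case using Suc by simp
qed (simp add: assms)

lemma (in prob_space) Chebyshev_second_moment:
  fixes Y :: "'a \<Rightarrow> real"
  assumes [measurable]: "Y \<in> borel_measurable M" and "integrable M (\<lambda>\<omega>. (Y \<omega>)\<^sup>2)" "0 < a"
  shows "prob {\<omega> \<in> space M. \<bar>Y \<omega>\<bar> > a} \<le> expectation (\<lambda>\<omega>. (Y \<omega>)\<^sup>2) / a\<^sup>2"
proof -
  have "prob {\<omega> \<in> space M. \<bar>Y \<omega>\<bar> > a} \<le> prob {\<omega> \<in> space M. (Y \<omega>)\<^sup>2 \<ge> a\<^sup>2}"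
  proof (rule finite_measure_mono)
    show "{\<omega> \<in> space M. \<bar>Y \<omega>\<bar> > a} \<subseteq> {\<omega> \<in> space M. (Y \<omega>)\<^sup>2 \<ge> a\<^sup>2}"
      using \<open>0 < a\<close> by (auto simp: abs_le_square_iff[symmetric])
  qed measurable
  also have "\<dots> \<le> expectation (\<lambda>\<omega>. (Y \<omega>)\<^sup>2) / a\<^sup>2"
    by (rule integral_Markov_inequality_measure[where A = "{}"]) (use assms in auto)
  finally show ?thesis .
qed

context adapted_BM
begin

text \<open>A Lenglart type inequality for coefficients without moments. The truncated coefficients
  have quadratic variation at most \<open>\<delta>\<close> on every path, so the isometry and
  Markov's inequality give the term \<open>\<delta> / e\<close>; truncation is active only where the
  quadratic variation exceeds \<open>\<delta>\<close>, which gives the other term.\<close>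

lemma blocks_tail_bound:
  fixes q :: "nat \<Rightarrow> real" and c :: "nat \<Rightarrow> 'a \<Rightarrow> real"
  assumes q0: "0 \<le> q 0" and q: "\<And>i. i < n \<Longrightarrow> q i < q (Suc i)"
    and c: "\<And>i. i < n \<Longrightarrow> c i \<in> borel_measurable (F (q i))"
    and \<phi>: "mono \<phi>" "\<phi> 0 = 0" "\<phi> K = n"
    and e: "0 < e" and \<delta>: "0 \<le> \<delta>"
  shows "prob {\<omega> \<in> space M. (\<Sum>k<K. (\<Sum>i=\<phi> k..<\<phi> (Suc k). c i \<omega> * (W (q (Suc i)) \<omega> - W (q i) \<omega>))\<^sup>2) > e}
    \<le> prob {\<omega> \<in> space M. (\<Sum>i<n. (c i \<omega>)\<^sup>2 * (q (Suc i) - q i)) > \<delta>} + \<delta> / e"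
proof -
  have qpos: "0 \<le> q i" if "i \<le> n" for i
    using that by (induction i) (use q0 q in \<open>auto simp: Suc_le_eq intro: less_imp_le order_trans\<close>)
  have qmono: "q i \<le> q j" if "i \<le> j" "j \<le> n" for i j
    using that by (induction j rule: dec_induct) (auto simp: Suc_le_eq intro: order_trans less_imp_le[OF q])
  \<comment> \<open>The coefficients are cut off, adaptedly, once the accumulated quadratic variation exceeds \<open>\<delta>\<close>.\<close>
  define a where "a i \<omega> = (if i < n then (c i \<omega>)\<^sup>2 * (q (Suc i) - q i) else 0)" for i \<omega>
  have a0: "0 \<le> a i \<omega>" for i \<omega> using q[of i] by (simp add: a_def less_imp_le)
  define c' where "c' i \<omega> = (if (\<Sum>j\<le>i. a j \<omega>) \<le> \<delta> then c i \<omega> else 0)" for i \<omega>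
  have aF: "a j \<in> borel_measurable (F (q i))" if "j \<le> i" "i < n" for i j
    using measurable_F_mono[OF c[of j] qpos[of j] qmono[of j i]] that unfolding a_def by simp
  have c': "c' i \<in> borel_measurable (F (q i))" if "i < n" for i
  proof -
    have [measurable]: "(\<lambda>\<omega>. \<Sum>j\<le>i. a j \<omega>) \<in> borel_measurable (F (q i))"
      using aF that by (intro borel_measurable_sum) auto
    have [measurable]: "c i \<in> borel_measurable (F (q i))" using c that by simp
    show ?thesis unfolding c'_def by measurable
  qed
  have c'M: "c' i \<in> borel_measurable M" "c i \<in> borel_measurable M" if "i < n" for i
    using measurable_F_M[OF c' qpos] measurable_F_M[OF c qpos] that by simp_all
  \<comment> \<open>A coefficient that survives the test contributes at most \<open>\<delta>\<close>
    by itself. This yields the deterministic bound that the isometry requires.\<close>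
  have c'bd: "\<bar>c' i \<omega>\<bar> \<le> sqrt (\<delta> / (q (Suc i) - q i))" if "i < n" for i \<omega>
  proof (cases "(\<Sum>j\<le>i. a j \<omega>) \<le> \<delta>")
    case True
    have "a i \<omega> \<le> (\<Sum>j\<le>i. a j \<omega>)" using a0 by (intro member_le_sum) auto
    then have "(c i \<omega>)\<^sup>2 \<le> \<delta> / (q (Suc i) - q i)"
      using True that q[of i] by (simp add: a_def field_simps)
    then show ?thesis using True real_le_rsqrt[of "\<bar>c i \<omega>\<bar>"] by (simp add: c'_def)
  next
    case False then show ?thesis using \<delta> q[of i] that by (simp add: c'_def)
  qed
  let ?dW = "\<lambda>i \<omega>. W (q (Suc i)) \<omega> - W (q i) \<omega>"
  let ?B = "\<lambda>c k \<omega>. \<Sum>i=\<phi> k..<\<phi> (Suc k). c i \<omega> * ?dW i \<omega>"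
  have lt: "i < n" if "i < \<phi> (Suc k)" "k < K" for i k
    using that \<phi> monoD[OF \<phi>(1), of "Suc k" K] by auto
  have \<phi>n: "\<phi> k \<le> n" if "k \<le> K" for k
    using that \<phi> monoD[OF \<phi>(1), of k K] by auto
  \<comment> \<open>The isometry is applied inside each block; the squares of different blocks are
    only added, so no cross terms between blocks arise.\<close>
  have iso: "integrable M (\<lambda>\<omega>. (?B c' k \<omega>)\<^sup>2) \<and>
    expectation (\<lambda>\<omega>. (?B c' k \<omega>)\<^sup>2) = (\<Sum>i=\<phi> k..<\<phi> (Suc k). expectation (\<lambda>\<omega>. (c' i \<omega>)\<^sup>2) * expectation (\<lambda>\<omega>. (?dW i \<omega>)\<^sup>2))"
    if "k < K" for k
    using martingale_transform_isometry[where a = "\<phi> k" and b = "\<phi> (Suc k)" and q = q and c = c' and Y = ?dW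
        and g = "\<lambda>_ x. x" and C = "\<lambda>i. sqrt (\<delta> / (q (Suc i) - q i))"]
      lt[OF _ that] monoD[OF \<phi>(1), of k "Suc k"] qpos[OF \<phi>n, of k] q c' c'bd
      increment_moments[OF qpos q] that by simp
  have c2i: "integrable M (\<lambda>\<omega>. (c' i \<omega>)\<^sup>2)" if "i < n" for i
  proof (rule integrable_const_bound[where B = "(sqrt (\<delta> / (q (Suc i) - q i)))\<^sup>2"])
    show "AE \<omega> in M. norm ((c' i \<omega>)\<^sup>2) \<le> (sqrt (\<delta> / (q (Suc i) - q i)))\<^sup>2"
      using power_mono[OF c'bd[OF that] abs_ge_zero, of _ 2] by (intro AE_I2) simp
  qed (use c'M[OF that] in simp)
  have "expectation (\<lambda>\<omega>. \<Sum>k<K. (?B c' k \<omega>)\<^sup>2) = (\<Sum>k<K. expectation (\<lambda>\<omega>. (?B c' k \<omega>)\<^sup>2))"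
    using iso by (intro Bochner_Integration.integral_sum) auto
  also have "\<dots> = (\<Sum>k<K. \<Sum>i=\<phi> k..<\<phi> (Suc k). expectation (\<lambda>\<omega>. (c' i \<omega>)\<^sup>2 * (q (Suc i) - q i)))"
  proof (intro sum.cong refl)
    fix k assume "k \<in> {..<K}"
    then have "expectation (\<lambda>\<omega>. (?B c' k \<omega>)\<^sup>2) = (\<Sum>i=\<phi> k..<\<phi> (Suc k). expectation (\<lambda>\<omega>. (c' i \<omega>)\<^sup>2) * expectation (\<lambda>\<omega>. (?dW i \<omega>)\<^sup>2))"
      using iso by blast
    also have "\<dots> = (\<Sum>i=\<phi> k..<\<phi> (Suc k). expectation (\<lambda>\<omega>. (c' i \<omega>)\<^sup>2 * (q (Suc i) - q i)))"
      using lt \<open>k \<in> {..<K}\<close> increment_moments(3)[OF qpos q] by (intro sum.cong) auto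
    finally show "expectation (\<lambda>\<omega>. (?B c' k \<omega>)\<^sup>2) = (\<Sum>i=\<phi> k..<\<phi> (Suc k). expectation (\<lambda>\<omega>. (c' i \<omega>)\<^sup>2 * (q (Suc i) - q i)))" .
  qed
  also have "\<dots> = expectation (\<lambda>\<omega>. \<Sum>i<n. (c' i \<omega>)\<^sup>2 * (q (Suc i) - q i))"
    unfolding sum_blocks[OF \<phi>(1,2)] \<phi>(3) using c2i
    by (intro Bochner_Integration.integral_sum[symmetric]) auto
  also have "\<dots> \<le> \<delta>"
  proof (rule integral_le_const)
    show "integrable M (\<lambda>\<omega>. \<Sum>i<n. (c' i \<omega>)\<^sup>2 * (q (Suc i) - q i))"
      using c2i by (intro Bochner_Integration.integrable_sum) auto
    show "AE \<omega> in M. (\<Sum>i<n. (c' i \<omega>)\<^sup>2 * (q (Suc i) - q i)) \<le> \<delta>"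
    proof (rule AE_I2)
      fix \<omega>
      have "(\<Sum>i<n. (c' i \<omega>)\<^sup>2 * (q (Suc i) - q i)) = (\<Sum>i<n. if (\<Sum>j\<le>i. a j \<omega>) \<le> \<delta> then a i \<omega> else 0)"
        by (intro sum.cong) (auto simp: c'_def a_def)
      also have "\<dots> \<le> \<delta>" by (rule sum_truncated_le) (use a0 \<delta> in auto)
      finally show "(\<Sum>i<n. (c' i \<omega>)\<^sup>2 * (q (Suc i) - q i)) \<le> \<delta>" .
    qed
  qed
  finally have E: "expectation (\<lambda>\<omega>. \<Sum>k<K. (?B c' k \<omega>)\<^sup>2) \<le> \<delta>" .
  have dWM: "?dW i \<in> borel_measurable M" if "i < n" for i
    using measurable_W[OF qpos] that by auto
  have BM: "(\<lambda>\<omega>. \<Sum>k<K. (?B c' k \<omega>)\<^sup>2) \<in> borel_measurable M" "(\<lambda>\<omega>. \<Sum>k<K. (?B c k \<omega>)\<^sup>2) \<in> borel_measurable M"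
    using c'M dWM lt by (auto intro!: borel_measurable_sum borel_measurable_power borel_measurable_times)
  have AM: "(\<lambda>\<omega>. \<Sum>i<n. (c i \<omega>)\<^sup>2 * (q (Suc i) - q i)) \<in> borel_measurable M"
    using c'M by (auto intro!: borel_measurable_sum borel_measurable_power borel_measurable_times)
  have events: "{\<omega> \<in> space M. (\<Sum>i<n. (c i \<omega>)\<^sup>2 * (q (Suc i) - q i)) > \<delta>} \<in> events"
      "{\<omega> \<in> space M. (\<Sum>k<K. (?B c' k \<omega>)\<^sup>2) \<ge> e} \<in> events"
    using borel_measurable_less[OF borel_measurable_const AM] borel_measurable_le[OF borel_measurable_const BM(1)] by simp_all
  have "prob {\<omega> \<in> space M. (\<Sum>k<K. (?B c k \<omega>)\<^sup>2) > e}
    \<le> prob ({\<omega> \<in> space M. (\<Sum>i<n. (c i \<omega>)\<^sup>2 * (q (Suc i) - q i)) > \<delta>} \<union> {\<omega> \<in> space M. (\<Sum>k<K. (?B c' k \<omega>)\<^sup>2) \<ge> e})"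
  proof (rule finite_measure_mono)
    show "{\<omega> \<in> space M. (\<Sum>i<n. (c i \<omega>)\<^sup>2 * (q (Suc i) - q i)) > \<delta>} \<union> {\<omega> \<in> space M. (\<Sum>k<K. (?B c' k \<omega>)\<^sup>2) \<ge> e} \<in> events"
      using events by blast
    show "{\<omega> \<in> space M. (\<Sum>k<K. (?B c k \<omega>)\<^sup>2) > e} \<subseteq>
      {\<omega> \<in> space M. (\<Sum>i<n. (c i \<omega>)\<^sup>2 * (q (Suc i) - q i)) > \<delta>} \<union> {\<omega> \<in> space M. (\<Sum>k<K. (?B c' k \<omega>)\<^sup>2) \<ge> e}"
    proof safe
      fix \<omega> assume \<omega>: "\<omega> \<in> space M" "e < (\<Sum>k<K. (?B c k \<omega>)\<^sup>2)" "\<not> e \<le> (\<Sum>k<K. (?B c' k \<omega>)\<^sup>2)"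
      \<comment> \<open>If the sum for \<open>c\<close> exceeds \<open>e\<close> and the one for
        \<open>c'\<close> does not, some coefficient was cut off, and nonnegativity of the
        \<open>a j\<close> makes the total quadratic variation exceed \<open>\<delta>\<close> as
        well.\<close>
      have "\<exists>i<n. c' i \<omega> \<noteq> c i \<omega>"
      proof (rule ccontr)
        assume "\<not> ?thesis"
        then have "(\<Sum>k<K. (?B c' k \<omega>)\<^sup>2) = (\<Sum>k<K. (?B c k \<omega>)\<^sup>2)"
          using lt by (intro sum.cong refl arg_cong[where f = "\<lambda>x. x\<^sup>2"]) auto
        with \<omega> show False by simp
      qed
      then obtain i where "i < n" "\<not> (\<Sum>j\<le>i. a j \<omega>) \<le> \<delta>" by (auto simp: c'_def split: if_splits)
      moreover have "(\<Sum>j\<le>i. a j \<omega>) \<le> (\<Sum>j<n. a j \<omega>)"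
        using \<open>i < n\<close> a0 by (intro sum_mono2) auto
      moreover have "(\<Sum>j<n. a j \<omega>) = (\<Sum>i<n. (c i \<omega>)\<^sup>2 * (q (Suc i) - q i))" by (simp add: a_def)
      ultimately show "\<delta> < (\<Sum>i<n. (c i \<omega>)\<^sup>2 * (q (Suc i) - q i))" by simp
    qed
  qed
  also have "\<dots> \<le> prob {\<omega> \<in> space M. (\<Sum>i<n. (c i \<omega>)\<^sup>2 * (q (Suc i) - q i)) > \<delta>} + prob {\<omega> \<in> space M. (\<Sum>k<K. (?B c' k \<omega>)\<^sup>2) \<ge> e}"
    by (rule measure_Un_le[OF events])
  also have "prob {\<omega> \<in> space M. (\<Sum>k<K. (?B c' k \<omega>)\<^sup>2) \<ge> e} \<le> expectation (\<lambda>\<omega>. \<Sum>k<K. (?B c' k \<omega>)\<^sup>2) / e"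
    by (rule integral_Markov_inequality_measure[where A = "{}"])
       (use e iso in \<open>auto intro!: Bochner_Integration.integrable_sum sum_nonneg\<close>)
  also have "\<dots> \<le> \<delta> / e" using E e by (simp add: divide_right_mono)
  finally show ?thesis by simp
qed

text \<open>The free choice of blocks matters: a single block controls the square of the whole sum,
  the blocks of a coarse grid control the sum of the squared remainders.\<close>

lemma null_in_prob_blocks:
  fixes q :: "nat \<Rightarrow> nat \<Rightarrow> real" and c :: "nat \<Rightarrow> nat \<Rightarrow> 'a \<Rightarrow> real"
  assumes q0: "\<And>n. 0 \<le> q n 0" and q: "\<And>n i. i < N n \<Longrightarrow> q n i < q n (Suc i)"
    and c: "\<And>n i. i < N n \<Longrightarrow> c n i \<in> borel_measurable (F (q n i))"
    and \<phi>: "\<And>n. mono (\<phi> n)" "\<And>n. \<phi> n 0 = 0" "\<And>n. \<phi> n (K n) = N n"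
    and null: "null_in_prob (\<lambda>n \<omega>. \<Sum>i<N n. (c n i \<omega>)\<^sup>2 * (q n (Suc i) - q n i))"
  shows "null_in_prob (\<lambda>n \<omega>. \<Sum>k<K n. (\<Sum>i=\<phi> n k..<\<phi> n (Suc k). c n i \<omega> * (W (q n (Suc i)) \<omega> - W (q n i) \<omega>))\<^sup>2)"
  unfolding null_in_prob_def
proof (intro allI impI)
  fix e :: real assume e: "0 < e"
  let ?A = "\<lambda>n \<omega>. \<Sum>i<N n. (c n i \<omega>)\<^sup>2 * (q n (Suc i) - q n i)"
  let ?B = "\<lambda>n \<omega>. \<Sum>k<K n. (\<Sum>i=\<phi> n k..<\<phi> n (Suc k). c n i \<omega> * (W (q n (Suc i)) \<omega> - W (q n i) \<omega>))\<^sup>2"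
  have B: "\<bar>?B n \<omega>\<bar> = ?B n \<omega>" for n \<omega> by (simp add: sum_nonneg)
  have A: "\<bar>?A n \<omega>\<bar> = ?A n \<omega>" for n \<omega> by (intro abs_of_nonneg sum_nonneg mult_nonneg_nonneg) (use q in \<open>auto simp: less_imp_le\<close>)
  show "(\<lambda>n. prob {\<omega> \<in> space M. \<bar>?B n \<omega>\<bar> > e}) \<longlonglongrightarrow> 0"
  proof (rule LIMSEQ_I)
    fix r :: real assume r: "0 < r"
    \<comment> \<open>The level \<open>\<delta> = e * r / 2\<close> turns the term
      \<open>\<delta> / e\<close> of \<open>blocks_tail_bound\<close> into
      \<open>r / 2\<close>.\<close>
    have "0 < e * r / 2" using e r by simp
    with null have "(\<lambda>n. prob {\<omega> \<in> space M. \<bar>?A n \<omega>\<bar> > e * r / 2}) \<longlonglongrightarrow> 0"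
      unfolding null_in_prob_def by blast
    then have "(\<lambda>n. prob {\<omega> \<in> space M. ?A n \<omega> > e * r / 2}) \<longlonglongrightarrow> 0" unfolding A .
    then have "eventually (\<lambda>n. prob {\<omega> \<in> space M. ?A n \<omega> > e * r / 2} < r / 2) sequentially"
      by (rule order_tendstoD) (use r in simp)
    then have "eventually (\<lambda>n. norm (prob {\<omega> \<in> space M. \<bar>?B n \<omega>\<bar> > e} - 0) < r) sequentially"
    proof eventually_elim
      case (elim n)
      have "prob {\<omega> \<in> space M. ?B n \<omega> > e} \<le> prob {\<omega> \<in> space M. ?A n \<omega> > e * r / 2} + (e * r / 2) / e"
        by (rule blocks_tail_bound) (use q0 q c \<phi> e r in auto)
      also have "\<dots> < r" using elim e by (simp add: field_simps)
      finally show ?case unfolding B by simp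
    qed
    then show "\<exists>no. \<forall>n\<ge>no. norm (prob {\<omega> \<in> space M. \<bar>?B n \<omega>\<bar> > e} - 0) < r"
      by (simp add: eventually_sequentially)
  qed
qed

section \<open>Path properties of Brownian motion: quadratic variation and growth\<close>

lemma quadratic_variation:
  fixes T :: real
  assumes T: "0 < T"
  shows "AE \<omega> in M. (\<lambda>n. \<Sum>i<2^n. (W (T * Suc i / 2^n) \<omega> - W (T * i / 2^n) \<omega>)\<^sup>2) \<longlonglongrightarrow> T"
proof -
  let ?q = "\<lambda>n i :: nat. T * i / 2^n"
  have q: "0 \<le> ?q n i" "?q n i < ?q n (Suc i)" "?q n (Suc i) - ?q n i = T / 2^n" for n i
    using T by (auto simp: field_simps)
  let ?g = "\<lambda>n x. x\<^sup>2 - T / 2^n"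
  let ?Y = "\<lambda>n i \<omega>. ?g n (W (?q n (Suc i)) \<omega> - W (?q n i) \<omega>)"
  \<comment> \<open>The factor \<open>1\<close> is the coefficient \<open>c i\<close> in
    \<open>martingale_transform_isometry\<close>, which is applied to centred squares here. The
    fourth moment of the increments gives their second moments.\<close>
  let ?S = "\<lambda>n \<omega>. \<Sum>i=0..<2^n. 1 * ?Y n i \<omega>"
  note mom = increment_moments[OF q(1,2)]
  have Y1: "expectation (?Y n i) = 0" for n i
    using mom(1)[of i n 2] mom(3)[of i n] q(3)[of i n] by (simp add: prob_space)
  have Y2eq: "(\<lambda>\<omega>. (?Y n i \<omega>)\<^sup>2) = (\<lambda>\<omega>. (W (?q n (Suc i)) \<omega> - W (?q n i) \<omega>)^4
      - 2 * (T / 2^n) * (W (?q n (Suc i)) \<omega> - W (?q n i) \<omega>)\<^sup>2 + (T / 2^n)\<^sup>2)" for n i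
    by (auto simp: power2_eq_square power4_eq_xxxx algebra_simps)
  have Y2i: "integrable M (\<lambda>\<omega>. (?Y n i \<omega>)\<^sup>2)" for n i
    unfolding Y2eq using mom(1)[of i n 2] mom(1)[of i n 4] by simp
  have Y2: "expectation (\<lambda>\<omega>. (?Y n i \<omega>)\<^sup>2) = 2 * (T / 2^n)\<^sup>2" for n i
    unfolding Y2eq using mom(1)[of i n 2] mom(1)[of i n 4] mom(3)[of i n] mom(4)[of i n] q(3)[of i n]
    by (simp add: prob_space power2_eq_square)
  have S: "?S n \<in> borel_measurable M" "integrable M (\<lambda>\<omega>. (?S n \<omega>)\<^sup>2)"
    "expectation (\<lambda>\<omega>. (?S n \<omega>)\<^sup>2) = 2 * T\<^sup>2 * (1/2)^n" for n
  proof -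
    have *: "0 \<le> ?q n (2^n) \<and> ?S n \<in> borel_measurable (F (?q n (2^n))) \<and> integrable M (\<lambda>\<omega>. (?S n \<omega>)\<^sup>2) \<and>
      expectation (\<lambda>\<omega>. (?S n \<omega>)\<^sup>2) = (\<Sum>i=0..<2^n. expectation (\<lambda>\<omega>. 1\<^sup>2) * expectation (\<lambda>\<omega>. (?Y n i \<omega>)\<^sup>2))"
      by (rule martingale_transform_isometry[where g = "\<lambda>_. ?g n" and C = "\<lambda>_. 1"])
         (use q(1,2) Y1 Y2i in auto)
    then show "?S n \<in> borel_measurable M" "integrable M (\<lambda>\<omega>. (?S n \<omega>)\<^sup>2)"
      using measurable_F_M by blast+
    show "expectation (\<lambda>\<omega>. (?S n \<omega>)\<^sup>2) = 2 * T\<^sup>2 * (1/2)^n"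
      using * unfolding Y2 by (simp add: prob_space power2_eq_square field_simps)
  qed
  have "AE \<omega> in M. (\<lambda>n. ?S n \<omega>) \<longlonglongrightarrow> 0"
  proof (rule AE_tendsto_zero_of_tails)
    \<comment> \<open>The second moment decays like \<open>(1/2)^n\<close>. The base
      \<open>3/4\<close> lies between \<open>1/2\<close> and \<open>1\<close>: the thresholds
      \<open>sqrt (3/4)^n\<close> tend to \<open>0\<close>, while the Chebyshev bounds keep the
      summable ratio \<open>(2/3)^n\<close>. This speed of the dyadic grids gives almost sure
      convergence without a subsequence.\<close>
    show "prob {\<omega> \<in> space M. \<bar>?S n \<omega>\<bar> > sqrt (3/4)^n} \<le> 2 * T\<^sup>2 * (2/3)^n" for n
    proof -
      have "prob {\<omega> \<in> space M. \<bar>?S n \<omega>\<bar> > sqrt (3/4)^n} \<le> expectation (\<lambda>\<omega>. (?S n \<omega>)\<^sup>2) / (sqrt (3/4)^n)\<^sup>2"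
        by (rule Chebyshev_second_moment[OF S(1,2)]) simp
      also have "(sqrt (3/4)^n)\<^sup>2 = (3/4 :: real)^n" by (simp flip: power_mult add: mult.commute[of n 2]) (simp add: power_mult)
      also have "expectation (\<lambda>\<omega>. (?S n \<omega>)\<^sup>2) / (3/4)^n = 2 * T\<^sup>2 * ((1/2)^n / (3/4)^n)" unfolding S(3) by simp
      also have "(1/2 :: real)^n / (3/4)^n = (2/3)^n" by (simp flip: power_divide)
      finally show ?thesis .
    qed
    show "summable (\<lambda>n. 2 * T\<^sup>2 * (2/3)^n)" by (intro summable_mult summable_geometric) simp
    show "(\<lambda>n. sqrt (3/4)^n) \<longlonglongrightarrow> 0" by (rule LIMSEQ_power_zero) simp
  qed (rule S(1))
  then show ?thesis
  proof eventually_elim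
    case (elim \<omega>)
    have "?S n \<omega> + T = (\<Sum>i<2^n. (W (T * Suc i / 2^n) \<omega> - W (T * i / 2^n) \<omega>)\<^sup>2)" for n
      by (simp add: sum_subtractf lessThan_atLeast0)
    with tendsto_add[OF elim tendsto_const[of T]] show ?case by simp
  qed
qed

text \<open>The maximum is reduced to a single variable, the walk stopped at its first exit: on the
  event it equals the exit value, and by the isometry its second moment is at most the elapsed time.
  Chebyshev's inequality concludes.\<close>

lemma maximal_inequality:
  fixes q :: "nat \<Rightarrow> real"
  assumes q0: "0 \<le> q 0" and q: "\<And>i. q i < q (Suc i)" and a: "0 < a"
  shows "prob {\<omega> \<in> space M. \<exists>i\<le>n. \<bar>W (q i) \<omega> - W (q 0) \<omega>\<bar> > a} \<le> (q n - q 0) / a\<^sup>2"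
proof -
  have qpos: "0 \<le> q i" for i by (induction i) (use q0 q in \<open>auto intro: less_imp_le order_trans\<close>)
  have qmono: "q i \<le> q j" if "i \<le> j" for i j by (rule lift_Suc_mono_le[where f = q, OF less_imp_le[OF q] that])
  \<comment> \<open>With these coefficients the transform is \<open>W - W (q 0)\<close> stopped when it first leaves \<open>[-a, a]\<close>.\<close>
  define c :: "nat \<Rightarrow> 'a \<Rightarrow> real" where "c i \<omega> = (if \<forall>j\<in>{..i}. \<bar>W (q j) \<omega> - W (q 0) \<omega>\<bar> \<le> a then 1 else 0)" for i \<omega>
  have c: "c i \<in> borel_measurable (F (q i))" for i
  proof -
    have WF: "W (q j) \<in> borel_measurable (F (q i))" if "j \<le> i" for j
      using measurable_F_mono[OF adapted[OF qpos] qpos qmono[OF that]] .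
    have "{\<omega> \<in> space (F (q i)). \<bar>W (q j) \<omega> - W (q 0) \<omega>\<bar> \<le> a} \<in> sets (F (q i))" if "j \<le> i" for j
      using WF[OF that] WF[OF le0] by (intro borel_measurable_le) auto
    then have "{\<omega> \<in> space (F (q i)). \<forall>j\<in>{..i}. \<bar>W (q j) \<omega> - W (q 0) \<omega>\<bar> \<le> a} \<in> sets (F (q i))"
      by (intro sets.sets_Collect_finite_All) auto
    then show ?thesis unfolding c_def by (intro measurable_If) auto
  qed
  let ?dW = "\<lambda>i \<omega>. W (q (Suc i)) \<omega> - W (q i) \<omega>"
  let ?S = "\<lambda>\<omega>. \<Sum>i=0..<n. c i \<omega> * ?dW i \<omega>"
  have c1: "\<bar>c i \<omega>\<bar> \<le> 1" for i \<omega> by (simp add: c_def)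
  have *: "0 \<le> q n \<and> ?S \<in> borel_measurable (F (q n)) \<and> integrable M (\<lambda>\<omega>. (?S \<omega>)\<^sup>2) \<and>
    expectation (\<lambda>\<omega>. (?S \<omega>)\<^sup>2) = (\<Sum>i=0..<n. expectation (\<lambda>\<omega>. (c i \<omega>)\<^sup>2) * expectation (\<lambda>\<omega>. (?dW i \<omega>)\<^sup>2))"
    by (rule martingale_transform_isometry[where g = "\<lambda>_ x. x" and C = "\<lambda>_. 1"])
       (use c q qpos c1 increment_moments[OF qpos q] in auto)
  have SM: "?S \<in> borel_measurable M" using * measurable_F_M by blast
  have "expectation (\<lambda>\<omega>. (c i \<omega>)\<^sup>2) \<le> 1" for i
  proof (rule integral_le_const)
    show "integrable M (\<lambda>\<omega>. (c i \<omega>)\<^sup>2)"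
    proof (rule integrable_const_bound[where B = 1])
      show "(\<lambda>\<omega>. (c i \<omega>)\<^sup>2) \<in> borel_measurable M"
        using measurable_F_M[OF c qpos] by (intro borel_measurable_power)
    qed (simp add: c_def)
  qed (simp add: c_def)
  then have "(\<Sum>i=0..<n. expectation (\<lambda>\<omega>. (c i \<omega>)\<^sup>2) * (q (Suc i) - q i)) \<le> (\<Sum>i=0..<n. 1 * (q (Suc i) - q i))"
    using q by (intro sum_mono mult_right_mono) (simp_all add: less_imp_le)
  then have "expectation (\<lambda>\<omega>. (?S \<omega>)\<^sup>2) \<le> (\<Sum>i=0..<n. 1 * (q (Suc i) - q i))"
    using * increment_moments(3)[OF qpos q] by simp
  also have "\<dots> = q n - q 0" using sum_lessThan_telescope[of q n] by (simp add: lessThan_atLeast0)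
  finally have ES: "expectation (\<lambda>\<omega>. (?S \<omega>)\<^sup>2) \<le> q n - q 0" .
  have "prob {\<omega> \<in> space M. \<exists>i\<le>n. \<bar>W (q i) \<omega> - W (q 0) \<omega>\<bar> > a} \<le> prob {\<omega> \<in> space M. \<bar>?S \<omega>\<bar> > a}"
  proof (rule finite_measure_mono)
    show "{\<omega> \<in> space M. \<bar>?S \<omega>\<bar> > a} \<in> events" using SM by measurable
    show "{\<omega> \<in> space M. \<exists>i\<le>n. \<bar>W (q i) \<omega> - W (q 0) \<omega>\<bar> > a} \<subseteq> {\<omega> \<in> space M. \<bar>?S \<omega>\<bar> > a}"
    proof safe
      fix \<omega> i assume "i \<le> n" "a < \<bar>W (q i) \<omega> - W (q 0) \<omega>\<bar>"
      \<comment> \<open>The coefficient \<open>c j\<close> is \<open>1\<close> exactly for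
        \<open>j < m\<close>, so the last increment counted is the one that leads to the first exit
        point \<open>q m\<close>.\<close>
      define m where "m = (LEAST i. a < \<bar>W (q i) \<omega> - W (q 0) \<omega>\<bar>)"
      have m: "a < \<bar>W (q m) \<omega> - W (q 0) \<omega>\<bar>" "m \<le> i"
        unfolding m_def using \<open>a < _\<close> by (auto intro: LeastI Least_le)
      have lt: "\<not> a < \<bar>W (q j) \<omega> - W (q 0) \<omega>\<bar>" if "j < m" for j
        using that not_less_Least unfolding m_def by blast
      have ci: "c j \<omega> = (if j < m then 1 else 0)" for j
        using lt m(1) unfolding c_def by (metis atMost_iff le_less_trans not_le)
      have "?S \<omega> = (\<Sum>j\<in>{0..<n}. if j < m then ?dW j \<omega> else 0)"
        by (intro sum.cong) (auto simp: ci)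
      also have "\<dots> = (\<Sum>j<m. ?dW j \<omega>)"
        using m(2) \<open>i \<le> n\<close> by (subst sum.inter_filter[symmetric]) (auto intro!: sum.cong)
      also have "\<dots> = W (q m) \<omega> - W (q 0) \<omega>" by (rule sum_lessThan_telescope)
      finally show "a < \<bar>?S \<omega>\<bar>" using m by simp
    qed
  qed
  also have "\<dots> \<le> expectation (\<lambda>\<omega>. (?S \<omega>)\<^sup>2) / a\<^sup>2"
    using Chebyshev_second_moment[OF SM _ a] * by blast
  also have "\<dots> \<le> (q n - q 0) / a\<^sup>2" using ES by (simp add: divide_right_mono)
  finally show ?thesis .
qed

end

text \<open>The bound of \<open>maximal_inequality\<close> does not depend on the grid, so it
  survives the increasing union over dyadic grids; continuity carries the estimate from dyadic times
  to all times. An explicit event \<open>A\<close> avoids the measurability of a supremum over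
  uncountably many times, and continuity is asked of the individual path only.\<close>

lemma (in adapted_BM) running_max_tail:
  fixes T a :: real
  assumes T: "0 < T" and a: "0 < a"
  shows "\<exists>A\<in>events. prob A \<le> T / a\<^sup>2 \<and>
    (\<forall>\<omega>\<in>space M - A. continuous_on {0..} (\<lambda>t. W t \<omega>) \<longrightarrow> (\<forall>t\<in>{0..T}. \<bar>W t \<omega> - W 0 \<omega>\<bar> \<le> a))"
proof -
  define A where "A m = {\<omega> \<in> space M. \<exists>i\<le>2^m. \<bar>W (T * real i / 2^m) \<omega> - W 0 \<omega>\<bar> > a}" for m :: nat
  have A: "A m \<in> events" for m
  proof -
    have "{\<omega> \<in> space M. \<bar>W (T * real i / 2^m) \<omega> - W 0 \<omega>\<bar> > a} \<in> events" for i
      using measurable_W[of "T * real i / 2^m"] measurable_W[of 0] T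
      by (intro borel_measurable_less) auto
    then have "{\<omega> \<in> space M. \<exists>i\<in>{..2^m}. \<bar>W (T * real i / 2^m) \<omega> - W 0 \<omega>\<bar> > a} \<in> events"
      by (intro sets.sets_Collect_finite_Ex) auto
    then show ?thesis by (simp only: A_def Bex_def atMost_iff)
  qed
  have pA: "prob (A m) \<le> T / a\<^sup>2" for m
  proof -
    have "prob {\<omega> \<in> space M. \<exists>i\<le>2^m. \<bar>W (T * real i / 2^m) \<omega> - W (T * real 0 / 2^m) \<omega>\<bar> > a}
      \<le> (T * real (2^m) / 2^m - T * real 0 / 2^m) / a\<^sup>2"
      using T by (intro maximal_inequality a) (simp_all add: divide_strict_right_mono)
    then show ?thesis by (simp add: A_def)
  qed
  have "A m \<subseteq> A (Suc m)" for m
  proof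
    fix \<omega> assume "\<omega> \<in> A m"
    then obtain i where i: "\<omega> \<in> space M" "i \<le> 2^m" "\<bar>W (T * real i / 2^m) \<omega> - W 0 \<omega>\<bar> > a"
      by (auto simp: A_def)
    \<comment> \<open>The grid point with index \<open>i\<close> has index \<open>2 * i\<close> in
      the next finer grid.\<close>
    have "a < \<bar>W (T * real (2 * i) / 2^Suc m) \<omega> - W 0 \<omega>\<bar>" using i by simp
    then show "\<omega> \<in> A (Suc m)" using i unfolding A_def
      by (intro CollectI conjI exI[of _ "2 * i"]) (auto simp del: of_nat_mult power_Suc, simp)
  qed
  then have inc: "incseq A" by (rule incseq_SucI)
  have lim: "(\<lambda>m. prob (A m)) \<longlonglongrightarrow> prob (\<Union>m. A m)"
    using A inc by (intro finite_Lim_measure_incseq) auto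
  show ?thesis
  proof (intro bexI[of _ "\<Union>m. A m"] conjI ballI impI)
    show "prob (\<Union>m. A m) \<le> T / a\<^sup>2"
      by (rule LIMSEQ_le_const2[OF lim]) (use pA in auto)
    show "(\<Union>m. A m) \<in> events" using A by auto
    fix \<omega> t assume \<omega>: "\<omega> \<in> space M - (\<Union>m. A m)" and c: "continuous_on {0..} (\<lambda>t. W t \<omega>)" and t: "t \<in> {0..T}"
    \<comment> \<open>The index of the last point of the grid of level \<open>m\<close> that does
      not exceed \<open>t\<close>; these points converge to \<open>t\<close> from below.\<close>
    define i where "i m = nat \<lfloor>t * 2^m / T\<rfloor>" for m :: nat
    have i: "real (i m) = of_int \<lfloor>t * 2^m / T\<rfloor>" for m
      using t T by (simp add: i_def)
    have le: "i m \<le> 2^m" for m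
    proof -
      have "real (i m) \<le> t * 2^m / T" unfolding i by simp
      also have "\<dots> \<le> 2^m" using t T by (simp add: field_simps mult_right_mono)
      finally show ?thesis by (simp flip: of_nat_le_iff)
    qed
    have lower: "t - T / 2^m \<le> T * real (i m) / 2^m" and upper: "T * real (i m) / 2^m \<le> t" for m
    proof -
      have "t * 2^m / T - 1 \<le> real (i m)" "real (i m) \<le> t * 2^m / T" unfolding i by linarith+
      then have "t * 2^m - T \<le> T * real (i m)" "T * real (i m) \<le> t * 2^m" using T by (simp_all add: field_simps)
      then have "(t * 2^m - T) / 2^m \<le> T * real (i m) / 2^m" "T * real (i m) / 2^m \<le> t * 2^m / 2^m"
        by (blast intro: divide_right_mono zero_le_power zero_le_numeral)+
      then show "t - T / 2^m \<le> T * real (i m) / 2^m" "T * real (i m) / 2^m \<le> t"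
        by (simp_all add: diff_divide_distrib)
    qed
    have "(\<lambda>m. t - T * (1/2)^m) \<longlonglongrightarrow> t - T * 0"
      by (intro tendsto_intros LIMSEQ_power_zero) simp
    then have "(\<lambda>m. t - T / 2^m) \<longlonglongrightarrow> t" by (simp add: power_one_over field_simps)
    then have "(\<lambda>m. T * real (i m) / 2^m) \<longlonglongrightarrow> t"
      by (rule tendsto_sandwich[OF _ _ _ tendsto_const, rotated 2]) (use lower upper in auto)
    then have "(\<lambda>m. W (T * real (i m) / 2^m) \<omega>) \<longlonglongrightarrow> W t \<omega>"
      by (rule continuous_on_tendsto_compose[OF c]) (use t T in auto)
    then have "(\<lambda>m. \<bar>W (T * real (i m) / 2^m) \<omega> - W 0 \<omega>\<bar>) \<longlonglongrightarrow> \<bar>W t \<omega> - W 0 \<omega>\<bar>"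
      by (intro tendsto_intros)
    moreover have "\<bar>W (T * real (i m) / 2^m) \<omega> - W 0 \<omega>\<bar> \<le> a" for m
      using \<omega> le[of m] by (auto simp: A_def not_less)
    ultimately show "\<bar>W t \<omega> - W 0 \<omega>\<bar> \<le> a"
      by (intro LIMSEQ_le_const2) auto
  qed
qed

text \<open>On \<open>[0, 2^Suc n]\<close> the running maximum exceeds \<open>2^n / Suc k\<close>
  with probability at most \<open>2 * (Suc k)\<^sup>2 * (1/2)^n\<close>, which is summable in
  \<open>n\<close>. By Borel-Cantelli the bound eventually holds, and for \<open>t\<close> between
  \<open>2^n\<close> and \<open>2^Suc n\<close> it reads
  \<open>\<bar>W t\<bar> \<le> t / Suc k\<close>.\<close>

lemma (in adapted_BM) sublinear_growth: "AE \<omega> in M. ((\<lambda>t. W t \<omega> / t) \<longlongrightarrow> 0) at_top"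
proof -
  have ev: "AE \<omega> in M. eventually (\<lambda>n. \<forall>t\<in>{0..2^Suc n}. \<bar>W t \<omega>\<bar> \<le> 2^n / Suc k) sequentially" for k :: nat
  proof -
    have "\<exists>A\<in>events. prob A \<le> 2^Suc n / (2^n / Suc k)\<^sup>2 \<and>
      (\<forall>\<omega>\<in>space M - A. continuous_on {0..} (\<lambda>t. W t \<omega>) \<longrightarrow> (\<forall>t\<in>{0..2^Suc n}. \<bar>W t \<omega> - W 0 \<omega>\<bar> \<le> 2^n / Suc k))" for n
      by (rule running_max_tail) auto
    then obtain A where A: "\<And>n. A n \<in> events" "\<And>n. prob (A n) \<le> 2^Suc n / (2^n / Suc k)\<^sup>2"
      "\<And>n \<omega> t. \<omega> \<in> space M - A n \<Longrightarrow> continuous_on {0..} (\<lambda>t. W t \<omega>) \<Longrightarrow> t \<in> {0..2^Suc n} \<Longrightarrow> \<bar>W t \<omega> - W 0 \<omega>\<bar> \<le> 2^n / Suc k"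
      by metis
    have eq: "2^Suc n / (2^n / Suc k)\<^sup>2 = 2 * (real (Suc k))\<^sup>2 * (1/2)^n" for n :: nat
      by (simp add: field_simps power2_eq_square power_one_over)
    have "AE \<omega> in M. eventually (\<lambda>n. \<omega> \<in> space M - A n) sequentially"
    proof (rule borel_cantelli_AE1[OF A(1)])
      show "summable (\<lambda>n. prob (A n))"
        by (rule summable_comparison_test'[where g = "\<lambda>n. 2 * (real (Suc k))\<^sup>2 * (1/2)^n" and N = 0])
           (use A(2)[unfolded eq] in \<open>auto intro!: summable_mult summable_geometric\<close>)
    qed (simp add: emeasure_eq_measure)
    then show ?thesis using cont start
    proof eventually_elim
      case (elim \<omega>)
      from elim(1) show ?case
      proof eventually_elim
        case (elim n)
        show ?case using A(3)[OF elim \<open>continuous_on {0..} (\<lambda>t. W t \<omega>)\<close>] \<open>W 0 \<omega> = 0\<close> by (intro ballI) simp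
      qed
    qed
  qed
  then have "AE \<omega> in M. \<forall>k. eventually (\<lambda>n. \<forall>t\<in>{0..2^Suc n}. \<bar>W t \<omega>\<bar> \<le> 2^n / Suc k) sequentially"
    by (simp add: AE_all_countable)
  then show ?thesis
  proof eventually_elim
    case (elim \<omega>)
    show ?case
    proof (rule tendstoI)
      fix e :: real assume "0 < e"
      then obtain k where k: "1 / Suc k < e" using nat_approx_posE by metis
      obtain N where N: "\<And>n t. n \<ge> N \<Longrightarrow> 0 \<le> t \<Longrightarrow> t \<le> 2^Suc n \<Longrightarrow> \<bar>W t \<omega>\<bar> \<le> 2^n / Suc k"
        using elim[rule_format, of k] unfolding eventually_sequentially by (metis atLeastAtMost_iff)
      have "eventually (\<lambda>t::real. t \<ge> 2^N) at_top" by (rule eventually_ge_at_top)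
      then show "eventually (\<lambda>t. dist (W t \<omega> / t) 0 < e) at_top"
      proof eventually_elim
        case (elim t)
        have t: "0 < t" by (rule less_le_trans[OF _ elim]) simp
        \<comment> \<open>Minimality gives \<open>2^n \<le> t\<close> unless \<open>n = 0\<close>,
          and then \<open>1 \<le> t\<close> gives it.\<close>
        define n where "n = (LEAST n. t \<le> 2^Suc n)"
        obtain m where "t < 2^m" using real_arch_pow[of 2 t] by auto
        also have "(2::real)^m \<le> 2^Suc m" by simp
        finally have "t \<le> 2^Suc m" by simp
        then have n1: "t \<le> 2^Suc n" unfolding n_def by (rule LeastI)
        have n2: "2^n \<le> t \<or> n = 0"
        proof (cases n)
          case (Suc j)
          then have "\<not> t \<le> 2^Suc j" using not_less_Least[of j "\<lambda>n. t \<le> 2^Suc n"] unfolding n_def by auto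
          then show ?thesis using Suc by simp
        qed simp
        have "1 \<le> t" by (rule order_trans[OF _ elim]) simp
        with n2 have n2: "2^n \<le> t" by auto
        have bd: "\<bar>W t \<omega>\<bar> \<le> t / Suc k"
        proof (cases "N \<le> n")
          case True
          have "\<bar>W t \<omega>\<bar> \<le> 2^n / Suc k" using N[OF True _ n1] t by simp
          also have "\<dots> \<le> t / Suc k" using n2 by (simp add: divide_right_mono)
          finally show ?thesis .
        next
          case False
          \<comment> \<open>The boundary case: \<open>2^N \<le> t \<le> 2^Suc n \<le> 2^N\<close>
            forces \<open>t = 2^N\<close>, which is covered by the bound at level \<open>N\<close>
            itself.\<close>
          then have "(2::real)^Suc n \<le> 2^N" by (intro power_increasing) auto
          then have "t = 2^N" using n1 elim by simp
          then have "\<bar>W t \<omega>\<bar> \<le> 2^N / Suc k" using N[of N t] by simp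
          then show ?thesis using \<open>t = 2^N\<close> by simp
        qed
        have "\<bar>W t \<omega> / t\<bar> \<le> 1 / Suc k" using bd t by (simp add: field_simps)
        then show ?case using k by simp
      qed
    qed
  qed
qed

text \<open>The exponent is \<open>- t\<close> times a bracket that tends to
  \<open>lam + \<sigma>\<^sup>2 / 2\<close>, a positive number.\<close>

lemma (in adapted_BM) geometric_BM_tendsto_zero:
  fixes lam \<sigma> :: real
  assumes "0 < lam"
  shows "AE \<omega> in M. ((\<lambda>t. exp (- (lam * t + \<sigma> * W t \<omega> + \<sigma>\<^sup>2 * t / 2))) \<longlongrightarrow> 0) at_top"
  using sublinear_growth
proof eventually_elim
  case (elim \<omega>)
  have "((\<lambda>t. lam + \<sigma> * (W t \<omega> / t) + \<sigma>\<^sup>2 / 2) \<longlongrightarrow> lam + \<sigma> * 0 + \<sigma>\<^sup>2 / 2) at_top"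
    by (intro tendsto_intros elim)
  then have "filterlim (\<lambda>t. (lam + \<sigma> * (W t \<omega> / t) + \<sigma>\<^sup>2 / 2) * t) at_top at_top"
    by (rule filterlim_tendsto_pos_mult_at_top) (use assms in \<open>auto intro: add_pos_nonneg filterlim_ident\<close>)
  moreover have "eventually (\<lambda>t. (lam + \<sigma> * (W t \<omega> / t) + \<sigma>\<^sup>2 / 2) * t = lam * t + \<sigma> * W t \<omega> + \<sigma>\<^sup>2 * t / 2) at_top"
    using eventually_gt_at_top[of 0] by eventually_elim (simp add: field_simps)
  ultimately have "filterlim (\<lambda>t. lam * t + \<sigma> * W t \<omega> + \<sigma>\<^sup>2 * t / 2) at_top at_top"
    using filterlim_cong[OF refl refl] by fastforce
  then have "filterlim (\<lambda>t. - (lam * t + \<sigma> * W t \<omega> + \<sigma>\<^sup>2 * t / 2)) at_bot at_top"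
    by (rule filterlim_compose[OF filterlim_uminus_at_bot_at_top])
  then show ?case by (rule filterlim_compose[OF exp_at_bot])
qed

section \<open>The linear equation along a path\<close>

lemma dyadic_oscillation:
  fixes f :: "real \<Rightarrow> real"
  assumes T: "0 < T" and f: "continuous_on {0..T} f" and \<eta>: "0 < \<eta>"
  shows "eventually (\<lambda>n. \<forall>k<2^n. \<forall>s\<in>{T * real k / 2^n..T * real (Suc k) / 2^n}. \<bar>f s - f (T * real k / 2^n)\<bar> < \<eta>) sequentially"
proof -
  have "uniformly_continuous_on {0..T} f" using f by (rule compact_uniformly_continuous) simp
  then obtain d where d: "0 < d" "\<And>x y. x \<in> {0..T} \<Longrightarrow> y \<in> {0..T} \<Longrightarrow> dist y x < d \<Longrightarrow> dist (f y) (f x) < \<eta>"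
    using \<eta> unfolding uniformly_continuous_on_def by metis
  have "(\<lambda>n. T * (1/2)^n) \<longlonglongrightarrow> T * 0"
    by (intro tendsto_intros LIMSEQ_power_zero) simp
  then have "eventually (\<lambda>n. T * (1/2)^n < d) sequentially"
    by (rule order_tendstoD(2)) (use d in simp)
  then show ?thesis
  proof eventually_elim
    case (elim n)
    show ?case
    proof safe
      fix k :: nat and s assume k: "k < 2^n" and s: "s \<in> {T * real k / 2^n..T * real (Suc k) / 2^n}"
      have 0: "0 \<le> T * real k / 2^n" using T by simp
      have "real (Suc k) \<le> 2^n" using k by (metis Suc_leI of_nat_le_iff of_nat_numeral of_nat_power)
      then have "T * real (Suc k) \<le> T * 2^n" using T by (intro mult_left_mono) simp_all
      then have 1: "T * real (Suc k) / 2^n \<le> T" by (simp add: divide_le_eq del: of_nat_Suc)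
      have "T * real (Suc k) / 2^n = T * real k / 2^n + T * (1/2)^n" by (simp add: field_simps power_one_over)
      then have "dist s (T * real k / 2^n) < d" using s elim by (simp add: dist_real_def)
      moreover have "s \<in> {0..T}" "T * real k / 2^n \<in> {0..T}" using 0 1 s by auto
      ultimately show "\<bar>f s - f (T * real k / 2^n)\<bar> < \<eta>" using d(2) by (metis dist_real_def)
    qed
  qed
qed

lemma exp_quadratic_bounds:
  fixes x :: real
  assumes "\<bar>x\<bar> \<le> 1"
  shows "\<bar>exp (x + x\<^sup>2 / 2) * (1 - x) - 1\<bar> \<le> exp 2 * \<bar>x\<bar>^3"
    and "\<bar>exp (x + x\<^sup>2 / 2) - 1\<bar> \<le> 2 * exp 2 * \<bar>x\<bar>"
    and "exp (x + x\<^sup>2 / 2) \<le> exp 2"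
proof -
  \<comment> \<open>The exponent is at most \<open>3/2\<close>; \<open>exp 2\<close> is a convenient
    round bound.\<close>
  have ub: "exp (y + y\<^sup>2 / 2) \<le> exp 2" if "\<bar>y\<bar> \<le> 1" for y :: real
  proof -
    have "y\<^sup>2 \<le> 1" using that by (simp add: abs_square_le_1)
    then show ?thesis using that by simp
  qed
  show "exp (x + x\<^sup>2 / 2) \<le> exp 2" using assms by (rule ub)
  let ?S = "{- \<bar>x\<bar>..\<bar>x\<bar>}"
  \<comment> \<open>The factor \<open>y\<^sup>2\<close> in the first derivative is what makes the defect cubic.\<close>
  have d1: "((\<lambda>y. exp (y + y\<^sup>2 / 2) * (1 - y)) has_real_derivative (- (y\<^sup>2) * exp (y + y\<^sup>2 / 2))) (at y within ?S)" for y :: real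
    by (auto intro!: derivative_eq_intros simp: field_simps power2_eq_square)
  have d2: "((\<lambda>y. exp (y + y\<^sup>2 / 2)) has_real_derivative ((1 + y) * exp (y + y\<^sup>2 / 2))) (at y within ?S)" for y :: real
    by (auto intro!: derivative_eq_intros simp: field_simps power2_eq_square)
  have "norm (exp (x + x\<^sup>2 / 2) * (1 - x) - exp (0 + 0\<^sup>2 / 2) * (1 - 0)) \<le> (\<bar>x\<bar>\<^sup>2 * exp 2) * norm (x - 0)"
  proof (rule field_differentiable_bound[OF _ d1])
    fix y assume "y \<in> ?S"
    then have y: "\<bar>y\<bar> \<le> \<bar>x\<bar>" by auto
    then show "norm (- (y\<^sup>2) * exp (y + y\<^sup>2 / 2)) \<le> \<bar>x\<bar>\<^sup>2 * exp 2"
      using ub[of y] assms power_mono[OF y abs_ge_zero, of 2] by (auto simp: abs_mult intro!: mult_mono)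
  qed auto
  then show "\<bar>exp (x + x\<^sup>2 / 2) * (1 - x) - 1\<bar> \<le> exp 2 * \<bar>x\<bar>^3"
    by (simp add: power3_eq_cube power2_eq_square mult_ac)
  have "norm (exp (x + x\<^sup>2 / 2) - exp (0 + 0\<^sup>2 / 2)) \<le> (2 * exp 2) * norm (x - 0)"
  proof (rule field_differentiable_bound[OF _ d2])
    fix y assume "y \<in> ?S"
    then have y: "\<bar>y\<bar> \<le> 1" using assms by auto
    then show "norm ((1 + y) * exp (y + y\<^sup>2 / 2)) \<le> 2 * exp 2"
      using ub[of y] by (auto simp: abs_mult intro!: mult_mono)
  qed auto
  then show "\<bar>exp (x + x\<^sup>2 / 2) - 1\<bar> \<le> 2 * exp 2 * \<bar>x\<bar>" by simp
qed

text \<open>The two remainders play different roles: \<open>a\<close> is small in absolute sum,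
  whereas \<open>b\<close> is small only in square sum and in the sum weighted by \<open>E\<close>.
  The weighted sum is therefore kept exactly on the left, and only its product with \<open>x\<close>
  is estimated by absolute values.\<close>

lemma exponential_product_defect:
  fixes x a b z :: "nat \<Rightarrow> real"
  defines "E \<equiv> \<lambda>k. exp (\<Sum>i<k. x i + (x i)\<^sup>2 / 2)"
  assumes x: "\<And>k. k < N \<Longrightarrow> \<bar>x k\<bar> \<le> 1"
    and z: "\<And>k. k < N \<Longrightarrow> z (Suc k) = (1 - x k) * z k + a k + b k"
    and B: "\<And>k. k < N \<Longrightarrow> \<bar>z k\<bar> \<le> B" "\<And>k. k < N \<Longrightarrow> E k \<le> B"
  shows "\<bar>E N * z N - z 0 - (\<Sum>k<N. E k * b k)\<bar>
    \<le> exp 2 * B\<^sup>2 * (\<Sum>k<N. \<bar>x k\<bar>^3) + exp 2 * B * (\<Sum>k<N. \<bar>a k\<bar>) + 2 * exp 2 * B * (\<Sum>k<N. \<bar>x k\<bar> * \<bar>b k\<bar>)"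
proof -
  let ?R = "\<lambda>k. E (Suc k) * z (Suc k) - E k * z k - E k * b k"
  have "E N * z N - z 0 - (\<Sum>k<N. E k * b k) = (\<Sum>k<N. ?R k)"
    using sum_lessThan_telescope[of "\<lambda>k. E k * z k" N] by (simp add: sum_subtractf E_def)
  also have "\<bar>\<dots>\<bar> \<le> (\<Sum>k<N. \<bar>?R k\<bar>)" by (rule sum_abs)
  also have "\<dots> \<le> (\<Sum>k<N. exp 2 * B\<^sup>2 * \<bar>x k\<bar>^3 + exp 2 * B * \<bar>a k\<bar> + 2 * exp 2 * B * (\<bar>x k\<bar> * \<bar>b k\<bar>))"
  proof (rule sum_mono)
    fix k assume "k \<in> {..<N}"
    then have k: "k < N" by simp
    let ?e = "exp (x k + (x k)\<^sup>2 / 2)"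
    have E: "0 \<le> E k" "E k \<le> B" using B(2)[OF k] by (simp_all add: E_def)
    have "E (Suc k) = E k * ?e" by (simp add: E_def exp_add)
    \<comment> \<open>The three summands are the cubic defect of the factor, the drift remainder,
      and the part of the \<open>b\<close> term left after \<open>E k * b k\<close> is subtracted;
      the last one gains a factor \<open>x k\<close> from
      \<open>exp (x + x\<^sup>2 / 2) - 1\<close>.\<close>
    then have R: "?R k = E k * (z k * (?e * (1 - x k) - 1)) + E k * (?e * a k) + E k * ((?e - 1) * b k)"
      by (simp add: z[OF k] algebra_simps)
    note eb = exp_quadratic_bounds[OF x[OF k]]
    have "\<bar>E k * (z k * (?e * (1 - x k) - 1))\<bar> \<le> B * (B * (exp 2 * \<bar>x k\<bar>^3))"
      unfolding abs_mult using E B(1)[OF k] eb(1) by (intro mult_mono) auto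
    moreover have "\<bar>E k * (?e * a k)\<bar> \<le> B * (exp 2 * \<bar>a k\<bar>)"
      unfolding abs_mult using E eb(3) by (intro mult_mono) auto
    moreover have "\<bar>E k * ((?e - 1) * b k)\<bar> \<le> B * ((2 * exp 2 * \<bar>x k\<bar>) * \<bar>b k\<bar>)"
      unfolding abs_mult using E eb(2) by (intro mult_mono) auto
    ultimately have "\<bar>?R k\<bar> \<le> B * (B * (exp 2 * \<bar>x k\<bar>^3)) + B * (exp 2 * \<bar>a k\<bar>) + B * ((2 * exp 2 * \<bar>x k\<bar>) * \<bar>b k\<bar>)"
      unfolding R by linarith
    then show "\<bar>?R k\<bar> \<le> exp 2 * B\<^sup>2 * \<bar>x k\<bar>^3 + exp 2 * B * \<bar>a k\<bar> + 2 * exp 2 * B * (\<bar>x k\<bar> * \<bar>b k\<bar>)"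
      by (simp add: power2_eq_square mult_ac)
  qed
  finally show ?thesis by (simp add: sum.distrib sum_distrib_left)
qed

text \<open>Both end values of \<open>z\<close> are the same on all grids, so letting the mesh
  vanish in the defect estimate leaves an exact identity between them.\<close>

lemma exponential_product_limit:
  fixes x a b z :: "nat \<Rightarrow> nat \<Rightarrow> real" and N :: "nat \<Rightarrow> nat"
  defines "E \<equiv> \<lambda>n k. exp (\<Sum>i<k. x n i + (x n i)\<^sup>2 / 2)"
  assumes x: "\<And>\<eta>. 0 < \<eta> \<Longrightarrow> eventually (\<lambda>n. \<forall>k<N n. \<bar>x n k\<bar> \<le> \<eta>) sequentially"
    and x2: "(\<lambda>n. \<Sum>k<N n. (x n k)\<^sup>2) \<longlonglongrightarrow> Q"
    and x1: "\<And>n. (\<Sum>k<N n. x n k) = S"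
    and z: "\<And>n k. k < N n \<Longrightarrow> z n (Suc k) = (1 - x n k) * z n k + a n k + b n k"
    and B: "\<And>n k. k < N n \<Longrightarrow> \<bar>z n k\<bar> \<le> B" "\<And>n k. k < N n \<Longrightarrow> E n k \<le> B"
    and a: "(\<lambda>n. \<Sum>k<N n. \<bar>a n k\<bar>) \<longlonglongrightarrow> 0"
    and b2: "(\<lambda>n. \<Sum>k<N n. (b n k)\<^sup>2) \<longlonglongrightarrow> 0"
    and Eb: "(\<lambda>n. \<Sum>k<N n. E n k * b n k) \<longlonglongrightarrow> 0"
    and ends: "\<And>n. z n 0 = z0" "\<And>n. z n (N n) = zT"
  shows "exp (S + Q / 2) * zT = z0"
proof -
  have x3: "(\<lambda>n. \<Sum>k<N n. \<bar>x n k\<bar>^3) \<longlonglongrightarrow> 0"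
  proof (rule LIMSEQ_I)
    fix r :: real assume r: "0 < r"
    have Q: "0 \<le> Q" by (rule LIMSEQ_le_const[OF x2]) (simp add: sum_nonneg)
    have ev: "eventually (\<lambda>n. (\<Sum>k<N n. (x n k)\<^sup>2) < Q + 1) sequentially"
      using x2 by (rule order_tendstoD) simp
    \<comment> \<open>The sum of the cubes is at most the largest \<open>\<bar>x\<bar>\<close> times
      the sum of the squares. \<open>Q + 1\<close> eventually exceeds that sum and stays positive
      when \<open>Q = 0\<close>.\<close>
    have "0 < r / (Q + 1)" using r Q by simp
    from x[OF this] ev have "eventually (\<lambda>n. norm ((\<Sum>k<N n. \<bar>x n k\<bar>^3) - 0) < r) sequentially"
    proof eventually_elim
      case (elim n)
      have "(\<Sum>k<N n. \<bar>x n k\<bar>^3) \<le> (\<Sum>k<N n. r / (Q + 1) * (x n k)\<^sup>2)"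
      proof (rule sum_mono)
        fix k assume "k \<in> {..<N n}"
        then have "\<bar>x n k\<bar> * \<bar>x n k\<bar>\<^sup>2 \<le> r / (Q + 1) * \<bar>x n k\<bar>\<^sup>2" using elim by (intro mult_right_mono) auto
        then show "\<bar>x n k\<bar>^3 \<le> r / (Q + 1) * (x n k)\<^sup>2" by (simp add: power3_eq_cube power2_eq_square)
      qed
      also have "\<dots> = r / (Q + 1) * (\<Sum>k<N n. (x n k)\<^sup>2)" by (simp add: sum_distrib_left)
      also have "\<dots> < r / (Q + 1) * (Q + 1)" using elim r Q by (intro mult_strict_left_mono) auto
      also have "\<dots> = r" using Q by simp
      finally show ?case by (simp add: sum_nonneg)
    qed
    then show "\<exists>no. \<forall>n\<ge>no. norm ((\<Sum>k<N n. \<bar>x n k\<bar>^3) - 0) < r" by (simp add: eventually_sequentially)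
  qed
  \<comment> \<open>Cauchy-Schwarz pairs the bounded square sum of \<open>x\<close> with the
    vanishing one of \<open>b\<close>.\<close>
  have xb: "(\<lambda>n. \<Sum>k<N n. \<bar>x n k\<bar> * \<bar>b n k\<bar>) \<longlonglongrightarrow> 0"
  proof (rule Lim_null_comparison)
    have "(\<lambda>n. sqrt (\<Sum>k<N n. (x n k)\<^sup>2) * sqrt (\<Sum>k<N n. (b n k)\<^sup>2)) \<longlonglongrightarrow> sqrt Q * sqrt 0"
      by (intro tendsto_intros x2 b2)
    then show "(\<lambda>n. sqrt (\<Sum>k<N n. (x n k)\<^sup>2) * sqrt (\<Sum>k<N n. (b n k)\<^sup>2)) \<longlonglongrightarrow> 0" by simp
    have "(\<Sum>k<N n. \<bar>x n k\<bar> * \<bar>b n k\<bar>) \<le> sqrt (\<Sum>k<N n. (x n k)\<^sup>2) * sqrt (\<Sum>k<N n. (b n k)\<^sup>2)" for n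
      using L2_set_mult_ineq[of "x n" "b n" "{..<N n}"] by (simp add: L2_set_def)
    then show "eventually (\<lambda>n. norm (\<Sum>k<N n. \<bar>x n k\<bar> * \<bar>b n k\<bar>) \<le> sqrt (\<Sum>k<N n. (x n k)\<^sup>2) * sqrt (\<Sum>k<N n. (b n k)\<^sup>2)) sequentially"
      by (simp add: sum_nonneg)
  qed
  let ?bd = "\<lambda>n. exp 2 * B\<^sup>2 * (\<Sum>k<N n. \<bar>x n k\<bar>^3) + exp 2 * B * (\<Sum>k<N n. \<bar>a n k\<bar>) + 2 * exp 2 * B * (\<Sum>k<N n. \<bar>x n k\<bar> * \<bar>b n k\<bar>)"
  have bd: "?bd \<longlonglongrightarrow> exp 2 * B\<^sup>2 * 0 + exp 2 * B * 0 + 2 * exp 2 * B * 0"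
    by (intro tendsto_intros x3 a xb)
  have lim0: "(\<lambda>n. E n (N n) * zT - z0 - (\<Sum>k<N n. E n k * b n k)) \<longlonglongrightarrow> 0"
  proof (rule Lim_null_comparison)
    show "?bd \<longlonglongrightarrow> 0" using bd by simp
    show "eventually (\<lambda>n. norm (E n (N n) * zT - z0 - (\<Sum>k<N n. E n k * b n k)) \<le> ?bd n) sequentially"
      using x[OF zero_less_one]
    proof eventually_elim
      case (elim n)
      have "\<bar>E n (N n) * z n (N n) - z n 0 - (\<Sum>k<N n. E n k * b n k)\<bar> \<le> ?bd n"
        unfolding E_def by (rule exponential_product_defect) (use elim z B in \<open>auto simp: E_def\<close>)
      then show ?case by (simp add: ends)
    qed
  qed
  \<comment> \<open>The linear part of the exponent is \<open>S\<close> on every grid, so only the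
    quadratic part has to pass to the limit.\<close>
  have En: "E n (N n) = exp (S + (\<Sum>k<N n. (x n k)\<^sup>2) / 2)" for n
    by (simp add: E_def sum.distrib x1 sum_divide_distrib)
  have "(\<lambda>n. E n (N n) * zT) \<longlonglongrightarrow> exp (S + Q / 2) * zT"
    unfolding En by (intro tendsto_intros x2) simp
  moreover have "(\<lambda>n. E n (N n) * zT) \<longlonglongrightarrow> z0"
    using tendsto_add[OF tendsto_add[OF lim0 Eb] tendsto_const[of z0]] by simp
  ultimately show ?thesis by (rule LIMSEQ_unique)
qed

lemma riemann_sum_defect:
  fixes z :: "real \<Rightarrow> real"
  assumes T: "0 < T" and z: "continuous_on {0..T} z"
  shows "(\<lambda>n. \<Sum>k<2^n. \<bar>integral {T * real k / 2^n..T * real (Suc k) / 2^n} z - T / 2^n * z (T * real k / 2^n)\<bar>) \<longlonglongrightarrow> 0"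
proof (rule LIMSEQ_I)
  fix r :: real assume r: "0 < r"
  \<comment> \<open>An oscillation of \<open>r / (2 * T)\<close> on \<open>2^n\<close> cells of
    length \<open>T / 2^n\<close> costs \<open>r / 2\<close> in total.\<close>
  have "0 < r / (2 * T)" using r T by simp
  from dyadic_oscillation[OF T z this]
  have "eventually (\<lambda>n. norm ((\<Sum>k<2^n. \<bar>integral {T * real k / 2^n..T * real (Suc k) / 2^n} z - T / 2^n * z (T * real k / 2^n)\<bar>) - 0) < r) sequentially"
  proof eventually_elim
    case (elim n)
    have "(\<Sum>k<2^n. \<bar>integral {T * real k / 2^n..T * real (Suc k) / 2^n} z - T / 2^n * z (T * real k / 2^n)\<bar>)
      \<le> (\<Sum>k<(2::nat)^n. r / (2 * T) * (T / 2^n))"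
    proof (rule sum_mono)
      fix k :: nat assume "k \<in> {..<2^n}"
      then have k: "k < 2^n" by simp
      let ?a = "T * real k / 2^n" and ?b = "T * real (Suc k) / 2^n"
      have ab: "?a \<le> ?b" "?b - ?a = T / 2^n" "0 \<le> ?a"
        using T by (simp_all add: divide_right_mono flip: diff_divide_distrib) (simp add: algebra_simps)
      have "real (Suc k) \<le> 2^n" using k by (metis Suc_leI of_nat_le_iff of_nat_numeral of_nat_power)
      then have "T * real (Suc k) \<le> T * 2^n" using T by (intro mult_left_mono) simp_all
      then have "?b \<le> T" by (simp add: divide_le_eq del: of_nat_Suc)
      then have "continuous_on {?a..?b} z" using ab by (intro continuous_on_subset[OF z]) auto
      then have "(z has_integral integral {?a..?b} z) {?a..?b}"
        by (intro integrable_integral integrable_continuous_interval)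
      moreover have "((\<lambda>_. z ?a) has_integral (?b - ?a) *\<^sub>R z ?a) {?a..?b}"
        by (rule has_integral_const_real[of "z ?a" ?a ?b, simplified content_real[OF ab(1)]])
      ultimately have "((\<lambda>s. z s - z ?a) has_integral (integral {?a..?b} z - (?b - ?a) *\<^sub>R z ?a)) {?a..?b}"
        by (rule has_integral_diff)
      then have "((\<lambda>s. z s - z ?a) has_integral (integral {?a..?b} z - T / 2^n * z ?a)) {?a..?b}"
        unfolding ab(2) real_scaleR_def .
      then have "norm (integral {?a..?b} z - T / 2^n * z ?a) \<le> r / (2 * T) * Henstock_Kurzweil_Integration.content {?a..?b}"
        using elim k r T by (intro has_integral_bound_real[where f = "\<lambda>s. z s - z ?a"]) (auto intro: less_imp_le)
      then show "\<bar>integral {?a..?b} z - T / 2^n * z ?a\<bar> \<le> r / (2 * T) * (T / 2^n)"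
        unfolding content_real[OF ab(1)] ab(2) by simp
    qed
    also have "\<dots> = r / 2" using T by simp
    finally show ?case using r by (simp add: sum_nonneg)
  qed
  then show "\<exists>no. \<forall>n\<ge>no. norm ((\<Sum>k<2^n. \<bar>integral {T * real k / 2^n..T * real (Suc k) / 2^n} z - T / 2^n * z (T * real k / 2^n)\<bar>) - 0) < r"
    by (simp add: eventually_sequentially)
qed

text \<open>The linear part of the exponent telescopes, so a bounded path and the convergent square
  sums bound all partial products uniformly over the grids. This pathwise bound is what admits the
  products as weights of the Ito remainders.\<close>

lemma dyadic_exponential_product:
  fixes w :: "real \<Rightarrow> real" and lam \<sigma> T :: real
  defines "\<Delta> \<equiv> \<lambda>n k. w (T * real (Suc k) / 2^n) - w (T * real k / 2^n)"
  defines "x \<equiv> \<lambda>n k. lam * T / 2^n + \<sigma> * \<Delta> n k"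
  assumes T: "0 < T" and w: "continuous_on {0..T} w"
    and QV: "(\<lambda>n. \<Sum>k<2^n. (\<Delta> n k)\<^sup>2) \<longlonglongrightarrow> T"
  shows "(\<lambda>n. \<Sum>k<2^n. (x n k)\<^sup>2) \<longlonglongrightarrow> \<sigma>\<^sup>2 * T"
    and "\<exists>B. \<forall>n k. k < 2^n \<longrightarrow> exp (\<Sum>i<k. x n i + (x n i)\<^sup>2 / 2) \<le> B"
proof -
  let ?t = "\<lambda>n k. T * real k / 2^n"
  have tle: "0 \<le> ?t n k" "?t n k \<le> T" if "k \<le> 2^n" for n k :: nat
  proof -
    have "real k \<le> 2^n" using that by (metis of_nat_le_iff of_nat_numeral of_nat_power)
    then have "T * real k \<le> T * 2^n" using T by (intro mult_left_mono) simp_all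
    then show "?t n k \<le> T" by (simp add: divide_le_eq)
    show "0 \<le> ?t n k" using T by simp
  qed
  have tele: "(\<Sum>i<k. \<Delta> n i) = w (?t n k) - w 0" for n and k :: nat
    unfolding \<Delta>_def using sum_lessThan_telescope[of "\<lambda>k. w (?t n k)" k] by simp
  have x2: "(\<lambda>n. \<Sum>k<2^n. (x n k)\<^sup>2) \<longlonglongrightarrow> \<sigma>\<^sup>2 * T"
  proof -
    \<comment> \<open>The squared drift has order \<open>(1/2)^n\<close>; the mixed term telescopes
      and has the same order. Only the quadratic variation of \<open>w\<close> survives.\<close>
    have "(\<Sum>k<2^n. (x n k)\<^sup>2) = lam\<^sup>2 * T\<^sup>2 * (1/2)^n + 2 * lam * T * \<sigma> * (w T - w 0) * (1/2)^n + \<sigma>\<^sup>2 * (\<Sum>k<2^n. (\<Delta> n k)\<^sup>2)" for n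
    proof -
      have "(\<Sum>k<2^n. (x n k)\<^sup>2) = (\<Sum>k<(2::nat)^n. (lam * T / 2^n)\<^sup>2 + 2 * (lam * T / 2^n) * \<sigma> * \<Delta> n k + \<sigma>\<^sup>2 * (\<Delta> n k)\<^sup>2)"
        by (intro sum.cong) (auto simp: x_def power2_eq_square algebra_simps)
      also have "\<dots> = 2^n * (lam * T / 2^n)\<^sup>2 + 2 * (lam * T / 2^n) * \<sigma> * (\<Sum>k<2^n. \<Delta> n k) + \<sigma>\<^sup>2 * (\<Sum>k<2^n. (\<Delta> n k)\<^sup>2)"
        by (simp add: sum.distrib sum_distrib_left)
      also have "(\<Sum>k<2^n. \<Delta> n k) = w T - w 0" by (simp add: tele)
      also have "2^n * (lam * T / 2^n)\<^sup>2 = lam\<^sup>2 * T\<^sup>2 * (1/2)^n" by (simp add: power2_eq_square power_one_over field_simps)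
      also have "2 * (lam * T / 2^n) * \<sigma> * (w T - w 0) = 2 * lam * T * \<sigma> * (w T - w 0) * (1/2)^n" by (simp add: power_one_over field_simps)
      finally show ?thesis .
    qed
    moreover have "(\<lambda>n. lam\<^sup>2 * T\<^sup>2 * (1/2)^n + 2 * lam * T * \<sigma> * (w T - w 0) * (1/2)^n + \<sigma>\<^sup>2 * (\<Sum>k<2^n. (\<Delta> n k)\<^sup>2))
      \<longlonglongrightarrow> lam\<^sup>2 * T\<^sup>2 * 0 + 2 * lam * T * \<sigma> * (w T - w 0) * 0 + \<sigma>\<^sup>2 * T"
      by (intro tendsto_intros QV LIMSEQ_power_zero) simp_all
    ultimately show ?thesis by simp
  qed
  then show "(\<lambda>n. \<Sum>k<2^n. (x n k)\<^sup>2) \<longlonglongrightarrow> \<sigma>\<^sup>2 * T" .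
  obtain Bw where Bw: "\<And>t. t \<in> {0..T} \<Longrightarrow> \<bar>w t\<bar> \<le> Bw"
    using compact_imp_bounded[OF compact_continuous_image[OF w compact_Icc]] unfolding bounded_iff real_norm_def by blast
  obtain Bx where Bx: "\<And>n. (\<Sum>k<2^n. (x n k)\<^sup>2) \<le> Bx"
    using convergent_imp_Bseq[OF convergentI[OF x2]] unfolding Bseq_def by (metis abs_ge_self order_trans real_norm_def)
  define B where "B = exp (\<bar>lam\<bar> * T + \<bar>\<sigma>\<bar> * (Bw + Bw) + Bx / 2)"
  have EB: "exp (\<Sum>i<k. x n i + (x n i)\<^sup>2 / 2) \<le> B" if "k < 2^n" for n k
  proof -
    have "(\<Sum>i<k. x n i) = lam * ?t n k + \<sigma> * (w (?t n k) - w 0)"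
      by (simp add: x_def sum.distrib tele flip: sum_distrib_left)
    also have "\<dots> \<le> \<bar>lam\<bar> * T + \<bar>\<sigma>\<bar> * (Bw + Bw)"
    proof (rule add_mono)
      have "lam * ?t n k \<le> \<bar>lam\<bar> * ?t n k" using tle(1)[of k n] that by (intro mult_right_mono) auto
      also have "\<dots> \<le> \<bar>lam\<bar> * T" using tle(2)[of k n] that by (intro mult_left_mono) auto
      finally show "lam * ?t n k \<le> \<bar>lam\<bar> * T" .
      have "\<bar>w (?t n k) - w 0\<bar> \<le> Bw + Bw"
        using Bw[of "?t n k"] Bw[of 0] tle[of k n] that T by (auto intro: order_trans[OF abs_triangle_ineq4])
      then have "\<bar>\<sigma> * (w (?t n k) - w 0)\<bar> \<le> \<bar>\<sigma>\<bar> * (Bw + Bw)" unfolding abs_mult by (intro mult_left_mono) auto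
      then show "\<sigma> * (w (?t n k) - w 0) \<le> \<bar>\<sigma>\<bar> * (Bw + Bw)" by simp
    qed
    finally have 1: "(\<Sum>i<k. x n i) \<le> \<bar>lam\<bar> * T + \<bar>\<sigma>\<bar> * (Bw + Bw)" .
    have "(\<Sum>i<k. (x n i)\<^sup>2) \<le> (\<Sum>i<2^n. (x n i)\<^sup>2)" using that by (intro sum_mono2) auto
    also have "\<dots> \<le> Bx" by (rule Bx)
    finally have "(\<Sum>i<k. x n i + (x n i)\<^sup>2 / 2) \<le> \<bar>lam\<bar> * T + \<bar>\<sigma>\<bar> * (Bw + Bw) + Bx / 2"
      using 1 by (simp add: sum.distrib flip: sum_divide_distrib)
    then show ?thesis by (simp add: B_def)
  qed
  then show "\<exists>B. \<forall>n k. k < 2^n \<longrightarrow> exp (\<Sum>i<k. x n i + (x n i)\<^sup>2 / 2) \<le> B" by blast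
qed

text \<open>A deterministic statement about one path: all probability is hidden in the hypotheses on
  \<open>\<rho>\<close>, the Ito remainder of a cell. These concern a subsequence \<open>r\<close>,
  along which almost sure convergence is available.\<close>

lemma linear_equation_solution:
  fixes w z j :: "real \<Rightarrow> real" and lam \<sigma> T :: real
  defines "\<Delta> \<equiv> \<lambda>f n k. f (T * real (Suc k) / 2^n) - f (T * real k / 2^n)"
  defines "x \<equiv> \<lambda>n k. lam * T / 2^n + \<sigma> * \<Delta> w n k"
  defines "\<rho> \<equiv> \<lambda>n k. \<Delta> j n k - z (T * real k / 2^n) * \<Delta> w n k"
  assumes T: "0 < T" and w: "continuous_on {0..T} w" and z: "continuous_on {0..T} z"
    and eq: "\<And>t. 0 \<le> t \<Longrightarrow> t \<le> T \<Longrightarrow> z t = z 0 - lam * (LINT s:{0..t}|lborel. z s) - \<sigma> * j t"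
    and r: "strict_mono r"
    and QV: "(\<lambda>n. \<Sum>k<2^n. (\<Delta> w n k)\<^sup>2) \<longlonglongrightarrow> T"
    and R1: "(\<lambda>n. \<Sum>k<2^r n. exp (\<Sum>i<k. x (r n) i + (x (r n) i)\<^sup>2 / 2) * \<rho> (r n) k) \<longlonglongrightarrow> 0"
    and R2: "(\<lambda>n. \<Sum>k<2^r n. (\<rho> (r n) k)\<^sup>2) \<longlonglongrightarrow> 0"
  shows "exp (lam * T + \<sigma> * (w T - w 0) + \<sigma>\<^sup>2 * T / 2) * z T = z 0"
proof -
  let ?t = "\<lambda>n k. T * real k / 2^n"
  have tle: "0 \<le> ?t n k" "?t n k \<le> T" if "k \<le> 2^n" for n k :: nat
  proof -
    have "real k \<le> 2^n" using that by (metis of_nat_le_iff of_nat_numeral of_nat_power)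
    then have "T * real k \<le> T * 2^n" using T by (intro mult_left_mono) simp_all
    then show "?t n k \<le> T" by (simp add: divide_le_eq)
    show "0 \<le> ?t n k" using T by simp
  qed
  have tele: "(\<Sum>i<k. \<Delta> f n i) = f (?t n k) - f 0" for f n and k :: nat
    unfolding \<Delta>_def using sum_lessThan_telescope[of "\<lambda>k. f (?t n k)" k] by simp
  \<comment> \<open>The error of freezing \<open>z\<close> at the left end of the cell in the drift
    integral.\<close>
  define a where "a n k = - lam * (integral {?t n k..?t n (Suc k)} z - T / 2^n * z (?t n k))" for n k
  have zint: "z t = z 0 - lam * integral {0..t} z - \<sigma> * j t" if "0 \<le> t" "t \<le> T" for t
  proof -
    have "continuous_on {0..t} z" using z by (rule continuous_on_subset) (use that in auto)
    then have "set_integrable lborel {0..t} z" by (rule borel_integrable_atLeastAtMost')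
    then have "(LINT s:{0..t}|lborel. z s) = integral {0..t} z" by (rule set_borel_integral_eq_integral(2))
    then show ?thesis using eq[OF that] by simp
  qed
  have step: "z (?t n (Suc k)) = (1 - x n k) * z (?t n k) + a n k + - \<sigma> * \<rho> n k" if "k < 2^n" for n k
  proof -
    have le: "?t n k \<le> ?t n (Suc k)" using T by (simp add: divide_right_mono)
    have "z integrable_on {0..?t n (Suc k)}"
      using tle(2)[of "Suc k" n] that by (intro integrable_continuous_interval continuous_on_subset[OF z]) auto
    then have "integral {0..?t n k} z + integral {?t n k..?t n (Suc k)} z = integral {0..?t n (Suc k)} z"
      using tle(1)[of k n] le that by (intro Henstock_Kurzweil_Integration.integral_combine) auto
    then have "lam * integral {0..?t n (Suc k)} z = lam * integral {0..?t n k} z + lam * integral {?t n k..?t n (Suc k)} z"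
      by (metis distrib_left)
    moreover have "k \<le> 2^n" "Suc k \<le> 2^n" using that by auto
    ultimately show ?thesis
      using zint[OF tle, of k n] zint[OF tle, of "Suc k" n]
      unfolding a_def x_def \<rho>_def \<Delta>_def by (simp add: algebra_simps del: of_nat_Suc)
  qed
  have rtop: "filterlim r sequentially sequentially" using r by (rule filterlim_subseq)
  obtain Bz where Bz: "\<And>t. t \<in> {0..T} \<Longrightarrow> \<bar>z t\<bar> \<le> Bz"
    using compact_imp_bounded[OF compact_continuous_image[OF z compact_Icc]] unfolding bounded_iff real_norm_def by blast
  have x2: "(\<lambda>n. \<Sum>k<2^n. (x n k)\<^sup>2) \<longlonglongrightarrow> \<sigma>\<^sup>2 * T"
    using dyadic_exponential_product(1)[OF T w QV[unfolded \<Delta>_def], of lam \<sigma>] unfolding x_def \<Delta>_def .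
  obtain BE where BE: "\<And>n k. k < 2^n \<Longrightarrow> exp (\<Sum>i<k. x n i + (x n i)\<^sup>2 / 2) \<le> BE"
    using dyadic_exponential_product(2)[OF T w QV[unfolded \<Delta>_def], of lam \<sigma>] unfolding x_def \<Delta>_def by blast
  define B where "B = max Bz BE"
  have EB: "exp (\<Sum>i<k. x n i + (x n i)\<^sup>2 / 2) \<le> B" if "k < 2^n" for n k
    using BE[OF that] by (simp add: B_def)
  have zB: "\<bar>z (?t n k)\<bar> \<le> B" if "k < 2^n" for n k
    using Bz[of "?t n k"] tle[of k n] that by (auto simp: B_def)
  have xsmall: "eventually (\<lambda>n. \<forall>k<2^n. \<bar>x n k\<bar> \<le> \<eta>) sequentially" if \<eta>: "0 < \<eta>" for \<eta>
  proof -
    have "(\<lambda>n. \<bar>lam\<bar> * T * (1/2)^n) \<longlonglongrightarrow> \<bar>lam\<bar> * T * 0" by (intro tendsto_intros LIMSEQ_power_zero) simp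
    then have "eventually (\<lambda>n. \<bar>lam\<bar> * T * (1/2)^n < \<eta> / 2) sequentially"
      by (rule order_tendstoD(2)) (use \<eta> in simp)
    \<comment> \<open>The increment \<open>1\<close> avoids a division by zero when
      \<open>\<sigma> = 0\<close>.\<close>
    moreover have "0 < \<eta> / (2 * (\<bar>\<sigma>\<bar> + 1))" using \<eta> by simp
    note dyadic_oscillation[OF T w this]
    ultimately show ?thesis
    proof eventually_elim
      case (elim n)
      show ?case
      proof safe
        fix k :: nat assume k: "k < 2^n"
        have "?t n k \<le> ?t n (Suc k)" using T by (simp add: divide_right_mono)
        then have "\<bar>\<Delta> w n k\<bar> < \<eta> / (2 * (\<bar>\<sigma>\<bar> + 1))" using elim(2) k unfolding \<Delta>_def by auto
        then have "(\<bar>\<sigma>\<bar> + 1) * \<bar>\<Delta> w n k\<bar> \<le> \<eta> / 2" by (simp add: field_simps)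
        then have "\<bar>\<sigma> * \<Delta> w n k\<bar> \<le> \<eta> / 2" unfolding abs_mult by (simp add: algebra_simps)
        moreover have "\<bar>lam * T / 2^n\<bar> \<le> \<eta> / 2" using elim(1) T by (simp add: abs_mult power_one_over)
        ultimately have "\<bar>\<sigma> * \<Delta> w n k\<bar> + \<bar>lam * T / 2^n\<bar> \<le> \<eta> / 2 + \<eta> / 2" by (rule add_mono)
        then have "\<bar>lam * T / 2^n\<bar> + \<bar>\<sigma> * \<Delta> w n k\<bar> \<le> \<eta>" unfolding add.commute[of _ "\<bar>lam * T / 2^n\<bar>"] field_sum_of_halves .
        then show "\<bar>x n k\<bar> \<le> \<eta>" unfolding x_def by (rule order_trans[OF abs_triangle_ineq])
      qed
    qed
  qed
  have al: "(\<lambda>n. \<Sum>k<2^n. \<bar>a n k\<bar>) \<longlonglongrightarrow> 0"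
    using tendsto_mult_left[OF riemann_sum_defect[OF T z], of "\<bar>lam\<bar>"]
    by (simp add: a_def abs_mult sum_distrib_left)
  have "exp ((lam * T + \<sigma> * (w T - w 0)) + \<sigma>\<^sup>2 * T / 2) * z T = z 0"
  proof (rule exponential_product_limit[where x = "\<lambda>n. x (r n)" and N = "\<lambda>n. 2^r n" and z = "\<lambda>n k. z (?t (r n) k)"
        and a = "\<lambda>n. a (r n)" and b = "\<lambda>n k. - \<sigma> * \<rho> (r n) k" and B = B])
    show "eventually (\<lambda>n. \<forall>k<2^r n. \<bar>x (r n) k\<bar> \<le> \<eta>) sequentially" if "0 < \<eta>" for \<eta>
      using eventually_compose_filterlim[OF xsmall[OF that] rtop] .
    show "(\<lambda>n. \<Sum>k<2^r n. (x (r n) k)\<^sup>2) \<longlonglongrightarrow> \<sigma>\<^sup>2 * T" by (rule filterlim_compose[OF x2 rtop])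
    show "(\<lambda>n. \<Sum>k<2^r n. \<bar>a (r n) k\<bar>) \<longlonglongrightarrow> 0" by (rule filterlim_compose[OF al rtop])
    show "(\<Sum>k<2^r n. x (r n) k) = lam * T + \<sigma> * (w T - w 0)" for n
      by (simp add: x_def sum.distrib tele flip: sum_distrib_left)
    show "(\<lambda>n. \<Sum>k<2^r n. (- \<sigma> * \<rho> (r n) k)\<^sup>2) \<longlonglongrightarrow> 0"
      using tendsto_mult_left[OF R2, of "\<sigma>\<^sup>2"] by (simp add: power_mult_distrib sum_distrib_left)
    show "(\<lambda>n. \<Sum>k<2^r n. exp (\<Sum>i<k. x (r n) i + (x (r n) i)\<^sup>2 / 2) * (- \<sigma> * \<rho> (r n) k)) \<longlonglongrightarrow> 0"
      using tendsto_mult_left[OF R1, of "- \<sigma>"] by (simp add: sum_distrib_left mult_ac)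
  qed (use step zB EB T in auto)
  then show ?thesis by simp
qed

section \<open>Riemann sums of Ito integrals\<close>

text \<open>With \<open>P\<close> the breakpoints of a simple process, the process becomes constant
  on every cell \<open>(q i, q (Suc i)]\<close>, while the grid points remain nodes;
  \<open>\<phi> k\<close> is the position of the grid point \<open>t k\<close> among the
  nodes.\<close>

lemma common_refinement:
  fixes t :: "nat \<Rightarrow> real" and P :: "real set"
  assumes t: "\<And>k. t k < t (Suc k)" and P: "finite P"
  shows "\<exists>N q \<phi>. mono \<phi> \<and> \<phi> 0 = 0 \<and> \<phi> K = N \<and> (\<forall>i<N. q i < q (Suc i)) \<and> (\<forall>k\<le>K. q (\<phi> k) = t k) \<and>
    (\<forall>i<N. \<forall>p\<in>P. \<not> (q i < p \<and> p < q (Suc i)))"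
proof -
  have tmono: "strict_mono t" using t by (simp add: strict_mono_Suc_iff)
  have tle: "t i \<le> t j \<longleftrightarrow> i \<le> j" for i j using tmono by (rule strict_mono_less_eq)
  \<comment> \<open>Breakpoints outside the range of the grid are dropped; they cannot fall inside a
    cell, and the end nodes stay \<open>t 0\<close> and \<open>t K\<close>.\<close>
  define Q where "Q = t ` {..K} \<union> (P \<inter> {t 0..t K})"
  have fin: "finite Q" using P by (simp add: Q_def)
  have Qb: "t 0 \<le> p" "p \<le> t K" if "p \<in> Q" for p using that tle by (auto simp: Q_def)
  define xs where "xs = sorted_list_of_set Q"
  have xs: "set xs = Q" "sorted_wrt (<) xs" "distinct xs" using fin by (auto simp: xs_def)
  have ne: "0 < length xs" using xs(1) by (cases xs) (auto simp: Q_def)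
  define N where "N = length xs - 1"
  define q where "q i = xs ! i" for i
  have qlt: "q i < q j" if "i < j" "j \<le> N" for i j
    unfolding q_def by (rule sorted_wrt_nth_less[OF xs(2) that(1)]) (use that ne in \<open>simp add: N_def\<close>)
  have qlt_iff: "q i < q j \<longleftrightarrow> i < j" if "i \<le> N" "j \<le> N" for i j
    using qlt[of i j] qlt[of j i] that by (metis less_asym linorder_neqE_nat order_less_irrefl)
  have Q: "Q = q ` {..N}"
  proof -
    have "Q = (\<lambda>i. xs ! i) ` {..<length xs}" unfolding xs(1)[symmetric] by (auto simp: in_set_conv_nth image_iff)
    also have "{..<length xs} = {..N}" using ne unfolding N_def by (cases "length xs") (simp_all add: lessThan_Suc_atMost)
    finally show ?thesis by (simp add: q_def)
  qed
  \<comment> \<open>The number of nodes below a node is its index in the sorted list. The cap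
    \<open>min k K\<close> keeps \<open>\<phi>\<close> monotone on all natural numbers.\<close>
  define \<phi> where "\<phi> k = card {p\<in>Q. p < t (min k K)}" for k
  have \<phi>q: "card {p\<in>Q. p < q j} = j" if "j \<le> N" for j
  proof -
    have "{p\<in>Q. p < q j} = q ` {..<j}"
      unfolding Q using that qlt_iff by auto
    moreover have "inj_on q {..<j}"
    proof (rule inj_onI)
      fix x y assume "x \<in> {..<j}" "y \<in> {..<j}" "q x = q y"
      then show "x = y" using qlt_iff[of x y] qlt_iff[of y x] that by auto
    qed
    ultimately show ?thesis by (simp add: card_image)
  qed
  have q\<phi>: "q (\<phi> k) = t k \<and> \<phi> k \<le> N" if "k \<le> K" for k
  proof -
    have "t k \<in> Q" using that by (auto simp: Q_def)
    then obtain j where j: "j \<le> N" "t k = q j" unfolding Q by auto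
    then show ?thesis using \<phi>q[OF j(1)] that by (simp add: \<phi>_def)
  qed
  show ?thesis
  proof (intro exI conjI allI impI ballI)
    show "mono \<phi>"
    proof (rule monoI)
      fix x y :: nat assume "x \<le> y"
      then have "t (min x K) \<le> t (min y K)" unfolding tle by simp
      then show "\<phi> x \<le> \<phi> y" unfolding \<phi>_def using fin by (intro card_mono) auto
    qed
    have "{p\<in>Q. p < t 0} = {}" using Qb(1) by (auto simp: not_less)
    then have "card {p\<in>Q. p < t 0} = 0" by (simp only: card.empty)
    then show "\<phi> 0 = 0" by (simp add: \<phi>_def)
    show "\<phi> K = N"
    proof (rule ccontr)
      assume "\<phi> K \<noteq> N"
      then have "q (\<phi> K) < q N" using q\<phi>[of K] by (intro qlt) auto
      moreover have "q N \<in> Q" unfolding Q by simp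
      ultimately show False using Qb q\<phi>[of K] by fastforce
    qed
    show "q i < q (Suc i)" if "i < N" for i using that by (intro qlt) auto
    show "q (\<phi> k) = t k" if "k \<le> K" for k using q\<phi> that by blast
    show "\<not> (q i < p \<and> p < q (Suc i))" if "i < N" "p \<in> P" for i p
    proof
      assume p: "q i < p \<and> p < q (Suc i)"
      have "q i \<in> Q" "q (Suc i) \<in> Q" using that unfolding Q by auto
      then have "t 0 \<le> p" "p \<le> t K" using p Qb[of "q i"] Qb[of "q (Suc i)"] by auto
      then have "p \<in> Q" using that by (simp add: Q_def)
      then obtain l where "l \<le> N" "p = q l" unfolding Q by auto
      then show False using p qlt_iff[of i l] qlt_iff[of l "Suc i"] that by auto
    qed
  qed
qed

lemma indicator_Ioc_cell:
  fixes a b s c d :: real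
  assumes "a < s" "s \<le> b" "\<not> (a < c \<and> c < b)" "\<not> (a < d \<and> d < b)"
  shows "indicator {c<..d} s = (indicator {c<..d} b :: real)"
  using assms by (auto simp: indicator_def)

text \<open>The pieces of a simple process contain their right ends, so the right end
  \<open>b\<close> represents a cell without inner breakpoints.\<close>

lemma simple_process_cell:
  assumes "a < s" "s \<le> b" and P: "\<And>k. k \<le> n \<Longrightarrow> \<not> (a < \<tau> k \<and> \<tau> k < b)"
  shows "simple_process n \<tau> \<xi> s \<omega> = simple_process n \<tau> \<xi> b \<omega>"
  unfolding simple_process_def
proof (intro sum.cong refl)
  fix k assume "k \<in> {..<n}"
  then have "indicator {\<tau> k<..\<tau> (Suc k)} s = (indicator {\<tau> k<..\<tau> (Suc k)} b :: real)"
    using P by (intro indicator_Ioc_cell[OF assms(1,2)]) auto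
  then show "\<xi> k \<omega> * indicator {\<tau> k<..\<tau> (Suc k)} s = \<xi> k \<omega> * indicator {\<tau> k<..\<tau> (Suc k)} b" by simp
qed

lemma simple_integral_cell:
  assumes ab: "a < b" and P: "\<And>k. k \<le> n \<Longrightarrow> \<not> (a < \<tau> k \<and> \<tau> k < b)" and \<tau>: "\<And>k. k < n \<Longrightarrow> \<tau> k < \<tau> (Suc k)"
  shows "simple_integral W n \<tau> \<xi> b \<omega> - simple_integral W n \<tau> \<xi> a \<omega> = simple_process n \<tau> \<xi> b \<omega> * (W b \<omega> - W a \<omega>)"
  unfolding simple_integral_def simple_process_def sum_subtractf[symmetric] sum_distrib_right
proof (intro sum.cong refl)
  fix k assume "k \<in> {..<n}"
  then have k: "k < n" by simp
  have cases: "\<tau> j \<le> a \<or> b \<le> \<tau> j" if "j \<le> n" for j using P[OF that] by linarith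
  show "\<xi> k \<omega> * (W (min b (\<tau> (Suc k))) \<omega> - W (min b (\<tau> k)) \<omega>) - \<xi> k \<omega> * (W (min a (\<tau> (Suc k))) \<omega> - W (min a (\<tau> k)) \<omega>)
    = \<xi> k \<omega> * indicator {\<tau> k<..\<tau> (Suc k)} b * (W b \<omega> - W a \<omega>)"
    using cases[of k] cases[of "Suc k"] k \<tau>[OF k] ab
    by (auto simp: min_absorb1 min_absorb2 indicator_def algebra_simps)
qed

text \<open>This passes from the L2 distance between a simple process and \<open>H\<close> to its
  distance from the values \<open>g i\<close> of \<open>H\<close> frozen per cell: the square of a
  sum is at most twice the sum of the squares, and freezing costs at most
  \<open>\<eta>\<close>.\<close>

lemma cell_sum_bound:
  fixes q g :: "nat \<Rightarrow> real" and S H :: "real \<Rightarrow> real"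
  assumes q0: "q 0 = 0" and qN: "q N = T" and q: "\<And>i. i < N \<Longrightarrow> q i < q (Suc i)"
    and S: "\<And>i s. i < N \<Longrightarrow> q i < s \<Longrightarrow> s \<le> q (Suc i) \<Longrightarrow> S s = S (q (Suc i))"
    and Sm: "S \<in> borel_measurable borel"
    and H: "continuous_on {0..T} H"
    and osc: "\<And>i s. i < N \<Longrightarrow> q i < s \<Longrightarrow> s \<le> q (Suc i) \<Longrightarrow> \<bar>H s - g i\<bar> \<le> \<eta>"
    and e: "(\<integral>\<^sup>+ s\<in>{0..T}. ennreal ((S s - H s)\<^sup>2) \<partial>lborel) \<le> ennreal e" "0 \<le> e"
  shows "(\<Sum>i<N. (S (q (Suc i)) - g i)\<^sup>2 * (q (Suc i) - q i)) \<le> 2 * e + 2 * \<eta>\<^sup>2 * T"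
proof -
  have qle: "q i \<le> q j" if "i \<le> j" "j \<le> N" for i j
    using that by (induction j rule: dec_induct) (auto simp: Suc_le_eq intro: order_trans less_imp_le[OF q])
  have T0: "0 \<le> T" using qle[of 0 N] q0 qN by simp
  let ?I = "\<lambda>i. {q i<..q (Suc i)}"
  have ind: "(\<Sum>i<n. indicator (?I i) s) = (indicator {q 0<..q n} s :: real)" if "n \<le> N" for n s
    using that
  proof (induction n)
    case (Suc n)
    then show ?case using qle[of 0 n] qle[of n "Suc n"] by (auto simp: indicator_def)
  qed simp
  let ?d = "\<lambda>i. (S (q (Suc i)) - g i)\<^sup>2"
  \<comment> \<open>\<open>H\<close> is continuous on \<open>[0, T]\<close> only. Cutting it off
    outside makes the integrand Borel measurable on the whole line.\<close>
  let ?h = "\<lambda>s. (S s - indicator {0..T} s *\<^sub>R H s)\<^sup>2"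
  have Hm: "(\<lambda>s. indicator {0..T} s *\<^sub>R H s) \<in> borel_measurable borel"
    by (rule borel_measurable_continuous_on_indicator[OF _ H]) simp
  have hm: "?h \<in> borel_measurable borel" using Hm Sm by measurable
  have pt: "(\<Sum>i<N. ?d i * indicator (?I i) s) \<le> (2 * ?h s + 2 * \<eta>\<^sup>2) * indicator {0..T} s" for s
  proof -
    have "(\<Sum>i<N. ?d i * indicator (?I i) s) \<le> (\<Sum>i<N. (2 * ?h s + 2 * \<eta>\<^sup>2) * indicator (?I i) s)"
    proof (rule sum_mono)
      fix i assume "i \<in> {..<N}"
      then have i: "i < N" by simp
      show "?d i * indicator (?I i) s \<le> (2 * ?h s + 2 * \<eta>\<^sup>2) * indicator (?I i) s"
      proof (cases "s \<in> ?I i")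
        case True
        then have s: "q i < s" "s \<le> q (Suc i)" by auto
        then have "s \<in> {0..T}" using qle[of 0 i] qle[of "Suc i" N] q0 qN i by auto
        have "?d i = ((S s - H s) + (H s - g i))\<^sup>2" using S[OF i s] by simp
        also have "\<dots> \<le> 2 * (S s - H s)\<^sup>2 + 2 * (H s - g i)\<^sup>2"
          using sum_squares_bound[of "S s - H s" "H s - g i"] unfolding power2_sum by linarith
        also have "(H s - g i)\<^sup>2 \<le> \<eta>\<^sup>2"
          using power_mono[OF osc[OF i s] abs_ge_zero, of 2] by simp
        finally show ?thesis using True \<open>s \<in> {0..T}\<close> by simp
      qed simp
    qed
    also have "\<dots> = (2 * ?h s + 2 * \<eta>\<^sup>2) * indicator {0<..T} s"
      using ind[of N s] by (simp add: q0 qN flip: sum_distrib_left)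
    also have "\<dots> \<le> (2 * ?h s + 2 * \<eta>\<^sup>2) * indicator {0..T} s"
      by (intro mult_left_mono) (auto simp: indicator_def)
    finally show ?thesis .
  qed
  have "ennreal (\<Sum>i<N. ?d i * (q (Suc i) - q i)) = (\<Sum>i<N. ennreal (?d i) * ennreal (q (Suc i) - q i))"
    using q by (subst sum_ennreal[symmetric]) (auto simp: ennreal_mult less_imp_le)
  also have "\<dots> = (\<Sum>i<N. \<integral>\<^sup>+ s. ennreal (?d i) * indicator (?I i) s \<partial>lborel)"
    using q by (intro sum.cong refl) (simp add: nn_integral_cmult_indicator less_imp_le)
  also have "\<dots> = (\<integral>\<^sup>+ s. (\<Sum>i<N. ennreal (?d i) * indicator (?I i) s) \<partial>lborel)"
    by (rule nn_integral_sum[symmetric]) simp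
  also have "\<dots> = (\<integral>\<^sup>+ s. ennreal (\<Sum>i<N. ?d i * indicator (?I i) s) \<partial>lborel)"
    by (intro nn_integral_cong, subst sum_ennreal[symmetric]) (auto simp: ennreal_mult ennreal_indicator)
  also have "\<dots> \<le> (\<integral>\<^sup>+ s. ennreal ((2 * ?h s + 2 * \<eta>\<^sup>2) * indicator {0..T} s) \<partial>lborel)"
    by (intro nn_integral_mono ennreal_leI pt)
  also have "\<dots> = (\<integral>\<^sup>+ s. 2 * (ennreal (?h s) * indicator {0..T} s) + ennreal (2 * \<eta>\<^sup>2) * indicator {0..T} s \<partial>lborel)"
    by (intro nn_integral_cong) (auto simp: indicator_def ennreal_plus ennreal_mult)
  also have "\<dots> = 2 * (\<integral>\<^sup>+ s. ennreal (?h s) * indicator {0..T} s \<partial>lborel) + ennreal (2 * \<eta>\<^sup>2) * emeasure lborel {0..T}"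
    using hm by (subst nn_integral_add) (auto simp: nn_integral_cmult nn_integral_cmult_indicator)
  also have "(\<integral>\<^sup>+ s. ennreal (?h s) * indicator {0..T} s \<partial>lborel) = (\<integral>\<^sup>+ s\<in>{0..T}. ennreal ((S s - H s)\<^sup>2) \<partial>lborel)"
    by (intro nn_integral_cong) (auto simp: indicator_def)
  also have "2 * (\<integral>\<^sup>+ s\<in>{0..T}. ennreal ((S s - H s)\<^sup>2) \<partial>lborel) + ennreal (2 * \<eta>\<^sup>2) * emeasure lborel {0..T}
    \<le> 2 * ennreal e + ennreal (2 * \<eta>\<^sup>2) * ennreal T"
    using T0 by (intro add_mono mult_left_mono e(1)) auto
  also have "\<dots> = ennreal (2 * e + 2 * \<eta>\<^sup>2 * T)"
    using e(2) T0 by (simp add: ennreal_plus ennreal_mult)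
  finally show ?thesis using e(2) T0 by (subst (asm) ennreal_le_iff) auto
qed

section \<open>Adaptedness and measurability of simple processes\<close>

lemma measurable_simple_process [measurable]: "(\<lambda>s. simple_process n \<tau> \<xi> s \<omega>) \<in> borel_measurable borel"
  unfolding simple_process_def by measurable

lemma simple_integrand_nonneg:
  assumes S: "simple_integrand M F n \<tau> \<xi>" and "k \<le> n"
  shows "0 \<le> \<tau> k"
  using \<open>k \<le> n\<close>
proof (induction k)
  case (Suc k)
  then have "\<tau> k < \<tau> (Suc k)" "0 \<le> \<tau> k" using S by (auto simp: simple_integrand_def)
  then show ?case by simp
qed (use S in \<open>simp add: simple_integrand_def\<close>)

context adapted_BM
begin

lemma measurable_simple_integrand:
  assumes S: "simple_integrand M F n \<tau> \<xi>" and "k < n"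
  shows "\<xi> k \<in> borel_measurable M"
  by (rule measurable_F_M[of _ "\<tau> k"]) (use S simple_integrand_nonneg[OF S, of k] assms(2) in \<open>auto simp: simple_integrand_def\<close>)

lemma measurable_simple_integral:
  assumes S: "simple_integrand M F n \<tau> \<xi>" and t: "0 \<le> t"
  shows "simple_integral W n \<tau> \<xi> t \<in> borel_measurable M"
  unfolding simple_integral_def
proof (rule borel_measurable_sum)
  fix k assume "k \<in> {..<n}"
  then have "0 \<le> min t (\<tau> k)" "0 \<le> min t (\<tau> (Suc k))" "\<xi> k \<in> borel_measurable M"
    using simple_integrand_nonneg[OF S] measurable_simple_integrand[OF S] t by auto
  then show "(\<lambda>\<omega>. \<xi> k \<omega> * (W (min t (\<tau> (Suc k))) \<omega> - W (min t (\<tau> k)) \<omega>)) \<in> borel_measurable M"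
    by (intro borel_measurable_times borel_measurable_diff measurable_W)
qed

text \<open>The value at the right end is already known at the left end \<open>a\<close>: a
  coefficient active at \<open>b\<close> has \<open>\<tau> k < b\<close>, and without breakpoints
  inside the cell \<open>\<tau> k \<le> a\<close>. This makes the value a legitimate coefficient for
  the increment from \<open>a\<close> to \<open>b\<close>.\<close>

lemma simple_process_adapted:
  assumes S: "simple_integrand M F n \<tau> \<xi>" and ab: "0 \<le> a" "a < b" and P: "\<And>k. k \<le> n \<Longrightarrow> \<not> (a < \<tau> k \<and> \<tau> k < b)"
  shows "simple_process n \<tau> \<xi> b \<in> borel_measurable (F a)"
  unfolding simple_process_def
proof (rule borel_measurable_sum)
  fix k assume "k \<in> {..<n}"
  then have k: "k < n" by simp
  have \<tau>0: "0 \<le> \<tau> k" using simple_integrand_nonneg[OF S] k by simp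
  show "(\<lambda>\<omega>. \<xi> k \<omega> * indicator {\<tau> k<..\<tau> (Suc k)} b) \<in> borel_measurable (F a)"
  proof (cases "\<tau> k < b")
    case True
    then have "\<tau> k \<le> a" using P[of k] k by auto
    moreover have "\<xi> k \<in> borel_measurable (F (\<tau> k))" using S k by (simp add: simple_integrand_def)
    ultimately have "\<xi> k \<in> borel_measurable (F a)" using measurable_F_mono \<tau>0 by blast
    then show ?thesis by simp
  qed (simp add: indicator_def)
qed

lemma measurable_simple_error:
  assumes S: "simple_integrand M F n \<tau> \<xi>" and H: "progressively_measurable F H" and T: "0 \<le> T"
  shows "(\<lambda>\<omega>. \<integral>\<^sup>+ s\<in>{0..T}. ennreal ((simple_process n \<tau> \<xi> s \<omega> - H s \<omega>)\<^sup>2) \<partial>lborel) \<in> borel_measurable M"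
proof -
  let ?R = "restrict_space lborel {0..T}"
  interpret R: sigma_finite_measure ?R
    by (rule sigma_finite_measure_restrict_space) (auto intro: lborel.sigma_finite_measure_axioms)
  have Req: "sets ?R = sets (restrict_space borel {0..T})" by (rule sets_restrict_space_cong) simp
  have H': "(\<lambda>(s, \<omega>). H s \<omega>) \<in> borel_measurable (restrict_space borel {0..T} \<Otimes>\<^sub>M F T)"
    using H T by (simp add: progressively_measurable_def)
  \<comment> \<open>Progressive measurability puts time first, whereas the time to be integrated out
    must be the second component here; \<open>F T\<close> is also enlarged to
    \<open>M\<close>.\<close>
  have sw: "(\<lambda>(\<omega>, s). (s, \<omega>)) \<in> measurable (M \<Otimes>\<^sub>M ?R) (restrict_space borel {0..T} \<Otimes>\<^sub>M F T)"
  proof -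
    have "(\<lambda>\<omega>. \<omega>) \<in> measurable M (F T)"
      by (rule measurable_from_subalg[OF subalg[OF T] measurable_ident_sets[OF refl]])
    then have 1: "(\<lambda>p. fst p) \<in> measurable (M \<Otimes>\<^sub>M ?R) (F T)"
      by (rule measurable_compose[OF measurable_fst])
    have 2: "(\<lambda>p. snd p) \<in> measurable (M \<Otimes>\<^sub>M ?R) (restrict_space borel {0..T})"
      using measurable_snd measurable_cong_sets[OF refl Req] by blast
    show ?thesis using measurable_Pair[OF 2 1] by (simp add: case_prod_beta')
  qed
  have HM: "(\<lambda>(\<omega>, s). H s \<omega>) \<in> borel_measurable (M \<Otimes>\<^sub>M ?R)"
    using measurable_compose[OF sw H'] by (simp add: case_prod_beta')
  have SM: "(\<lambda>(\<omega>, s). simple_process n \<tau> \<xi> s \<omega>) \<in> borel_measurable (M \<Otimes>\<^sub>M ?R)"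
    unfolding simple_process_def case_prod_beta'
  proof (rule borel_measurable_sum)
    fix k assume "k \<in> {..<n}"
    then have k: "k < n" by simp
    have "\<xi> k \<in> borel_measurable M" by (rule measurable_simple_integrand[OF S k])
    then have 1: "(\<lambda>p. \<xi> k (fst p)) \<in> borel_measurable (M \<Otimes>\<^sub>M ?R)" by measurable
    have "(\<lambda>s. s) \<in> borel_measurable ?R" by (rule measurable_restrict_space1) simp
    then have "(\<lambda>s. indicator {\<tau> k<..\<tau> (Suc k)} s :: real) \<in> borel_measurable ?R"
      by (rule measurable_compose) simp
    then have 2: "(\<lambda>p. indicator {\<tau> k<..\<tau> (Suc k)} (snd p) :: real) \<in> borel_measurable (M \<Otimes>\<^sub>M ?R)"
      by (rule measurable_compose[OF measurable_snd])
    show "(\<lambda>p. \<xi> k (fst p) * indicator {\<tau> k<..\<tau> (Suc k)} (snd p)) \<in> borel_measurable (M \<Otimes>\<^sub>M ?R)"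
      using 1 2 by (rule borel_measurable_times)
  qed
  have "(\<lambda>(\<omega>, s). ennreal ((simple_process n \<tau> \<xi> s \<omega> - H s \<omega>)\<^sup>2)) \<in> borel_measurable (M \<Otimes>\<^sub>M ?R)"
    using borel_measurable_diff[OF SM[unfolded case_prod_beta'] HM[unfolded case_prod_beta']]
    unfolding case_prod_beta' by measurable
  from R.borel_measurable_nn_integral[OF this]
  show ?thesis by (simp add: nn_integral_restrict_space)
qed

lemma progressively_measurable_section:
  assumes H: "progressively_measurable F H" and T: "0 \<le> T"
  shows "H T \<in> borel_measurable (F T)"
proof -
  have H': "(\<lambda>(s, \<omega>). H s \<omega>) \<in> borel_measurable (restrict_space borel {0..T} \<Otimes>\<^sub>M F T)"
    using H T by (simp add: progressively_measurable_def)
  have "(\<lambda>\<omega>. (T, \<omega>)) \<in> measurable (F T) (restrict_space borel {0..T} \<Otimes>\<^sub>M F T)"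
    using T by (intro measurable_Pair) (auto simp: space_restrict_space)
  from measurable_compose[OF this H'] show ?thesis by simp
qed

lemma null_in_prob_of_square:
  assumes "null_in_prob (\<lambda>n \<omega>. (Y n \<omega>)\<^sup>2)"
  shows "null_in_prob Y"
  unfolding null_in_prob_def
proof (intro allI impI)
  fix e :: real assume e: "0 < e"
  then have "(\<lambda>n. prob {\<omega> \<in> space M. \<bar>(Y n \<omega>)\<^sup>2\<bar> > e\<^sup>2}) \<longlonglongrightarrow> 0"
    using assms by (simp add: null_in_prob_def)
  moreover have "\<bar>(Y n \<omega>)\<^sup>2\<bar> > e\<^sup>2 \<longleftrightarrow> \<bar>Y n \<omega>\<bar> > e" for n \<omega>
    using e abs_le_square_iff[of "Y n \<omega>" e] by (simp add: not_le[symmetric])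
  ultimately show "(\<lambda>n. prob {\<omega> \<in> space M. \<bar>Y n \<omega>\<bar> > e}) \<longlonglongrightarrow> 0" by simp
qed

text \<open>The convergence in probability is pointwise in time, but level \<open>n\<close> has only
  \<open>2^n + 1\<close> grid points, so one approximation can be chosen that is good at all of
  them. The rate \<open>(1/8)^n\<close> beats the number of cells twice: in the union bound over the
  points and in the later sum of the errors over the cells.\<close>

lemma ito_fast_approximation:
  assumes ito: "is_ito_integral M F W H J" and T: "0 < T"
  shows "\<exists>N \<tau> \<xi>. (\<forall>n. simple_integrand M F (N n) (\<tau> n) (\<xi> n)) \<and>
    (AE \<omega> in M. eventually (\<lambda>n. (\<integral>\<^sup>+ s\<in>{0..T}. ennreal ((simple_process (N n) (\<tau> n) (\<xi> n) s \<omega> - H s \<omega>)\<^sup>2) \<partial>lborel)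
       \<le> ennreal ((1/2)^n)) sequentially) \<and>
    (AE \<omega> in M. eventually (\<lambda>n. \<forall>k\<le>2^n. \<bar>simple_integral W (N n) (\<tau> n) (\<xi> n) (T * real k / 2^n) \<omega> - J (T * real k / 2^n) \<omega>\<bar> \<le> (1/8)^n) sequentially)"
proof -
  let ?t = "\<lambda>n k :: nat. T * real k / 2^n"
  have t0: "0 \<le> ?t n k" for n k using T by simp
  have H: "progressively_measurable F H" and J: "adapted_to F J" using ito by (simp_all add: is_ito_integral_def)
  have JM: "J s \<in> borel_measurable M" if "0 \<le> s" for s
    using J measurable_F_M that by (auto simp: adapted_to_def)
  from ito obtain N \<tau> \<xi> where S: "\<And>m::nat. simple_integrand M F (N m) (\<tau> m) (\<xi> m)"
    and cS: "\<And>t \<epsilon>. t \<ge> 0 \<Longrightarrow> \<epsilon> > 0 \<Longrightarrow> (\<lambda>m. prob {\<omega> \<in> space M.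
        (\<integral>\<^sup>+ s\<in>{0..t}. ennreal ((simple_process (N m) (\<tau> m) (\<xi> m) s \<omega> - H s \<omega>)\<^sup>2) \<partial>lborel) > ennreal \<epsilon>}) \<longlonglongrightarrow> 0"
    and cI: "\<And>t \<epsilon>. t \<ge> 0 \<Longrightarrow> \<epsilon> > 0 \<Longrightarrow> (\<lambda>m. prob {\<omega> \<in> space M. \<bar>simple_integral W (N m) (\<tau> m) (\<xi> m) t \<omega> - J t \<omega>\<bar> > \<epsilon>}) \<longlonglongrightarrow> 0"
    unfolding is_ito_integral_def by blast
  let ?err = "\<lambda>m \<omega>. \<integral>\<^sup>+ s\<in>{0..T}. ennreal ((simple_process (N m) (\<tau> m) (\<xi> m) s \<omega> - H s \<omega>)\<^sup>2) \<partial>lborel"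
  let ?d = "\<lambda>m t \<omega>. simple_integral W (N m) (\<tau> m) (\<xi> m) t \<omega> - J t \<omega>"
  let ?A = "\<lambda>n m. {\<omega> \<in> space M. ?err m \<omega> > ennreal ((1/2)^n)}"
  let ?B = "\<lambda>n k m. {\<omega> \<in> space M. \<bar>?d m (?t n k) \<omega>\<bar> > (1/8)^n}"
  have "\<exists>m. prob (?A n m) < (1/2)^n \<and> (\<forall>k\<in>{..2^n}. prob (?B n k m) < (1/8)^n)" for n :: nat
  proof -
    have "eventually (\<lambda>m. prob (?A n m) < (1/2)^n) sequentially"
      by (rule order_tendstoD(2)[OF cS]) (use T in auto)
    moreover have "eventually (\<lambda>m. \<forall>k\<in>{..2^n}. prob (?B n k m) < (1/8)^n) sequentially"
      by (rule eventually_ball_finite[OF finite_atMost], rule ballI, rule order_tendstoD(2)[OF cI]) (use t0 in auto)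
    ultimately have "eventually (\<lambda>m. prob (?A n m) < (1/2)^n \<and> (\<forall>k\<in>{..2^n}. prob (?B n k m) < (1/8)^n)) sequentially"
      by (rule eventually_conj)
    then show ?thesis using eventually_happens'[OF sequentially_bot] by blast
  qed
  then have "\<exists>m. \<forall>n. prob (?A n (m n)) < (1/2)^n \<and> (\<forall>k\<in>{..2^n}. prob (?B n k (m n)) < (1/8)^n)"
    by (intro choice) blast
  then obtain m where m: "\<And>n. prob (?A n (m n)) < (1/2)^n" "\<And>n k. k \<in> {..2^n} \<Longrightarrow> prob (?B n k (m n)) < (1/8)^n"
    by (elim exE) blast
  have Am: "?A n (m n) \<in> events" for n
    by (rule borel_measurable_less[OF borel_measurable_const measurable_simple_error[OF S H]]) (use T in simp)
  have Bm: "?B n k (m n) \<in> events" for n k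
    by (intro borel_measurable_less borel_measurable_const borel_measurable_abs borel_measurable_diff measurable_simple_integral[OF S] JM t0)
  have "AE \<omega> in M. eventually (\<lambda>n. \<omega> \<in> space M - ?A n (m n)) sequentially"
  proof (rule borel_cantelli_AE1[OF Am])
    show "summable (\<lambda>n. prob (?A n (m n)))"
      by (rule summable_comparison_test'[OF summable_geometric[of "1/2::real"], of 0]) (use m(1) in \<open>auto intro: less_imp_le\<close>)
  qed (simp add: emeasure_eq_measure)
  then have 1: "AE \<omega> in M. eventually (\<lambda>n. ?err (m n) \<omega> \<le> ennreal ((1/2)^n)) sequentially"
    by eventually_elim (auto elim: eventually_mono simp: not_less)
  have "AE \<omega> in M. eventually (\<lambda>n. \<omega> \<in> space M - (\<Union>k\<in>{..2^n}. ?B n k (m n))) sequentially"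
  proof (rule borel_cantelli_AE1)
    show "(\<Union>k\<in>{..2^n}. ?B n k (m n)) \<in> events" for n :: nat using Bm by (intro sets.finite_UN) auto
    have "prob (\<Union>k\<in>{..2^n}. ?B n k (m n)) \<le> 2 * (1/4)^n" for n :: nat
    proof -
      have "prob (\<Union>k\<in>{..2^n}. ?B n k (m n)) \<le> (\<Sum>k\<in>{..2^n}. prob (?B n k (m n)))"
        using Bm by (intro finite_measure_subadditive_finite) auto
      also have "\<dots> \<le> (\<Sum>k\<in>{..(2::nat)^n}. (1/8)^n)" by (intro sum_mono less_imp_le m(2))
      also have "\<dots> = (2^n + 1) * (1/8)^n" by simp
      \<comment> \<open>The number of grid points exceeds the number of cells by one; doubling the
        latter covers it.\<close>
      also have "\<dots> \<le> (2 * 2^n) * (1/8)^n" by (intro mult_right_mono) auto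
      also have "\<dots> = 2 * (1/4)^n" by (simp flip: power_mult_distrib)
      finally show ?thesis .
    qed
    then show "summable (\<lambda>n. prob (\<Union>k\<in>{..2^n}. ?B n k (m n)))"
      by (intro summable_comparison_test'[OF summable_mult[OF summable_geometric[of "1/4::real"], of 2], of 0]) auto
  qed (simp add: emeasure_eq_measure)
  then have 2: "AE \<omega> in M. eventually (\<lambda>n. \<forall>k\<le>2^n. \<bar>?d (m n) (?t n k) \<omega>\<bar> \<le> (1/8)^n) sequentially"
  proof eventually_elim
    case (elim \<omega>)
    then show ?case by eventually_elim (auto simp: not_less)
  qed
  show ?thesis
    by (intro exI[of _ "\<lambda>n. N (m n)"] exI[of _ "\<lambda>n. \<tau> (m n)"] exI[of _ "\<lambda>n. \<xi> (m n)"] conjI allI S 1 2)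
qed

end

lemma (in adapted_BM) ito_riemann_error:
  fixes \<eta> :: "nat \<Rightarrow> nat \<Rightarrow> 'a \<Rightarrow> real" and H J :: "real \<Rightarrow> 'a \<Rightarrow> real" and T :: real
  defines "\<rho> \<equiv> \<lambda>n k \<omega>. \<eta> n k \<omega> * (J (T * real (Suc k) / 2^n) \<omega> - J (T * real k / 2^n) \<omega>
      - H (T * real k / 2^n) \<omega> * (W (T * real (Suc k) / 2^n) \<omega> - W (T * real k / 2^n) \<omega>))"
  assumes ito: "is_ito_integral M F W H J"
    and Hc: "AE \<omega> in M. continuous_on {0..} (\<lambda>t. H t \<omega>)"
    and T: "0 < T"
    and \<eta>: "\<And>n k. k < 2^n \<Longrightarrow> \<eta> n k \<in> borel_measurable (F (T * real k / 2^n))"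
    and bd: "AE \<omega> in M. \<exists>B. \<forall>n k. k < 2^n \<longrightarrow> \<bar>\<eta> n k \<omega>\<bar> \<le> B"
  shows "null_in_prob (\<lambda>n \<omega>. \<Sum>k<2^n. \<rho> n k \<omega>)" and "null_in_prob (\<lambda>n \<omega>. \<Sum>k<2^n. (\<rho> n k \<omega>)\<^sup>2)"
proof -
  let ?t = "\<lambda>n k :: nat. T * real k / 2^n"
  have t0: "0 \<le> ?t n k" for n k using T by simp
  have tlt: "?t n k < ?t n (Suc k)" for n k using T by (simp add: divide_strict_right_mono)
  have tlei: "?t n k \<le> ?t n l \<longleftrightarrow> k \<le> l" for n k l using T by (simp add: divide_le_cancel)
  have tlti: "?t n k < ?t n l \<longleftrightarrow> k < l" for n k l using tlei[of l n k] by (simp add: not_le[symmetric])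
  have Hp: "progressively_measurable F H" and J: "adapted_to F J" using ito by (simp_all add: is_ito_integral_def)
  have JM: "J s \<in> borel_measurable M" if "0 \<le> s" for s
    using J measurable_F_M that by (auto simp: adapted_to_def)
  have HF: "H s \<in> borel_measurable (F s)" if "0 \<le> s" for s
    using progressively_measurable_section[OF Hp that] .
  have HM: "H s \<in> borel_measurable M" if "0 \<le> s" for s
    using measurable_F_M[OF HF that] that by blast
  have \<eta>M: "\<eta> n k \<in> borel_measurable M" if "k < 2^n" for n k
    using measurable_F_M[OF \<eta>[OF that] t0] .
  from ito_fast_approximation[OF ito T] obtain Ns \<tau> \<xi>
    where S: "\<And>n. simple_integrand M F (Ns n) (\<tau> n) (\<xi> n)"
    and err: "AE \<omega> in M. eventually (\<lambda>n. (\<integral>\<^sup>+ s\<in>{0..T}. ennreal ((simple_process (Ns n) (\<tau> n) (\<xi> n) s \<omega> - H s \<omega>)\<^sup>2) \<partial>lborel)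
       \<le> ennreal ((1/2)^n)) sequentially"
    and dev: "AE \<omega> in M. eventually (\<lambda>n. \<forall>k\<le>2^n. \<bar>simple_integral W (Ns n) (\<tau> n) (\<xi> n) (?t n k) \<omega> - J (?t n k) \<omega>\<bar> \<le> (1/8)^n) sequentially"
    by blast
  define SP where "SP n s \<omega> = simple_process (Ns n) (\<tau> n) (\<xi> n) s \<omega>" for n s \<omega>
  define I where "I n s \<omega> = simple_integral W (Ns n) (\<tau> n) (\<xi> n) s \<omega>" for n s \<omega>
  have IM: "I n s \<in> borel_measurable M" if "0 \<le> s" for n s
    unfolding I_def using measurable_simple_integral[OF S that] by simp
  have "\<forall>n. \<exists>N q \<phi>. mono (\<phi>) \<and> \<phi> 0 = 0 \<and> \<phi> (2^n) = N \<and> (\<forall>i<N. q i < q (Suc i)) \<and> (\<forall>k\<le>2^n. q (\<phi> k) = ?t n k) \<and>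
    (\<forall>i<N. \<forall>p\<in>\<tau> n ` {..Ns n}. \<not> (q i < p \<and> p < q (Suc i)))"
    by (rule allI, rule common_refinement[where t = "?t n" for n], rule tlt, simp)
  then have "\<exists>N q \<phi>. \<forall>n. mono (\<phi> n) \<and> \<phi> n 0 = 0 \<and> \<phi> n (2^n) = N n \<and> (\<forall>i<N n. q n i < q n (Suc i)) \<and> (\<forall>k\<le>2^n. q n (\<phi> n k) = ?t n k) \<and>
    (\<forall>i<N n. \<forall>p\<in>\<tau> n ` {..Ns n}. \<not> (q n i < p \<and> p < q n (Suc i)))"
    unfolding choice_iff .
  then obtain N q \<phi> where R: "\<forall>n. mono (\<phi> n) \<and> \<phi> n 0 = 0 \<and> \<phi> n (2^n) = N n \<and> (\<forall>i<N n. q n i < q n (Suc i)) \<and> (\<forall>k\<le>2^n. q n (\<phi> n k) = ?t n k) \<and>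
    (\<forall>i<N n. \<forall>p\<in>\<tau> n ` {..Ns n}. \<not> (q n i < p \<and> p < q n (Suc i)))"
    by (elim exE)
  have \<phi>: "mono (\<phi> n)" "\<phi> n 0 = 0" "\<phi> n (2^n) = N n" for n using R by blast+
  have q: "q n i < q n (Suc i)" if "i < N n" for n i using R that by blast
  have q\<phi>: "q n (\<phi> n k) = ?t n k" if "k \<le> 2^n" for n k using R that by blast
  have cell: "\<not> (q n i < p \<and> p < q n (Suc i))" if "i < N n" "p \<in> \<tau> n ` {..Ns n}" for n i p using R that by blast
  have qmono: "q n i \<le> q n j" if "i \<le> j" "j \<le> N n" for n i j
    using that by (induction j rule: dec_induct) (auto simp: Suc_le_eq intro: order_trans less_imp_le[OF q])
  have qlt: "q n i < q n j" if "i < j" "j \<le> N n" for n i j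
    using q[of i n] qmono[of "Suc i" j n] that by simp
  have q00: "q n 0 = 0" for n using q\<phi>[of 0 n] \<phi>(2)[of n] by simp
  have qN: "q n (N n) = T" for n using q\<phi>[of "2^n" n] \<phi>(3)[of n] by simp
  have q0: "0 \<le> q n i" if "i \<le> N n" for n i using qmono[of 0 i n] that q00 by simp
  have \<phi>N: "\<phi> n k \<le> N n" if "k \<le> 2^n" for n k using monoD[OF \<phi>(1)[of n] that] \<phi>(3)[of n] by simp
  \<comment> \<open>The coarse cell that contains the \<open>i\<close>-th cell of the refined partition.\<close>
  define \<kappa> where "\<kappa> n i = nat \<lfloor>q n i * 2^n / T\<rfloor>" for n i
  have \<kappa>1: "?t n (\<kappa> n i) \<le> q n i" "q n i < ?t n (Suc (\<kappa> n i))" if "i < N n" for n i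
  proof -
    have "real (\<kappa> n i) = of_int \<lfloor>q n i * 2^n / T\<rfloor>" using q0[of i n] that T by (simp add: \<kappa>_def)
    then have "real (\<kappa> n i) \<le> q n i * 2^n / T" "q n i * 2^n / T < real (\<kappa> n i) + 1" by linarith+
    then show "?t n (\<kappa> n i) \<le> q n i" "q n i < ?t n (Suc (\<kappa> n i))"
      using T by (simp_all add: field_simps)
  qed
  have \<kappa>2: "\<kappa> n i < 2^n" if "i < N n" for n i
  proof -
    have "?t n (\<kappa> n i) < ?t n (2^n)" using \<kappa>1(1)[OF that] qlt[OF that order_refl] qN[of n] by simp
    then show ?thesis unfolding tlti .
  qed
  have \<kappa>3: "q n (Suc i) \<le> ?t n (Suc (\<kappa> n i))" if "i < N n" for n i
  proof -
    have k: "Suc (\<kappa> n i) \<le> 2^n" using \<kappa>2[OF that] by simp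
    have "q n i < q n (\<phi> n (Suc (\<kappa> n i)))" using \<kappa>1(2)[OF that] q\<phi>[OF k] by simp
    then have "i < \<phi> n (Suc (\<kappa> n i))" using qmono[of "\<phi> n (Suc (\<kappa> n i))" i n] that by (meson less_le_not_le not_le less_imp_le)
    then show ?thesis using qmono[of "Suc i" "\<phi> n (Suc (\<kappa> n i))" n] \<phi>N[OF k] q\<phi>[OF k] by simp
  qed
  have \<kappa>4: "\<kappa> n i = k" "i < N n" if k: "k < 2^n" and i: "i \<in> {\<phi> n k..<\<phi> n (Suc k)}" for n i k
  proof -
    have N: "\<phi> n (Suc k) \<le> N n" using k by (intro \<phi>N) simp
    then show iN: "i < N n" using i by simp
    have "?t n k \<le> q n i" using qmono[of "\<phi> n k" i n] i iN q\<phi>[of k n] k by simp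
    then have "?t n k < ?t n (Suc (\<kappa> n i))" using \<kappa>1(2)[OF iN] by simp
    moreover have "q n i < ?t n (Suc k)" using qlt[of i "\<phi> n (Suc k)" n] i N q\<phi>[of "Suc k" n] k by simp
    then have "?t n (\<kappa> n i) < ?t n (Suc k)" using \<kappa>1(1)[OF iN] by simp
    ultimately show "\<kappa> n i = k" unfolding tlti by simp
  qed
  \<comment> \<open>\<open>H\<close> frozen at the left end of the coarse cell, which is known at
    every finer node of that cell.\<close>
  define g where "g n i \<omega> = H (?t n (\<kappa> n i)) \<omega>" for n i \<omega>
  define c where "c n i \<omega> = \<eta> n (\<kappa> n i) \<omega> * (SP n (q n (Suc i)) \<omega> - g n i \<omega>)" for n i \<omega>
  have cF: "c n i \<in> borel_measurable (F (q n i))" if i: "i < N n" for n i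
  proof -
    have "SP n (q n (Suc i)) \<in> borel_measurable (F (q n i))"
      unfolding SP_def by (rule simple_process_adapted[OF S q0 q[OF i]]) (use i cell[OF i] in auto)
    moreover have "g n i \<in> borel_measurable (F (q n i))"
      unfolding g_def by (rule measurable_F_mono[OF HF[OF t0] t0 \<kappa>1(1)[OF i]])
    moreover have "\<eta> n (\<kappa> n i) \<in> borel_measurable (F (q n i))"
      by (rule measurable_F_mono[OF \<eta>[OF \<kappa>2[OF i]] t0 \<kappa>1(1)[OF i]])
    ultimately show ?thesis
      unfolding c_def by (intro borel_measurable_times borel_measurable_diff)
  qed
  have cM: "c n i \<in> borel_measurable M" if "i < N n" for n i
    using measurable_F_M[OF cF[OF that] q0] that by simp
  let ?C = "\<lambda>n \<omega>. \<Sum>i<N n. (c n i \<omega>)\<^sup>2 * (q n (Suc i) - q n i)"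
  have CM: "?C n \<in> borel_measurable M" for n
    using cM by (intro borel_measurable_sum borel_measurable_times borel_measurable_power) auto
  have C0: "AE \<omega> in M. (\<lambda>n. ?C n \<omega>) \<longlonglongrightarrow> 0"
    using err Hc bd
  proof eventually_elim
    case (elim \<omega>)
    from elim(3) obtain B where B: "\<And>n k. k < 2^n \<Longrightarrow> \<bar>\<eta> n k \<omega>\<bar> \<le> B" by blast
    have Hc': "continuous_on {0..T} (\<lambda>t. H t \<omega>)" using elim(2) by (rule continuous_on_subset) auto
    show ?case
    proof (rule LIMSEQ_I)
      fix r :: real assume r: "0 < r"
      \<comment> \<open>Chosen so that the oscillation contributes \<open>r / 4\<close> after
        multiplication by the bound \<open>B\<^sup>2 + 1\<close> on the squared weights; the L2
        error contributes less than another \<open>r / 4\<close>. The summand \<open>1\<close> keeps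
        that bound positive.\<close>
      define \<delta> where "\<delta> = sqrt (r / (8 * (B\<^sup>2 + 1) * T))"
      have B1: "0 < B\<^sup>2 + 1" by (simp add: add_nonneg_pos)
      have \<delta>: "0 < \<delta>" using r T B1 by (simp add: \<delta>_def)
      have sq: "\<delta>\<^sup>2 = r / (8 * (B\<^sup>2 + 1) * T)" using r T B1 by (simp add: \<delta>_def)
      have "b * (2 * (r / (8 * b * T)) * T) = r / 4" if "0 < b" for b using that T by (simp add: field_simps)
      from this[OF B1] have \<delta>2: "(B\<^sup>2 + 1) * (2 * \<delta>\<^sup>2 * T) = r / 4" unfolding sq .
      have "(\<lambda>n. (B\<^sup>2 + 1) * (2 * (1/2)^n)) \<longlonglongrightarrow> (B\<^sup>2 + 1) * (2 * 0)"
        by (intro tendsto_intros LIMSEQ_power_zero) simp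
      then have "eventually (\<lambda>n. (B\<^sup>2 + 1) * (2 * (1/2)^n) < r / 4) sequentially"
        by (rule order_tendstoD(2)) (use r in simp)
      with elim(1) dyadic_oscillation[OF T Hc' \<delta>]
      have "eventually (\<lambda>n. norm (?C n \<omega> - 0) < r) sequentially"
      proof eventually_elim
        case (elim n)
        have "(\<Sum>i<N n. (SP n (q n (Suc i)) \<omega> - g n i \<omega>)\<^sup>2 * (q n (Suc i) - q n i)) \<le> 2 * (1/2)^n + 2 * \<delta>\<^sup>2 * T"
        proof (rule cell_sum_bound[where H = "\<lambda>s. H s \<omega>" and S = "\<lambda>s. SP n s \<omega>"])
          show "SP n s \<omega> = SP n (q n (Suc i)) \<omega>" if "i < N n" "q n i < s" "s \<le> q n (Suc i)" for i s
            unfolding SP_def by (rule simple_process_cell[OF that(2,3)]) (use cell[OF that(1)] in auto)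
          show "\<bar>H s \<omega> - g n i \<omega>\<bar> \<le> \<delta>" if "i < N n" "q n i < s" "s \<le> q n (Suc i)" for i s
          proof -
            have "s \<in> {?t n (\<kappa> n i)..?t n (Suc (\<kappa> n i))}" using \<kappa>1(1)[OF that(1)] \<kappa>3[OF that(1)] that by auto
            then show ?thesis using elim(2) \<kappa>2[OF that(1)] unfolding g_def by (auto intro: less_imp_le)
          qed
          show "(\<lambda>s. SP n s \<omega>) \<in> borel_measurable borel" unfolding SP_def by (rule measurable_simple_process)
          show "(\<integral>\<^sup>+ s\<in>{0..T}. ennreal ((SP n s \<omega> - H s \<omega>)\<^sup>2) \<partial>lborel) \<le> ennreal ((1/2)^n)"
            unfolding SP_def by (rule elim(1))
        qed (use q00 qN q Hc' in auto)
        then have le: "(B\<^sup>2 + 1) * (\<Sum>i<N n. (SP n (q n (Suc i)) \<omega> - g n i \<omega>)\<^sup>2 * (q n (Suc i) - q n i))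
          \<le> (B\<^sup>2 + 1) * (2 * (1/2)^n + 2 * \<delta>\<^sup>2 * T)"
          using B1 by (intro mult_left_mono) auto
        have "?C n \<omega> \<le> (\<Sum>i<N n. (B\<^sup>2 + 1) * ((SP n (q n (Suc i)) \<omega> - g n i \<omega>)\<^sup>2 * (q n (Suc i) - q n i)))"
        proof (rule sum_mono)
          fix i assume "i \<in> {..<N n}"
          then have i: "i < N n" by simp
          have "(\<eta> n (\<kappa> n i) \<omega>)\<^sup>2 \<le> B\<^sup>2 + 1"
            using power_mono[OF B[OF \<kappa>2[OF i]] abs_ge_zero, of 2] by simp
          then show "(c n i \<omega>)\<^sup>2 * (q n (Suc i) - q n i) \<le> (B\<^sup>2 + 1) * ((SP n (q n (Suc i)) \<omega> - g n i \<omega>)\<^sup>2 * (q n (Suc i) - q n i))"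
            unfolding c_def power_mult_distrib mult.assoc using q[OF i] by (intro mult_right_mono) auto
        qed
        also have "\<dots> \<le> (B\<^sup>2 + 1) * (2 * (1/2)^n) + (B\<^sup>2 + 1) * (2 * \<delta>\<^sup>2 * T)"
          using le unfolding sum_distrib_left[symmetric] distrib_left[of "B\<^sup>2 + 1"] .
        also have "\<dots> < r" using elim(3) \<delta>2 r by linarith
        finally have "?C n \<omega> < r" .
        moreover have "0 \<le> ?C n \<omega>" using q by (intro sum_nonneg mult_nonneg_nonneg) (auto intro: less_imp_le)
        ultimately show ?case by simp
      qed
      then show "\<exists>no. \<forall>n\<ge>no. norm (?C n \<omega> - 0) < r" by (simp add: eventually_sequentially)
    qed
  qed
  have Cnull: "null_in_prob ?C" by (rule null_in_prob_of_AE[OF CM C0])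
  define bl where "bl n k \<omega> = (\<Sum>i=\<phi> n k..<\<phi> n (Suc k). c n i \<omega> * (W (q n (Suc i)) \<omega> - W (q n i) \<omega>))" for n k \<omega>
  have bl2: "null_in_prob (\<lambda>n \<omega>. \<Sum>k<2^n. (bl n k \<omega>)\<^sup>2)"
    unfolding bl_def by (rule null_in_prob_blocks[OF _ q cF \<phi> Cnull]) (use q00 in auto)
  \<comment> \<open>All cells form one block, from index \<open>0\<close> to \<open>N n\<close>; its
    square is the square of the whole sum.\<close>
  have "null_in_prob (\<lambda>n \<omega>. \<Sum>k<1::nat. (\<Sum>i=(if k = 0 then 0 else N n)..<(if Suc k = 0 then 0 else N n). c n i \<omega> * (W (q n (Suc i)) \<omega> - W (q n i) \<omega>))\<^sup>2)"
    by (rule null_in_prob_blocks[OF _ q cF _ _ _ Cnull]) (use q00 in \<open>auto simp: mono_def\<close>)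
  then have "null_in_prob (\<lambda>n \<omega>. (\<Sum>i<N n. c n i \<omega> * (W (q n (Suc i)) \<omega> - W (q n i) \<omega>))\<^sup>2)"
    by (simp add: lessThan_atLeast0)
  then have "null_in_prob (\<lambda>n \<omega>. \<Sum>i<N n. c n i \<omega> * (W (q n (Suc i)) \<omega> - W (q n i) \<omega>))"
    by (rule null_in_prob_of_square)
  then have bl1: "null_in_prob (\<lambda>n \<omega>. \<Sum>k<2^n. bl n k \<omega>)"
    unfolding bl_def sum_blocks[OF \<phi>(1,2)] \<phi>(3) .
  let ?\<Delta> = "\<lambda>f n k \<omega>. f (?t n (Suc k)) \<omega> - f (?t n k) \<omega>"
  have bl: "bl n k \<omega> = \<eta> n k \<omega> * (?\<Delta> (I n) n k \<omega> - H (?t n k) \<omega> * ?\<Delta> W n k \<omega>)" if k: "k < 2^n" for n k \<omega>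
  proof -
    let ?w = "\<lambda>i. W (q n i) \<omega>" and ?i = "\<lambda>i. I n (q n i) \<omega>"
    have "bl n k \<omega> = (\<Sum>i=\<phi> n k..<\<phi> n (Suc k). \<eta> n k \<omega> * (?i (Suc i) - ?i i) - \<eta> n k \<omega> * H (?t n k) \<omega> * (?w (Suc i) - ?w i))"
      unfolding bl_def
    proof (intro sum.cong refl)
      fix i assume i: "i \<in> {\<phi> n k..<\<phi> n (Suc k)}"
      note \<kappa> = \<kappa>4[OF k i]
      have e: "?i (Suc i) - ?i i = SP n (q n (Suc i)) \<omega> * (?w (Suc i) - ?w i)"
        unfolding I_def SP_def
        by (rule simple_integral_cell[OF q[OF \<kappa>(2)]]) (use cell[OF \<kappa>(2)] S[of n] in \<open>auto simp: simple_integrand_def\<close>)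
      show "c n i \<omega> * (?w (Suc i) - ?w i) = \<eta> n k \<omega> * (?i (Suc i) - ?i i) - \<eta> n k \<omega> * H (?t n k) \<omega> * (?w (Suc i) - ?w i)"
        unfolding c_def g_def \<kappa>(1) e by (simp add: algebra_simps)
    qed
    also have "\<dots> = \<eta> n k \<omega> * (?i (\<phi> n (Suc k)) - ?i (\<phi> n k)) - \<eta> n k \<omega> * H (?t n k) \<omega> * (?w (\<phi> n (Suc k)) - ?w (\<phi> n k))"
      unfolding sum_subtractf sum_distrib_left[symmetric]
      using monoD[OF \<phi>(1)[of n], of k "Suc k"] sum_Suc_diff'[of "\<phi> n k" "\<phi> n (Suc k)" ?i]
        sum_Suc_diff'[of "\<phi> n k" "\<phi> n (Suc k)" ?w] by (simp add: sum_subtractf)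
    also have "\<dots> = \<eta> n k \<omega> * (?\<Delta> (I n) n k \<omega> - H (?t n k) \<omega> * ?\<Delta> W n k \<omega>)"
      using q\<phi>[of k n] q\<phi>[of "Suc k" n] k by (simp add: algebra_simps)
    finally show ?thesis .
  qed
  have blM: "bl n k \<in> borel_measurable M" if "k < 2^n" for n k
    unfolding bl[OF that] using \<eta>M[OF that] IM[OF t0] HM[OF t0] measurable_W[OF t0]
    by (intro borel_measurable_times borel_measurable_diff)
  define D where "D n k \<omega> = \<eta> n k \<omega> * (?\<Delta> J n k \<omega> - ?\<Delta> (I n) n k \<omega>)" for n k \<omega>
  have DM: "D n k \<in> borel_measurable M" if "k < 2^n" for n k
    unfolding D_def using \<eta>M[OF that] IM[OF t0] JM[OF t0]
    by (intro borel_measurable_times borel_measurable_diff)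
  have \<rho>: "\<rho> n k \<omega> = bl n k \<omega> + D n k \<omega>" if "k < 2^n" for n k \<omega>
    unfolding bl[OF that] \<rho>_def D_def by (simp add: algebra_simps)
  \<comment> \<open>Each increment meets two grid points, hence the bound
    \<open>(2 * B) * (1/8)^n\<close>. Summed over \<open>2^n\<close> cells it decays like
    \<open>(1/4)^n\<close>, and its squares like \<open>(1/32)^n\<close>.\<close>
  have Dbd: "AE \<omega> in M. \<exists>B\<ge>0. eventually (\<lambda>n. \<forall>k<2^n. \<bar>D n k \<omega>\<bar> \<le> B * (1/8)^n) sequentially"
    using dev bd
  proof eventually_elim
    case (elim \<omega>)
    from elim(2) obtain B where B: "\<And>n k. k < 2^n \<Longrightarrow> \<bar>\<eta> n k \<omega>\<bar> \<le> B" by blast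
    have B0: "0 \<le> B" using order_trans[OF abs_ge_zero B[of 0 0]] by simp
    from elim(1) have "eventually (\<lambda>n. \<forall>k<2^n. \<bar>D n k \<omega>\<bar> \<le> (2 * B) * (1/8)^n) sequentially"
    proof eventually_elim
      case (elim n)
      show ?case
      proof (intro allI impI)
        fix k :: nat assume k: "k < 2^n"
        have "\<bar>?\<Delta> J n k \<omega> - ?\<Delta> (I n) n k \<omega>\<bar> \<le> \<bar>I n (?t n (Suc k)) \<omega> - J (?t n (Suc k)) \<omega>\<bar> + \<bar>I n (?t n k) \<omega> - J (?t n k) \<omega>\<bar>"
          by linarith
        also have "\<dots> \<le> (1/8)^n + (1/8)^n"
          unfolding I_def using elim[rule_format, of k] elim[rule_format, of "Suc k"] k by (intro add_mono) auto
        finally have "\<bar>D n k \<omega>\<bar> \<le> B * ((1/8)^n + (1/8)^n)"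
          unfolding D_def abs_mult using B[OF k] B0 by (intro mult_mono) auto
        then show "\<bar>D n k \<omega>\<bar> \<le> (2 * B) * (1/8)^n" by simp
      qed
    qed
    then show ?case using B0 by (intro exI[of _ "2 * B"]) simp
  qed
  have D1: "null_in_prob (\<lambda>n \<omega>. \<Sum>k<2^n. D n k \<omega>)"
  proof (rule null_in_prob_of_AE)
    show "AE \<omega> in M. (\<lambda>n. \<Sum>k<2^n. D n k \<omega>) \<longlonglongrightarrow> 0"
      using Dbd
    proof eventually_elim
      case (elim \<omega>)
      then obtain B where B: "0 \<le> B" "eventually (\<lambda>n. \<forall>k<2^n. \<bar>D n k \<omega>\<bar> \<le> B * (1/8)^n) sequentially" by blast
      show ?case
      proof (rule Lim_null_comparison)
        have "(\<lambda>n. B * (1/4)^n) \<longlonglongrightarrow> B * 0" by (intro tendsto_intros LIMSEQ_power_zero) simp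
        then show "(\<lambda>n. B * (1/4)^n) \<longlonglongrightarrow> 0" by simp
        show "eventually (\<lambda>n. norm (\<Sum>k<2^n. D n k \<omega>) \<le> B * (1/4)^n) sequentially"
          using B(2)
        proof eventually_elim
          case (elim n)
          have "norm (\<Sum>k<2^n. D n k \<omega>) \<le> (\<Sum>k<(2::nat)^n. B * (1/8)^n)"
            by (rule sum_norm_le) (use elim in auto)
          also have "\<dots> = B * (2^n * (1/8)^n)" by simp
          also have "(2::real)^n * (1/8)^n = (1/4)^n" by (simp flip: power_mult_distrib)
          finally show ?case .
        qed
      qed
    qed
  qed (use DM in \<open>auto intro!: borel_measurable_sum\<close>)
  have D2: "null_in_prob (\<lambda>n \<omega>. \<Sum>k<2^n. (D n k \<omega>)\<^sup>2)"
  proof (rule null_in_prob_of_AE)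
    show "AE \<omega> in M. (\<lambda>n. \<Sum>k<2^n. (D n k \<omega>)\<^sup>2) \<longlonglongrightarrow> 0"
      using Dbd
    proof eventually_elim
      case (elim \<omega>)
      then obtain B where B: "0 \<le> B" "eventually (\<lambda>n. \<forall>k<2^n. \<bar>D n k \<omega>\<bar> \<le> B * (1/8)^n) sequentially" by blast
      show ?case
      proof (rule Lim_null_comparison)
        have "(\<lambda>n. B\<^sup>2 * (1/32)^n) \<longlonglongrightarrow> B\<^sup>2 * 0" by (intro tendsto_intros LIMSEQ_power_zero) simp
        then show "(\<lambda>n. B\<^sup>2 * (1/32)^n) \<longlonglongrightarrow> 0" by simp
        show "eventually (\<lambda>n. norm (\<Sum>k<2^n. (D n k \<omega>)\<^sup>2) \<le> B\<^sup>2 * (1/32)^n) sequentially"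
          using B(2)
        proof eventually_elim
          case (elim n)
          have "norm (\<Sum>k<2^n. (D n k \<omega>)\<^sup>2) \<le> (\<Sum>k<(2::nat)^n. (B * (1/8)^n)\<^sup>2)"
          proof (rule sum_norm_le)
            fix k :: nat assume "k \<in> {..<2^n}"
            then have "\<bar>D n k \<omega>\<bar>\<^sup>2 \<le> (B * (1/8)^n)\<^sup>2" using elim by (intro power_mono) auto
            then show "norm ((D n k \<omega>)\<^sup>2) \<le> (B * (1/8)^n)\<^sup>2" by simp
          qed
          also have "\<dots> = B\<^sup>2 * (2^n * ((1/8)^n * (1/8)^n))" by (simp add: power2_eq_square)
          also have "(2::real)^n * ((1/8)^n * (1/8)^n) = (1/32)^n" by (simp flip: power_mult_distrib)
          finally show ?case .
        qed
      qed
    qed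
  qed (use DM in \<open>auto intro!: borel_measurable_sum borel_measurable_power\<close>)
  have "null_in_prob (\<lambda>n \<omega>. (\<Sum>k<2^n. bl n k \<omega>) + (\<Sum>k<2^n. D n k \<omega>))"
    by (rule null_in_prob_add[OF bl1 D1]) (use blM DM in \<open>auto intro!: borel_measurable_sum\<close>)
  moreover have "(\<Sum>k<2^n. bl n k \<omega>) + (\<Sum>k<2^n. D n k \<omega>) = (\<Sum>k<2^n. \<rho> n k \<omega>)" for n \<omega>
    unfolding sum.distrib[symmetric] by (intro sum.cong) (auto simp: \<rho>)
  ultimately show "null_in_prob (\<lambda>n \<omega>. \<Sum>k<2^n. \<rho> n k \<omega>)" by simp
  have sqM: "(\<lambda>\<omega>. \<Sum>k<2^n. (bl n k \<omega>)\<^sup>2) \<in> borel_measurable M" "(\<lambda>\<omega>. \<Sum>k<2^n. (D n k \<omega>)\<^sup>2) \<in> borel_measurable M" for n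
    using blM DM by (auto intro!: borel_measurable_sum borel_measurable_power)
  have "null_in_prob (\<lambda>n \<omega>. 2 * ((\<Sum>k<2^n. (bl n k \<omega>)\<^sup>2) + (\<Sum>k<2^n. (D n k \<omega>)\<^sup>2)))"
    by (intro null_in_prob_cmult null_in_prob_add bl2 D2 sqM)
  then show "null_in_prob (\<lambda>n \<omega>. \<Sum>k<2^n. (\<rho> n k \<omega>)\<^sup>2)"
  proof (rule null_in_prob_mono)
    have arith: "(x + y)\<^sup>2 \<le> 2 * (x\<^sup>2 + y\<^sup>2)" for x y :: real
      using sum_squares_bound[of x y] by (simp add: power2_sum)
    have "(\<Sum>k<2^n. (\<rho> n k \<omega>)\<^sup>2) \<le> 2 * ((\<Sum>k<2^n. (bl n k \<omega>)\<^sup>2) + (\<Sum>k<2^n. (D n k \<omega>)\<^sup>2))" for n \<omega>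
      unfolding sum.distrib[symmetric] sum_distrib_left
    proof (rule sum_mono)
      fix k :: nat assume "k \<in> {..<2^n}"
      then have "(\<rho> n k \<omega>)\<^sup>2 = (bl n k \<omega> + D n k \<omega>)\<^sup>2" by (simp add: \<rho>)
      then show "(\<rho> n k \<omega>)\<^sup>2 \<le> 2 * ((bl n k \<omega>)\<^sup>2 + (D n k \<omega>)\<^sup>2)"
        using arith[of "bl n k \<omega>" "D n k \<omega>"] by simp
    qed
    then show "AE \<omega> in M. \<bar>\<Sum>k<2^n. (\<rho> n k \<omega>)\<^sup>2\<bar> \<le> \<bar>2 * ((\<Sum>k<2^n. (bl n k \<omega>)\<^sup>2) + (\<Sum>k<2^n. (D n k \<omega>)\<^sup>2))\<bar>" for n
      by (intro AE_I2) (simp add: sum_nonneg)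
  qed (use sqM in \<open>auto intro!: borel_measurable_times borel_measurable_add\<close>)
qed

section \<open>Independence of the increments from the strong filtration\<close>

text \<open>The definition provides independent increments along partitions. Finitely many past
  values are partial sums of increments up to time \<open>s\<close>, apart from the null event where
  \<open>W 0\<close> is not \<open>0\<close>, so they are independent of the next increment.\<close>

lemma (in prob_space) standard_BM_past_indep:
  assumes W: "standard_BM M W" and st: "0 \<le> s" "s < t" and R: "finite R" "R \<subseteq> {0..s}"
    and B: "\<And>r. r \<in> R \<Longrightarrow> B r \<in> sets borel" and C: "C \<in> sets borel"
  shows "prob ({\<omega> \<in> space M. \<forall>r\<in>R. W r \<omega> \<in> B r} \<inter> {\<omega> \<in> space M. W t \<omega> - W s \<omega> \<in> C})
    = prob {\<omega> \<in> space M. \<forall>r\<in>R. W r \<omega> \<in> B r} * prob {\<omega> \<in> space M. W t \<omega> - W s \<omega> \<in> C}"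
proof -
  have WM: "W u \<in> borel_measurable M" if "0 \<le> u" for u using W that by (simp add: standard_BM_def)
  define Q where "Q = insert 0 (insert s R)"
  have Q: "finite Q" "Q \<subseteq> {0..s}" "0 \<in> Q" "s \<in> Q" using R st by (auto simp: Q_def)
  define xs where "xs = sorted_list_of_set Q"
  have xs: "set xs = Q" "sorted xs" using Q(1) by (auto simp: xs_def)
  have ne: "0 < length xs" using xs(1) Q(3) by (cases xs) auto
  define n where "n = length xs - 1"
  \<comment> \<open>The nodes are the sorted past times, with \<open>0\<close> first and
    \<open>s\<close> last; \<open>t\<close> follows, so increment number \<open>n\<close> is the one
    from \<open>s\<close> to \<open>t\<close>.\<close>
  define \<tau> where "\<tau> k = (if k \<le> n then xs ! k else t)" for k
  have in_xs: "\<tau> k \<in> {0..s}" if "k \<le> n" for k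
  proof -
    have "k < length xs" using that ne unfolding n_def by linarith
    from nth_mem[OF this] show ?thesis using that xs(1) Q(2) by (simp add: \<tau>_def subset_iff)
  qed
  have ex: "\<exists>j\<le>n. \<tau> j = r" if "r \<in> Q" for r
  proof -
    from that obtain j where "j < length xs" "xs ! j = r" using xs(1) by (metis in_set_conv_nth)
    then show ?thesis by (intro exI[of _ j]) (auto simp: \<tau>_def n_def)
  qed
  have mono: "\<tau> i \<le> \<tau> j" if "i \<le> j" "j \<le> n" for i j
  proof -
    have "j < length xs" using that ne unfolding n_def by linarith
    from sorted_nth_mono[OF xs(2) that(1) this] show ?thesis using that by (simp add: \<tau>_def)
  qed
  have \<tau>0: "\<tau> 0 = 0"
  proof -
    obtain j where "j \<le> n" "\<tau> j = 0" using ex[OF Q(3)] by blast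
    then show ?thesis using mono[of 0 j] in_xs[of 0] by auto
  qed
  have \<tau>n: "\<tau> n = s"
  proof -
    obtain j where "j \<le> n" "\<tau> j = s" using ex[OF Q(4)] by blast
    then show ?thesis using mono[of j n] in_xs[of n] by auto
  qed
  have \<tau>Sn: "\<tau> (Suc n) = t" by (simp add: \<tau>_def)
  let ?\<Delta> = "\<lambda>k \<omega>. W (\<tau> (Suc k)) \<omega> - W (\<tau> k) \<omega>"
  have step: "\<tau> k \<le> \<tau> (Suc k)" if "k < Suc n" for k
    using that mono[of k "Suc k"] \<tau>n \<tau>Sn st by (cases "k = n") auto
  have iv: "indep_vars (\<lambda>_. borel) ?\<Delta> {..<Suc n}"
  proof -
    have "0 \<le> \<tau> 0 \<and> (\<forall>k<Suc n. \<tau> k \<le> \<tau> (Suc k))" using \<tau>0 step by auto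
    then show ?thesis using W unfolding standard_BM_def by blast
  qed
  have "\<forall>r\<in>R. \<exists>j. j \<le> n \<and> \<tau> j = r" using ex by (auto simp: Q_def)
  then obtain j where j: "\<And>r. r \<in> R \<Longrightarrow> j r \<le> n \<and> \<tau> (j r) = r" by (metis bchoice)
  \<comment> \<open>The past event is expressed through the first \<open>n\<close> increments alone,
    as a measurable set in their product space.\<close>
  let ?A = "{f \<in> space (PiM {..<n} (\<lambda>_. borel :: real measure)). \<forall>r\<in>R. (\<Sum>i<j r. f i) \<in> B r}"
  have A: "?A \<in> sets (PiM {..<n} (\<lambda>_. borel))"
  proof (rule sets.sets_Collect_finite_All[OF _ R(1)])
    fix r assume r: "r \<in> R"
    have "(\<lambda>f. \<Sum>i<j r. f i) \<in> borel_measurable (PiM {..<n} (\<lambda>_. borel :: real measure))"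
      using j[OF r] by (intro borel_measurable_sum measurable_component_singleton) auto
    from measurable_sets[OF this B[OF r]]
    show "{f \<in> space (PiM {..<n} (\<lambda>_. borel :: real measure)). (\<Sum>i<j r. f i) \<in> B r} \<in> sets (PiM {..<n} (\<lambda>_. borel))"
      by (simp add: vimage_def Int_def conj_commute)
  qed
  let ?D = "{f \<in> space (PiM {n} (\<lambda>_. borel :: real measure)). f n \<in> C}"
  have D: "?D \<in> sets (PiM {n} (\<lambda>_. borel))"
    using measurable_sets[OF measurable_component_singleton[of n "{n}" "\<lambda>_. borel"] C]
    by (simp add: vimage_def Int_def conj_commute)
  have "indep_var (PiM {..<n} (\<lambda>_. borel)) (\<lambda>\<omega>. restrict (\<lambda>i. ?\<Delta> i \<omega>) {..<n}) (PiM {n} (\<lambda>_. borel)) (\<lambda>\<omega>. restrict (\<lambda>i. ?\<Delta> i \<omega>) {n})"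
    by (rule indep_var_restrict[OF iv]) auto
  from indep_varD[OF this A D]
  have eq: "prob ({\<omega> \<in> space M. \<forall>r\<in>R. (\<Sum>i<j r. ?\<Delta> i \<omega>) \<in> B r} \<inter> {\<omega> \<in> space M. W t \<omega> - W s \<omega> \<in> C})
    = prob {\<omega> \<in> space M. \<forall>r\<in>R. (\<Sum>i<j r. ?\<Delta> i \<omega>) \<in> B r} * prob {\<omega> \<in> space M. W t \<omega> - W s \<omega> \<in> C}"
  proof -
    have r: "(\<Sum>i<j r. restrict (\<lambda>i. ?\<Delta> i \<omega>) {..<n} i) = (\<Sum>i<j r. ?\<Delta> i \<omega>)" if "r \<in> R" for r \<omega>
      using j[OF that] by (intro sum.cong) auto
    have e1: "(\<lambda>\<omega>. restrict (\<lambda>i. ?\<Delta> i \<omega>) {..<n}) -` ?A \<inter> space M = {\<omega> \<in> space M. \<forall>r\<in>R. (\<Sum>i<j r. ?\<Delta> i \<omega>) \<in> B r}"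
      using r by (auto simp: space_PiM)
    have e2: "(\<lambda>\<omega>. restrict (\<lambda>i. ?\<Delta> i \<omega>) {n}) -` ?D \<inter> space M = {\<omega> \<in> space M. W t \<omega> - W s \<omega> \<in> C}"
      by (auto simp: space_PiM \<tau>n \<tau>Sn)
    have e3: "(\<lambda>\<omega>. (restrict (\<lambda>i. ?\<Delta> i \<omega>) {..<n}, restrict (\<lambda>i. ?\<Delta> i \<omega>) {n})) -` (?A \<times> ?D) \<inter> space M
      = ((\<lambda>\<omega>. restrict (\<lambda>i. ?\<Delta> i \<omega>) {..<n}) -` ?A \<inter> space M) \<inter> ((\<lambda>\<omega>. restrict (\<lambda>i. ?\<Delta> i \<omega>) {n}) -` ?D \<inter> space M)"
      by auto
    show ?thesis
      using indep_varD[OF \<open>indep_var _ _ _ _\<close> A D] unfolding e3 e1 e2 .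
  qed
  have sum: "(\<Sum>i<j r. ?\<Delta> i \<omega>) = W r \<omega> - W 0 \<omega>" if "r \<in> R" for r \<omega>
    using sum_lessThan_telescope[of "\<lambda>i. W (\<tau> i) \<omega>" "j r"] j[OF that] \<tau>0 by simp
  have "{\<omega> \<in> space M. \<forall>r\<in>R. W r \<omega> - W 0 \<omega> \<in> B r} \<in> events"
  proof (rule sets.sets_Collect_finite_All[OF _ R(1)])
    fix r assume r: "r \<in> R"
    then have "(\<lambda>\<omega>. W r \<omega> - W 0 \<omega>) \<in> borel_measurable M" using R by (intro borel_measurable_diff WM) auto
    from measurable_sets[OF this B[OF r]] show "{\<omega> \<in> space M. W r \<omega> - W 0 \<omega> \<in> B r} \<in> events"
      by (simp add: vimage_def Int_def conj_commute)
  qed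
  then have E': "{\<omega> \<in> space M. \<forall>r\<in>R. (\<Sum>i<j r. ?\<Delta> i \<omega>) \<in> B r} \<in> events" by (simp add: sum)
  have E: "{\<omega> \<in> space M. \<forall>r\<in>R. W r \<omega> \<in> B r} \<in> events"
  proof (rule sets.sets_Collect_finite_All[OF _ R(1)])
    fix r assume r: "r \<in> R"
    then have "W r \<in> borel_measurable M" using R by (intro WM) auto
    from measurable_sets[OF this B[OF r]] show "{\<omega> \<in> space M. W r \<omega> \<in> B r} \<in> events"
      by (simp add: vimage_def Int_def conj_commute)
  qed
  have "(\<lambda>\<omega>. W t \<omega> - W s \<omega>) \<in> borel_measurable M" using st by (intro borel_measurable_diff WM) auto
  from measurable_sets[OF this C] have DM: "{\<omega> \<in> space M. W t \<omega> - W s \<omega> \<in> C} \<in> events"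
    by (simp add: vimage_def Int_def conj_commute)
  have ae: "AE \<omega> in M. \<omega> \<in> {\<omega> \<in> space M. \<forall>r\<in>R. W r \<omega> \<in> B r} \<longleftrightarrow> \<omega> \<in> {\<omega> \<in> space M. \<forall>r\<in>R. (\<Sum>i<j r. ?\<Delta> i \<omega>) \<in> B r}"
  proof -
    have "AE \<omega> in M. W 0 \<omega> = 0" using W by (simp add: standard_BM_def)
    then show ?thesis by eventually_elim (simp add: sum)
  qed
  have "prob {\<omega> \<in> space M. \<forall>r\<in>R. W r \<omega> \<in> B r} = prob {\<omega> \<in> space M. \<forall>r\<in>R. (\<Sum>i<j r. ?\<Delta> i \<omega>) \<in> B r}"
    by (rule measure_eq_AE[OF ae E E'])
  moreover have "prob ({\<omega> \<in> space M. \<forall>r\<in>R. W r \<omega> \<in> B r} \<inter> {\<omega> \<in> space M. W t \<omega> - W s \<omega> \<in> C})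
    = prob ({\<omega> \<in> space M. \<forall>r\<in>R. (\<Sum>i<j r. ?\<Delta> i \<omega>) \<in> B r} \<inter> {\<omega> \<in> space M. W t \<omega> - W s \<omega> \<in> C})"
    by (rule measure_eq_AE) (use ae E E' DM in \<open>auto elim: eventually_mono\<close>)
  ultimately show ?thesis using eq by simp
qed

text \<open>Three independences are composed: of the initial value from all Brownian paths, of the
  coordinates from each other, and of the past of coordinate \<open>l\<close> from its increment.
  The increment event enters only one factor of the product over the coordinates.\<close>

lemma (in prob_space) initial_and_past_indep:
  fixes W :: "'d::finite \<Rightarrow> real \<Rightarrow> 'a \<Rightarrow> real" and \<xi> :: "'a \<Rightarrow> 'b::topological_space"
  assumes W: "independent_BMs M W" and \<xi>: "independent_of_BMs M W \<xi>"
    and st: "0 \<le> s" "s < t" and R: "finite R" "R \<subseteq> {0..s}"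
    and B: "\<And>l r. B l r \<in> sets borel" and C: "C \<in> sets borel" and A: "A \<in> sets borel"
  shows "prob ((\<xi> -` A \<inter> space M \<inter> {\<omega> \<in> space M. \<forall>l. \<forall>r\<in>R. W l r \<omega> \<in> B l r}) \<inter> {\<omega> \<in> space M. W l t \<omega> - W l s \<omega> \<in> C})
    = prob (\<xi> -` A \<inter> space M \<inter> {\<omega> \<in> space M. \<forall>l. \<forall>r\<in>R. W l r \<omega> \<in> B l r}) * prob {\<omega> \<in> space M. W l t \<omega> - W l s \<omega> \<in> C}"
proof -
  have BM: "standard_BM M (W l')" for l' using W by (simp add: independent_BMs_def)
  have iv: "indep_vars (\<lambda>_. \<Pi>\<^sub>M t\<in>{0..}. borel) (\<lambda>l \<omega>. \<lambda>t\<in>{0..}. W l t \<omega>) UNIV"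
    using W by (simp add: independent_BMs_def)
  have Rp: "r \<in> {0..}" if "r \<in> R" for r using R that by auto
  let ?X = "\<xi> -` A \<inter> space M"
  let ?E = "{\<omega> \<in> space M. \<forall>l. \<forall>r\<in>R. W l r \<omega> \<in> B l r}"
  let ?D = "{\<omega> \<in> space M. W l t \<omega> - W l s \<omega> \<in> C}"
  let ?El = "\<lambda>l'. {\<omega> \<in> space M. \<forall>r\<in>R. W l' r \<omega> \<in> B l' r}"
  let ?P = "\<Pi>\<^sub>M t\<in>{0::real..}. (borel :: real measure)"
  let ?G = "\<lambda>l'. {f \<in> space ?P. \<forall>r\<in>R. f r \<in> B l' r}"
  let ?GD = "{f \<in> space ?P. f t - f s \<in> C}"
  have cm: "(\<lambda>f. f u) \<in> borel_measurable ?P" if "0 \<le> u" for u :: real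
    using that by (intro measurable_component_singleton) auto
  have G: "?G l' \<in> sets ?P" for l'
  proof (rule sets.sets_Collect_finite_All[OF _ R(1)])
    fix r assume "r \<in> R"
    from measurable_sets[OF cm B[of l' r], of r] Rp[OF this] show "{f \<in> space ?P. f r \<in> B l' r} \<in> sets ?P"
      by (simp add: vimage_def Int_def conj_commute)
  qed
  have GD: "?GD \<in> sets ?P"
    using measurable_sets[OF borel_measurable_diff[OF cm cm] C, of t s] st
    by (simp add: vimage_def Int_def conj_commute)
  have vG: "(\<lambda>\<omega>. \<lambda>t\<in>{0..}. W l' t \<omega>) -` ?G l' \<inter> space M = ?El l'" for l'
    using Rp by (auto simp: space_PiM)
  have vGD: "(\<lambda>\<omega>. \<lambda>t\<in>{0..}. W l t \<omega>) -` ?GD \<inter> space M = ?D"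
    using st by (auto simp: space_PiM)
  have prod: "prob (\<Inter>l'\<in>UNIV. (\<lambda>\<omega>. \<lambda>t\<in>{0..}. W l' t \<omega>) -` H l' \<inter> space M) = (\<Prod>l'\<in>UNIV. prob ((\<lambda>\<omega>. \<lambda>t\<in>{0..}. W l' t \<omega>) -` H l' \<inter> space M))"
    if "\<And>l'. H l' \<in> sets ?P" for H
    by (rule indep_varsD[OF iv]) (use that in auto)
  have Eeq: "?E = (\<Inter>l'\<in>UNIV. ?El l')" by auto
  have pE: "prob ?E = (\<Prod>l'\<in>UNIV. prob (?El l'))"
    unfolding Eeq using prod[of ?G, OF G, unfolded vG] .
  \<comment> \<open>The increment event is merged with the past event of the same coordinate, as
    independence of the paths allows one event per coordinate.\<close>
  let ?H = "\<lambda>l'. if l' = l then ?G l' \<inter> ?GD else ?G l'"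
  have vH: "(\<lambda>\<omega>. \<lambda>t\<in>{0..}. W l' t \<omega>) -` ?H l' \<inter> space M = (if l' = l then ?El l' \<inter> ?D else ?El l')" for l'
  proof (cases "l' = l")
    case True
    have "X -` (Y \<inter> Z) \<inter> space M = (X -` Y \<inter> space M) \<inter> (X -` Z \<inter> space M)" for X and Y Z :: "(real \<Rightarrow> real) set"
      by blast
    from this[of "\<lambda>\<omega>. \<lambda>t\<in>{0..}. W l t \<omega>" "?G l" ?GD] show ?thesis
      unfolding True vG vGD by (simp only: simp_thms if_True)
  qed (simp only: if_False vG)
  have EDeq: "?E \<inter> ?D = (\<Inter>l'\<in>UNIV. if l' = l then ?El l' \<inter> ?D else ?El l')"
    by (auto split: if_splits)
  have HP: "?H l' \<in> sets ?P" for l' using G GD by auto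
  have "prob (?E \<inter> ?D) = (\<Prod>l'\<in>UNIV. prob (if l' = l then ?El l' \<inter> ?D else ?El l'))"
    unfolding EDeq using prod[of ?H, OF HP, unfolded vH] .
  also have "\<dots> = (\<Prod>l'\<in>UNIV. prob (?El l') * (if l' = l then prob ?D else 1))"
    using standard_BM_past_indep[OF BM st R B C] by (intro prod.cong) auto
  also have "\<dots> = prob ?E * prob ?D" unfolding prod.distrib pE by simp
  finally have ED: "prob (?E \<inter> ?D) = prob ?E * prob ?D" .
  \<comment> \<open>Independence from the initial value is stated for the whole family as one path
    indexed by pairs, so the same events are rewritten in this product space.\<close>
  let ?PP = "\<Pi>\<^sub>M p\<in>(UNIV :: 'd set) \<times> {0::real..}. (borel :: real measure)"
  let ?path = "\<lambda>\<omega>. \<lambda>p\<in>UNIV \<times> {0..}. W (fst p) (snd p) \<omega>"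
  have cmp: "(\<lambda>f. f (l', u)) \<in> borel_measurable ?PP" if "0 \<le> u" for u :: real and l' :: 'd
    using that by (intro measurable_component_singleton) auto
  let ?K = "{f \<in> space ?PP. \<forall>l'. \<forall>r\<in>R. f (l', r) \<in> B l' r}" and ?KD = "{f \<in> space ?PP. f (l, t) - f (l, s) \<in> C}"
  have K: "?K \<in> sets ?PP"
  proof -
    have "{f \<in> space ?PP. \<forall>l'\<in>UNIV. \<forall>r\<in>R. f (l', r) \<in> B l' r} \<in> sets ?PP"
    proof (intro sets.sets_Collect_finite_All R(1) finite_class.finite_UNIV)
      fix r l' assume "r \<in> R"
      from measurable_sets[OF cmp B[of l' r], of r l'] Rp[OF this] show "{f \<in> space ?PP. f (l', r) \<in> B l' r} \<in> sets ?PP"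
        by (simp add: vimage_def Int_def conj_commute)
    qed
    then show ?thesis by simp
  qed
  have KD: "?KD \<in> sets ?PP"
    using measurable_sets[OF borel_measurable_diff[OF cmp cmp] C, of t s l l] st
    by (simp add: vimage_def Int_def conj_commute)
  have vK: "?path -` ?K \<inter> space M = ?E" "?path -` (?K \<inter> ?KD) \<inter> space M = ?E \<inter> ?D"
    using Rp st by (auto simp: space_PiM)
  have ind: "indep_set {\<xi> -` A \<inter> space M |A. A \<in> sets borel} {?path -` A \<inter> space M |A. A \<in> sets ?PP}"
    using \<xi> by (simp add: independent_of_BMs_def)
  have X: "prob (?X \<inter> (?path -` K' \<inter> space M)) = prob ?X * prob (?path -` K' \<inter> space M)" if "K' \<in> sets ?PP" for K'
    by (rule indep_setD[OF ind]) (use A that in blast)+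
  have "prob ((?X \<inter> ?E) \<inter> ?D) = prob ?X * prob (?E \<inter> ?D)"
    using X[of "?K \<inter> ?KD"] K KD unfolding vK by (simp add: Int_assoc)
  moreover have "prob (?X \<inter> ?E) = prob ?X * prob ?E" using X[OF K] unfolding vK .
  ultimately show ?thesis using ED by simp
qed

text \<open>The filtration is generated by events on the initial value, events at single past times
  and null sets. Their finite intersections form a system stable under intersection on which
  independence is already known, and it extends to the generated sigma-algebras.\<close>

lemma (in prob_space) strong_filtration_adapted_BM:
  fixes W :: "'d::finite \<Rightarrow> real \<Rightarrow> 'a \<Rightarrow> real" and \<xi> :: "'a \<Rightarrow> 'b::topological_space"
  assumes W: "independent_BMs M W" and \<xi>: "independent_of_BMs M W \<xi>"
  shows "adapted_BM M (strong_filtration M W \<xi>) (W l)"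
proof -
  have BM: "standard_BM M (W l')" for l' using W by (simp add: independent_BMs_def)
  have WM: "W l' u \<in> borel_measurable M" if "0 \<le> u" for l' u using BM that by (simp add: standard_BM_def)
  have \<xi>M: "\<xi> \<in> borel_measurable M" using \<xi> by (simp add: independent_of_BMs_def)
  define Gen where "Gen t = {\<xi> -` A \<inter> space M |A. A \<in> sets borel} \<union>
      {W l s -` A \<inter> space M |l s A. 0 \<le> s \<and> s \<le> t \<and> A \<in> sets borel} \<union> null_sets M" for t :: real
  have Gen: "Gen t \<subseteq> events" for t
    unfolding Gen_def using measurable_sets[OF \<xi>M] measurable_sets[OF WM] null_setsD2 by blast
  have Pow: "Gen t \<subseteq> Pow (space M)" for t using Gen sets.sets_into_space by blast
  have F: "strong_filtration M W \<xi> t = sigma (space M) (Gen t)" for t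
    by (simp add: strong_filtration_def Gen_def)
  have sF: "space (strong_filtration M W \<xi> t) = space M" "sets (strong_filtration M W \<xi> t) = sigma_sets (space M) (Gen t)" for t
    unfolding F using Pow by (simp_all add: space_measure_of sets_measure_of)
  show ?thesis
  proof (unfold_locales)
    fix t :: real assume t: "0 \<le> t"
    show "subalgebra M (strong_filtration M W \<xi> t)"
      unfolding subalgebra_def sF using sets.sigma_sets_subset[OF Gen] by simp
    show "W l t \<in> borel_measurable (strong_filtration M W \<xi> t)"
    proof (rule measurableI)
      fix A :: "real set" assume "A \<in> sets borel"
      then have "W l t -` A \<inter> space M \<in> Gen t" unfolding Gen_def using t by blast
      then show "W l t -` A \<inter> space (strong_filtration M W \<xi> t) \<in> sets (strong_filtration M W \<xi> t)"
        unfolding sF by (rule sigma_sets.Basic)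
    qed simp
  next
    fix s t :: real assume "0 \<le> s" "s \<le> t"
    then have "Gen s \<subseteq> Gen t" unfolding Gen_def using order_trans by blast
    then show "subalgebra (strong_filtration M W \<xi> t) (strong_filtration M W \<xi> s)"
      unfolding subalgebra_def sF using sigma_sets_mono' by blast
  next
    fix s t :: real assume st: "0 \<le> s" "s < t"
    define P where "P = {\<xi> -` A \<inter> space M \<inter> {\<omega> \<in> space M. \<forall>l. \<forall>r\<in>R. W l r \<omega> \<in> B l r} |A R B.
       A \<in> sets borel \<and> finite R \<and> R \<subseteq> {0..s} \<and> (\<forall>l r. B l r \<in> sets borel)}"
    let ?D = "{(\<lambda>\<omega>. W l t \<omega> - W l s \<omega>) -` C \<inter> space M |C. C \<in> sets borel}"
    have PI: "\<xi> -` A \<inter> space M \<inter> {\<omega> \<in> space M. \<forall>l. \<forall>r\<in>R. W l r \<omega> \<in> B l r} \<in> P"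
      if "A \<in> sets borel" "finite R" "R \<subseteq> {0..s}" "\<And>l r. B l r \<in> sets borel" for A R B
      unfolding P_def using that by blast
    have Pev: "P \<subseteq> events"
    proof
      fix p assume "p \<in> P"
      then obtain A R B where p: "p = \<xi> -` A \<inter> space M \<inter> {\<omega> \<in> space M. \<forall>l. \<forall>r\<in>R. W l r \<omega> \<in> B l r}"
        "A \<in> sets borel" "finite R" "R \<subseteq> {0..s}" "\<And>l r. B l r \<in> sets borel" unfolding P_def by blast
      have "{\<omega> \<in> space M. \<forall>l\<in>UNIV. \<forall>r\<in>R. W l r \<omega> \<in> B l r} \<in> events"
      proof (intro sets.sets_Collect_finite_All p(3) finite_class.finite_UNIV)
        fix r l assume "r \<in> R"
        then have "0 \<le> r" using p(4) by auto
        from measurable_sets[OF WM[OF this] p(5)[of l r], of l]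
        show "{\<omega> \<in> space M. W l r \<omega> \<in> B l r} \<in> events" by (simp add: vimage_def Int_def conj_commute)
      qed
      then show "p \<in> events" using measurable_sets[OF \<xi>M p(2)] unfolding p(1) by auto
    qed
    have DM: "?D \<subseteq> events"
      using measurable_sets[OF borel_measurable_diff[OF WM WM], of t s _ l l] st by auto
    \<comment> \<open>Including the null sets keeps the generator closed under intersections.\<close>
    have ind: "indep_set (P \<union> null_sets M) ?D"
    proof (rule indep_setI)
      show "P \<union> null_sets M \<subseteq> events" using Pev null_setsD2 by blast
      show "?D \<subseteq> events" by (rule DM)
      fix a b assume a: "a \<in> P \<union> null_sets M" and "b \<in> ?D"
      then obtain C where b: "b = (\<lambda>\<omega>. W l t \<omega> - W l s \<omega>) -` C \<inter> space M" "C \<in> sets borel" by blast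
      have b': "b = {\<omega> \<in> space M. W l t \<omega> - W l s \<omega> \<in> C}" unfolding b(1) by auto
      from a show "prob (a \<inter> b) = prob a * prob b"
      proof
        assume "a \<in> P"
        then obtain A R B where p: "a = \<xi> -` A \<inter> space M \<inter> {\<omega> \<in> space M. \<forall>l. \<forall>r\<in>R. W l r \<omega> \<in> B l r}"
          "A \<in> sets borel" "finite R" "R \<subseteq> {0..s}" "\<And>l r. B l r \<in> sets borel" unfolding P_def by blast
        show ?thesis unfolding p(1) b' by (rule initial_and_past_indep[OF W \<xi> st p(3,4,5) b(2) p(2)])
      next
        assume a: "a \<in> null_sets M"
        have "b \<in> events" using DM \<open>b \<in> ?D\<close> by blast
        then have "a \<inter> b \<in> null_sets M" using a by (rule null_set_Int2[rotated])
        then show ?thesis using a by (simp add: measure_eq_0_null_sets)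
      qed
    qed
    have "Int_stable (P \<union> null_sets M)"
    proof (rule Int_stableI)
      fix a b assume ab: "a \<in> P \<union> null_sets M" "b \<in> P \<union> null_sets M"
      show "a \<inter> b \<in> P \<union> null_sets M"
      proof (cases "a \<in> null_sets M \<or> b \<in> null_sets M")
        case True
        then show ?thesis using ab Pev null_set_Int1 null_set_Int2 null_setsD2 by blast
      next
        case False
        with ab obtain A R B A' R' B' where
          a: "a = \<xi> -` A \<inter> space M \<inter> {\<omega> \<in> space M. \<forall>l. \<forall>r\<in>R. W l r \<omega> \<in> B l r}"
            "A \<in> sets borel" "finite R" "R \<subseteq> {0..s}" "\<And>l r. B l r \<in> sets borel" and
          b: "b = \<xi> -` A' \<inter> space M \<inter> {\<omega> \<in> space M. \<forall>l. \<forall>r\<in>R'. W l r \<omega> \<in> B' l r}"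
            "A' \<in> sets borel" "finite R'" "R' \<subseteq> {0..s}" "\<And>l r. B' l r \<in> sets borel"
          unfolding P_def by blast
        \<comment> \<open>The two families of constraints are put on the union of their times; a
          family constrains nothing at times that belong to the other one only.\<close>
        let ?B = "\<lambda>l r. (if r \<in> R then B l r else UNIV) \<inter> (if r \<in> R' then B' l r else UNIV)"
        have "a \<inter> b = \<xi> -` (A \<inter> A') \<inter> space M \<inter> {\<omega> \<in> space M. \<forall>l. \<forall>r\<in>R \<union> R'. W l r \<omega> \<in> ?B l r}"
          unfolding a(1) b(1) by (auto split: if_splits)
        moreover have "\<dots> \<in> P" using a b by (intro PI) auto
        ultimately show ?thesis by simp
      qed
    qed
    moreover have "Int_stable ?D"
    proof (rule Int_stableI)
      fix a b assume "a \<in> ?D" "b \<in> ?D"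
      then obtain A B where "a = (\<lambda>\<omega>. W l t \<omega> - W l s \<omega>) -` A \<inter> space M" "b = (\<lambda>\<omega>. W l t \<omega> - W l s \<omega>) -` B \<inter> space M"
        "A \<in> sets borel" "B \<in> sets borel" by blast
      then show "a \<inter> b \<in> ?D" by (auto intro!: exI[of _ "A \<inter> B"])
    qed
    ultimately have ind': "indep_set (sigma_sets (space M) (P \<union> null_sets M)) (sigma_sets (space M) ?D)"
      using indep_set_sigma_sets[OF ind] by blast
    \<comment> \<open>An event on the initial value uses no times; an event at one time of one
      coordinate uses \<open>UNIV\<close> for the initial value and the other coordinates.\<close>
    have "Gen s \<subseteq> P \<union> null_sets M"
    proof
      fix a assume "a \<in> Gen s"
      then consider A where "a = \<xi> -` A \<inter> space M" "A \<in> sets borel"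
        | l' r A where "a = W l' r -` A \<inter> space M" "0 \<le> r" "r \<le> s" "A \<in> sets borel"
        | "a \<in> null_sets M"
        unfolding Gen_def by blast
      then show "a \<in> P \<union> null_sets M"
      proof cases
        case 1
        have "\<xi> -` A \<inter> space M \<inter> {\<omega> \<in> space M. \<forall>l. \<forall>r\<in>{}. W l r \<omega> \<in> UNIV} \<in> P"
          using 1 by (intro PI) auto
        then show ?thesis unfolding 1(1) by (simp add: Int_def)
      next
        case 2
        have "\<xi> -` UNIV \<inter> space M \<inter> {\<omega> \<in> space M. \<forall>l. \<forall>r\<in>{r}. W l r \<omega> \<in> (if l = l' then A else UNIV)} \<in> P"
          using 2 by (intro PI) auto
        also have "\<xi> -` UNIV \<inter> space M \<inter> {\<omega> \<in> space M. \<forall>l. \<forall>r\<in>{r}. W l r \<omega> \<in> (if l = l' then A else UNIV)} = a"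
          unfolding 2(1) by (auto split: if_splits)
        finally show ?thesis by simp
      qed simp
    qed
    then have sub: "sets (strong_filtration M W \<xi> s) \<subseteq> sigma_sets (space M) (P \<union> null_sets M)"
      unfolding sF by (rule sigma_sets_mono')
    show "indep_set (sets (strong_filtration M W \<xi> s)) ?D"
    proof (rule indep_setI)
      show "sets (strong_filtration M W \<xi> s) \<subseteq> events" unfolding sF by (rule sets.sigma_sets_subset[OF Gen])
      show "?D \<subseteq> events" by (rule DM)
      show "prob (a \<inter> b) = prob a * prob b" if "a \<in> sets (strong_filtration M W \<xi> s)" "b \<in> ?D" for a b
        by (rule indep_setD[OF ind' subsetD[OF sub that(1)] sigma_sets.Basic[OF that(2)]])
    qed
    show "distributed M lborel (\<lambda>\<omega>. W l t \<omega> - W l s \<omega>) (normal_density 0 (sqrt (t - s)))"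
      using BM[of l] st by (simp add: standard_BM_def)
  next
    show "AE \<omega> in M. W l 0 \<omega> = 0" "AE \<omega> in M. continuous_on {0..} (\<lambda>t. W l t \<omega>)"
      using BM[of l] by (simp_all add: standard_BM_def)
  qed
qed

section \<open>The linear stochastic equation: solution formula and decay\<close>

context adapted_BM
begin

text \<open>Each integrand comes with its own approximating simple processes, so the remainders of
  the separate integrals vanish in probability one by one, all with the same weights
  \<open>E\<close>. Their finite combination is the remainder of \<open>Z\<close>, and
  \<open>linear_equation_solution\<close> applies path by path.\<close>

lemma linear_SDE_at_time:
  fixes Z :: "real \<Rightarrow> 'a \<Rightarrow> real" and H J :: "'i \<Rightarrow> real \<Rightarrow> 'a \<Rightarrow> real" and c :: "'i \<Rightarrow> real" and lam \<sigma> T :: real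
  assumes I: "finite I" and ito: "\<And>i. i \<in> I \<Longrightarrow> is_ito_integral M F W (H i) (J i)"
    and Hc: "\<And>i. i \<in> I \<Longrightarrow> AE \<omega> in M. continuous_on {0..} (\<lambda>t. H i t \<omega>)"
    and ZH: "\<And>t \<omega>. Z t \<omega> = (\<Sum>i\<in>I. c i * H i t \<omega>)"
    and eq: "AE \<omega> in M. \<forall>t\<ge>0. Z t \<omega> = Z 0 \<omega> - lam * (LINT s:{0..t}|lborel. Z s \<omega>) - \<sigma> * (\<Sum>i\<in>I. c i * J i t \<omega>)"
    and T: "0 < T"
  shows "AE \<omega> in M. exp (lam * T + \<sigma> * W T \<omega> + \<sigma>\<^sup>2 * T / 2) * Z T \<omega> = Z 0 \<omega>"
proof -
  let ?t = "\<lambda>n k :: nat. T * real k / 2^n"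
  let ?\<Delta> = "\<lambda>f n k \<omega>. f (T * real (Suc k) / 2^n) \<omega> - f (T * real k / 2^n) \<omega>"
  define x where "x n k \<omega> = lam * T / 2^n + \<sigma> * ?\<Delta> W n k \<omega>" for n k \<omega>
  define E where "E n k \<omega> = exp (\<Sum>i<k. x n i \<omega> + (x n i \<omega>)\<^sup>2 / 2)" for n k \<omega>
  define \<rho> where "\<rho> i n k \<omega> = ?\<Delta> (J i) n k \<omega> - H i (?t n k) \<omega> * ?\<Delta> W n k \<omega>" for i n k \<omega>
  define J' where "J' t \<omega> = (\<Sum>i\<in>I. c i * J i t \<omega>)" for t \<omega>
  have t0: "0 \<le> ?t n k" for n k using T by simp
  have tle: "?t n k \<le> ?t n l" if "k \<le> l" for n k l using T that by (simp add: divide_right_mono)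
  have JM: "J i s \<in> borel_measurable M" if "i \<in> I" "0 \<le> s" for i s
    using ito[OF that(1)] measurable_F_M that by (auto simp: adapted_to_def is_ito_integral_def)
  have HM: "H i s \<in> borel_measurable M" if "i \<in> I" "0 \<le> s" for i s
    using progressively_measurable_section[of "H i" s] ito[OF that(1)] measurable_F_M that by (auto simp: is_ito_integral_def)
  have EF: "E n k \<in> borel_measurable (F (?t n k))" for n k
  proof -
    have "x n i \<in> borel_measurable (F (?t n k))" if "i < k" for i
    proof -
      have "W (?t n i) \<in> borel_measurable (F (?t n k))" "W (?t n (Suc i)) \<in> borel_measurable (F (?t n k))"
        by (rule measurable_F_mono[OF adapted[OF t0] t0 tle]; use that in simp)+
      then show ?thesis unfolding x_def by (intro borel_measurable_add borel_measurable_times borel_measurable_diff borel_measurable_const)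
    qed
    then have "(\<lambda>\<omega>. \<Sum>i<k. x n i \<omega> + (x n i \<omega>)\<^sup>2 / 2) \<in> borel_measurable (F (?t n k))"
      by (intro borel_measurable_sum borel_measurable_add borel_measurable_divide borel_measurable_power borel_measurable_const) auto
    then show ?thesis unfolding E_def by (rule measurable_compose[OF _ borel_measurable_exp])
  qed
  have EM: "E n k \<in> borel_measurable M" for n k by (rule measurable_F_M[OF EF t0])
  have WcT: "AE \<omega> in M. continuous_on {0..T} (\<lambda>t. W t \<omega>)"
    using cont by eventually_elim (auto elim: continuous_on_subset)
  have QV: "AE \<omega> in M. (\<lambda>n. \<Sum>k<2^n. (?\<Delta> W n k \<omega>)\<^sup>2) \<longlonglongrightarrow> T" using quadratic_variation[OF T] .
  have Ebd: "AE \<omega> in M. \<exists>B. \<forall>n k. k < 2^n \<longrightarrow> \<bar>E n k \<omega>\<bar> \<le> B"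
    using WcT QV
  proof eventually_elim
    case (elim \<omega>)
    then show ?case using dyadic_exponential_product(2)[OF T, of "\<lambda>t. W t \<omega>" lam \<sigma>] by (simp add: E_def x_def)
  qed
  have R1: "null_in_prob (\<lambda>n \<omega>. \<Sum>k<2^n. E n k \<omega> * \<rho> i n k \<omega>)" if "i \<in> I" for i
    unfolding \<rho>_def by (rule ito_riemann_error(1)[OF ito[OF that] Hc[OF that] T EF Ebd])
  have R2: "null_in_prob (\<lambda>n \<omega>. \<Sum>k<2^n. (\<rho> i n k \<omega>)\<^sup>2)" if "i \<in> I" for i
    using ito_riemann_error(2)[OF ito[OF that] Hc[OF that] T, of "\<lambda>_ _ _. 1"] unfolding \<rho>_def by auto
  have \<rho>M: "\<rho> i n k \<in> borel_measurable M" if "i \<in> I" for i n k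
    unfolding \<rho>_def by (intro borel_measurable_times borel_measurable_diff JM HM measurable_W t0 that)
  let ?U = "\<lambda>n \<omega>. \<Sum>i\<in>I. c i * (\<Sum>k<2^n. E n k \<omega> * \<rho> i n k \<omega>)"
  let ?V = "\<lambda>n \<omega>. \<Sum>i\<in>I. (\<Sum>k<2^n. (\<rho> i n k \<omega>)\<^sup>2)"
  have UM: "?U n \<in> borel_measurable M" and VM: "?V n \<in> borel_measurable M" for n
    by (intro borel_measurable_sum borel_measurable_times borel_measurable_const borel_measurable_power EM \<rho>M; simp)+
  have "null_in_prob ?U"
    by (intro null_in_prob_sum null_in_prob_cmult R1 I borel_measurable_sum borel_measurable_times borel_measurable_const EM \<rho>M)
  then have U: "null_in_prob (\<lambda>n \<omega>. \<bar>?U n \<omega>\<bar>)" by (simp add: null_in_prob_def)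
  have V: "null_in_prob ?V"
    by (intro null_in_prob_sum R2 I borel_measurable_sum borel_measurable_power \<rho>M)
  \<comment> \<open>Both kinds of remainder are put into one nonnegative sequence, so that a single
    subsequence serves for both.\<close>
  have UV: "null_in_prob (\<lambda>n \<omega>. \<bar>?U n \<omega>\<bar> + ?V n \<omega>)"
    by (rule null_in_prob_add[OF U V VM]) (intro borel_measurable_abs UM)
  obtain r where r: "strict_mono r" and lim: "AE \<omega> in M. (\<lambda>n. \<bar>?U (r n) \<omega>\<bar> + ?V (r n) \<omega>) \<longlonglongrightarrow> 0"
    using null_in_prob_AE_subseq[OF UV borel_measurable_add[OF borel_measurable_abs[OF UM] VM]] by blast
  have Hc': "AE \<omega> in M. \<forall>i\<in>I. continuous_on {0..} (\<lambda>t. H i t \<omega>)"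
    using Hc I by (simp add: AE_finite_all)
  show ?thesis
    using lim Hc' eq WcT QV start
  proof eventually_elim
    case (elim \<omega>)
    have V0: "0 \<le> ?V n \<omega>" for n by (intro sum_nonneg) auto
    have Ul: "(\<lambda>n. ?U (r n) \<omega>) \<longlonglongrightarrow> 0"
      by (rule Lim_null_comparison[OF _ elim(1)]) (use V0 in auto)
    have Vl: "(\<lambda>n. ?V (r n) \<omega>) \<longlonglongrightarrow> 0"
      by (rule Lim_null_comparison[OF _ elim(1)]) (use V0 in auto)
    let ?R = "\<lambda>n k. ?\<Delta> J' n k \<omega> - Z (?t n k) \<omega> * ?\<Delta> W n k \<omega>"
    have R: "?R n k = (\<Sum>i\<in>I. c i * \<rho> i n k \<omega>)" for n k
      unfolding J'_def ZH \<rho>_def by (simp add: sum_distrib_left sum_distrib_right sum_subtractf sum.distrib algebra_simps)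
    have "?U n \<omega> = (\<Sum>k<2^n. E n k \<omega> * ?R n k)" for n
      unfolding R sum_distrib_left by (subst sum.swap) (simp add: mult_ac)
    with Ul have R1: "(\<lambda>n. \<Sum>k<2^r n. E (r n) k \<omega> * ?R (r n) k) \<longlonglongrightarrow> 0" by simp
    \<comment> \<open>Cauchy-Schwarz over the finite index set reduces the squared remainder of
      \<open>Z\<close> to those of the single integrals.\<close>
    have "(?R n k)\<^sup>2 \<le> (\<Sum>i\<in>I. (c i)\<^sup>2) * (\<Sum>i\<in>I. (\<rho> i n k \<omega>)\<^sup>2)" for n k
      unfolding R by (rule Cauchy_Schwarz_ineq_sum)
    then have "(\<Sum>k<2^n. (?R n k)\<^sup>2) \<le> (\<Sum>k<2^n. (\<Sum>i\<in>I. (c i)\<^sup>2) * (\<Sum>i\<in>I. (\<rho> i n k \<omega>)\<^sup>2))" for n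
      by (intro sum_mono)
    also have "(\<Sum>k<2^n. (\<Sum>i\<in>I. (c i)\<^sup>2) * (\<Sum>i\<in>I. (\<rho> i n k \<omega>)\<^sup>2)) = (\<Sum>i\<in>I. (c i)\<^sup>2) * ?V n \<omega>" for n
      unfolding sum_distrib_left[symmetric] by (subst sum.swap) simp
    finally have le: "(\<Sum>k<2^n. (?R n k)\<^sup>2) \<le> (\<Sum>i\<in>I. (c i)\<^sup>2) * ?V n \<omega>" for n .
    have "(\<lambda>n. (\<Sum>i\<in>I. (c i)\<^sup>2) * ?V (r n) \<omega>) \<longlonglongrightarrow> 0"
      using tendsto_mult_left[OF Vl, of "\<Sum>i\<in>I. (c i)\<^sup>2"] by simp
    then have R2: "(\<lambda>n. \<Sum>k<2^r n. (?R (r n) k)\<^sup>2) \<longlonglongrightarrow> 0"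
      by (rule Lim_null_comparison[rotated]) (use le in \<open>simp add: sum_nonneg\<close>)
    have Zc: "continuous_on {0..T} (\<lambda>t. Z t \<omega>)"
      unfolding ZH
    proof (intro continuous_on_sum continuous_on_mult continuous_on_const)
      fix i assume "i \<in> I"
      then have "continuous_on {0..} (\<lambda>t. H i t \<omega>)" using elim(2) by blast
      then show "continuous_on {0..T} (\<lambda>t. H i t \<omega>)" by (rule continuous_on_subset) auto
    qed
    have "exp (lam * T + \<sigma> * (W T \<omega> - W 0 \<omega>) + \<sigma>\<^sup>2 * T / 2) * Z T \<omega> = Z 0 \<omega>"
    proof (rule linear_equation_solution[where w = "\<lambda>t. W t \<omega>" and z = "\<lambda>t. Z t \<omega>" and j = "\<lambda>t. J' t \<omega>", OF T elim(4) Zc _ r elim(5)])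
      show "Z t \<omega> = Z 0 \<omega> - lam * (LINT s:{0..t}|lborel. Z s \<omega>) - \<sigma> * J' t \<omega>" if "0 \<le> t" for t
        using elim(3) that unfolding J'_def by blast
      show "(\<lambda>n. \<Sum>k<2^r n. (?R (r n) k)\<^sup>2) \<longlonglongrightarrow> 0" by (rule R2)
      show "(\<lambda>n. \<Sum>k<2^r n. exp (\<Sum>i<k. lam * T / 2^r n + \<sigma> * ?\<Delta> W (r n) i \<omega> + (lam * T / 2^r n + \<sigma> * ?\<Delta> W (r n) i \<omega>)\<^sup>2 / 2) * ?R (r n) k) \<longlonglongrightarrow> 0"
        using R1 unfolding E_def x_def .
    qed
    then show ?case using elim(6) by simp
  qed
qed

text \<open>The null set in \<open>linear_SDE_at_time\<close> depends on \<open>T\<close>. Countably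
  many rational times share one, and continuity of both \<open>Z\<close> and \<open>W\<close>
  extends the formula to all positive times, where the decay of the exponential factor
  decides.\<close>

lemma linear_SDE_tendsto_zero:
  fixes Z :: "real \<Rightarrow> 'a \<Rightarrow> real" and H J :: "'i \<Rightarrow> real \<Rightarrow> 'a \<Rightarrow> real" and c :: "'i \<Rightarrow> real" and lam \<sigma> :: real
  assumes I: "finite I" and ito: "\<And>i. i \<in> I \<Longrightarrow> is_ito_integral M F W (H i) (J i)"
    and Hc: "\<And>i. i \<in> I \<Longrightarrow> AE \<omega> in M. continuous_on {0..} (\<lambda>t. H i t \<omega>)"
    and ZH: "\<And>t \<omega>. Z t \<omega> = (\<Sum>i\<in>I. c i * H i t \<omega>)"
    and eq: "AE \<omega> in M. \<forall>t\<ge>0. Z t \<omega> = Z 0 \<omega> - lam * (LINT s:{0..t}|lborel. Z s \<omega>) - \<sigma> * (\<Sum>i\<in>I. c i * J i t \<omega>)"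
    and lam: "0 < lam"
  shows "AE \<omega> in M. ((\<lambda>t. Z t \<omega>) \<longlongrightarrow> 0) at_top"
proof -
  have "AE \<omega> in M. \<forall>T\<in>\<rat> \<inter> {0<..}. exp (lam * T + \<sigma> * W T \<omega> + \<sigma>\<^sup>2 * T / 2) * Z T \<omega> = Z 0 \<omega>"
    using linear_SDE_at_time[OF I ito Hc ZH eq] by (subst AE_ball_countable) (auto intro: countable_Int1 countable_rat)
  moreover have "AE \<omega> in M. \<forall>i\<in>I. continuous_on {0..} (\<lambda>t. H i t \<omega>)"
    using Hc I by (simp add: AE_finite_all)
  ultimately show ?thesis
    using cont geometric_BM_tendsto_zero[OF lam, of \<sigma>]
  proof eventually_elim
    case (elim \<omega>)
    let ?f = "\<lambda>t. exp (lam * t + \<sigma> * W t \<omega> + \<sigma>\<^sup>2 * t / 2) * Z t \<omega>"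
    have "continuous_on {0..} (\<lambda>t. Z t \<omega>)"
      unfolding ZH using elim(2) by (intro continuous_on_sum continuous_on_mult continuous_on_const) auto
    then have "continuous_on {0..} ?f" using elim(3) by (intro continuous_intros) auto
    then have fc: "continuous_on {0<..} ?f" by (rule continuous_on_subset) auto
    \<comment> \<open>A continuous function that differs from the constant at \<open>t\<close>
      differs from it near \<open>t\<close>, hence at some rational time.\<close>
    have sol: "?f t = Z 0 \<omega>" if t: "0 < t" for t
    proof (rule ccontr)
      assume "?f t \<noteq> Z 0 \<omega>"
      moreover have "continuous (at t) ?f" using fc t by (simp add: continuous_on_eq_continuous_at)
      ultimately obtain e where e: "0 < e" "\<And>y. dist t y < e \<Longrightarrow> ?f y \<noteq> Z 0 \<omega>"
        using continuous_at_avoid by blast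
      obtain y where y: "y \<in> \<rat>" "t < y" "y < t + e" using Rats_dense_in_real[of t "t + e"] e by auto
      then have "?f y = Z 0 \<omega>" using elim(1) t by auto
      moreover have "dist t y < e" using y by (simp add: dist_real_def)
      ultimately show False using e by blast
    qed
    have "((\<lambda>t. Z 0 \<omega> * exp (- (lam * t + \<sigma> * W t \<omega> + \<sigma>\<^sup>2 * t / 2))) \<longlongrightarrow> Z 0 \<omega> * 0) at_top"
      by (intro tendsto_mult tendsto_const elim(4))
    moreover have "eventually (\<lambda>t. Z 0 \<omega> * exp (- (lam * t + \<sigma> * W t \<omega> + \<sigma>\<^sup>2 * t / 2)) = Z t \<omega>) at_top"
      using eventually_gt_at_top[of 0]
    proof eventually_elim
      case (elim t)
      show ?case unfolding sol[OF elim, symmetric] exp_minus by simp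
    qed
    ultimately show ?case using tendsto_cong by fastforce
  qed
qed

end

section \<open>The particle system\<close>

lemma locally_lipschitz_continuous:
  assumes "locally_lipschitz f"
  shows "continuous_on UNIV f"
proof (rule continuous_at_imp_continuous_on, rule ballI)
  fix x
  obtain r C where "0 < r" "C-lipschitz_on (ball x r) f"
    using assms unfolding locally_lipschitz_def by blast
  then have "continuous_on (ball x r) f" by (intro lipschitz_on_continuous_on)
  then show "isCont f x" using \<open>0 < r\<close> by (simp add: continuous_on_eq_continuous_at)
qed

lemma sum_cbo_weight: "(\<Sum>k\<in>UNIV. cbo_weight \<beta> L x k) = 1"
proof -
  have "0 < (\<Sum>l\<in>UNIV. exp (- \<beta> * L (x $ l)))" by (intro sum_pos) auto
  then show ?thesis unfolding cbo_weight_def sum_divide_distrib[symmetric] by simp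
qed

lemma continuous_on_cbo_weight:
  assumes L: "continuous_on UNIV L" and X: "continuous_on S X"
  shows "continuous_on S (\<lambda>t. cbo_weight \<beta> L (X t) k)"
proof -
  have "continuous_on S (\<lambda>t. L (X t $ l))" for l
    by (rule continuous_on_compose2[OF L]) (auto intro: continuous_on_component X)
  moreover have "(\<Sum>l\<in>UNIV. exp (- \<beta> * L (X t $ l))) \<noteq> 0" for t
    by (rule less_imp_neq[symmetric], intro sum_pos) auto
  ultimately show ?thesis unfolding cbo_weight_def
    by (intro continuous_on_divide continuous_on_exp continuous_on_mult continuous_on_sum continuous_on_const) auto
qed

theorem theorem3p2:
  fixes M :: "'w measure"
    and W :: "'d::finite \<Rightarrow> real \<Rightarrow> 'w \<Rightarrow> real"
    and X :: "real \<Rightarrow> 'w \<Rightarrow> real^'d^'n::finite"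
    and L :: "real^'d \<Rightarrow> real"
    and lam \<sigma> \<beta> :: real
  assumes "prob_space M"
    and "lam > 0" and "\<sigma> \<ge> 0" and "\<beta> > 0"
    and "locally_lipschitz L"
    and "independent_BMs M W"
    and "independent_of_BMs M W (X 0)"
    and "cbo_strong_solution M W lam \<sigma> \<beta> L X"
  shows "\<forall>i j k. i \<noteq> j \<longrightarrow>
     (AE \<omega> in M. ((\<lambda>t. \<bar>X t \<omega> $ i $ k - X t \<omega> $ j $ k\<bar>) \<longlongrightarrow> 0) at_top) \<and>
     (\<forall>\<epsilon>>0. ((\<lambda>t. measure M {\<omega> \<in> space M. \<bar>X t \<omega> $ i $ k - X t \<omega> $ j $ k\<bar>\<^sup>2 > \<epsilon>}) \<longlongrightarrow> 0) at_top)"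
proof (intro allI impI)
  fix i j :: 'n and l :: 'd
  assume ij: "i \<noteq> j"
  interpret prob_space M by fact
  let ?F = "strong_filtration M W (X 0)"
  interpret BM: adapted_BM M ?F "W l"
    by (rule strong_filtration_adapted_BM) fact+
  have Lc: "continuous_on UNIV L" by (rule locally_lipschitz_continuous) fact
  note sol = \<open>cbo_strong_solution M W lam \<sigma> \<beta> L X\<close>[unfolded cbo_strong_solution_def]
  from sol have Xa: "adapted_to ?F X" and Xc: "AE \<omega> in M. continuous_on {0..} (\<lambda>t. X t \<omega>)" by blast+
  from sol obtain J where
    ito: "\<And>i k l. is_ito_integral M ?F (W l) (\<lambda>s \<omega>. cbo_weight \<beta> L (X s \<omega>) k * (X s \<omega> $ k $ l - X s \<omega> $ i $ l)) (J i k l)"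
    and eq: "AE \<omega> in M. \<forall>t\<ge>0. \<forall>i. X t \<omega> $ i = X 0 \<omega> $ i
             + lam *\<^sub>R (LINT s:{0..t}|lborel. (\<Sum>k\<in>UNIV. cbo_weight \<beta> L (X s \<omega>) k *\<^sub>R (X s \<omega> $ k - X s \<omega> $ i)))
             + \<sigma> *\<^sub>R (\<Sum>k\<in>UNIV. \<Sum>l\<in>UNIV. J i k l t \<omega> *\<^sub>R axis l 1)"
    by blast
  define Z where "Z t \<omega> = X t \<omega> $ i $ l - X t \<omega> $ j $ l" for t \<omega>
  define H where "H p s \<omega> = cbo_weight \<beta> L (X s \<omega>) (snd p) * (X s \<omega> $ snd p $ l - X s \<omega> $ fst p $ l)" for p s \<omega>
  \<comment> \<open>Since \<open>Z\<close> is the distance of particle \<open>j\<close> to the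
    weighted mean minus that of particle \<open>i\<close>, the terms of \<open>j\<close> count
    positively and those of \<open>i\<close> negatively.\<close>
  define c :: "'n \<times> 'n \<Rightarrow> real" where "c p = (if fst p = j then 1 else - 1)" for p
  \<comment> \<open>A pair names a particle and a summand of its noise, one Ito integral
    each.\<close>
  let ?I = "{i, j} \<times> (UNIV :: 'n set)"
  have sumI: "(\<Sum>p\<in>?I. c p * f p) = (\<Sum>k\<in>UNIV. f (j, k)) - (\<Sum>k\<in>UNIV. f (i, k))" for f :: "'n \<times> 'n \<Rightarrow> real"
  proof -
    have "(\<Sum>p\<in>?I. c p * f p) = (\<Sum>m\<in>{i, j}. \<Sum>k\<in>UNIV. c (m, k) * f (m, k))"
      by (simp only: sum.cartesian_product case_prod_beta' prod.collapse)
    also have "\<dots> = (\<Sum>k\<in>UNIV. f (j, k)) - (\<Sum>k\<in>UNIV. f (i, k))"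
      using ij by (simp add: c_def sum_negf)
    finally show ?thesis .
  qed
  \<comment> \<open>The weighted mean does not depend on the particle \<open>m\<close> and cancels
    in differences; this makes the equation for \<open>Z\<close> linear and closed.\<close>
  have drift: "(\<Sum>k\<in>UNIV. cbo_weight \<beta> L x k * (x $ k $ l - x $ m $ l)) = (\<Sum>k\<in>UNIV. cbo_weight \<beta> L x k * x $ k $ l) - x $ m $ l"
    for x :: "real^'d^'n" and m
    by (simp add: right_diff_distrib sum_subtractf sum_cbo_weight flip: sum_distrib_right)
  have ZH: "Z t \<omega> = (\<Sum>p\<in>?I. c p * H p t \<omega>)" for t \<omega>
    unfolding sumI H_def fst_conv snd_conv drift Z_def by simp
  have Hc: "AE \<omega> in M. continuous_on {0..} (\<lambda>t. H p t \<omega>)" for p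
    using Xc
  proof eventually_elim
    case (elim \<omega>)
    then show ?case unfolding H_def
      by (intro continuous_on_mult continuous_on_diff continuous_on_component continuous_on_cbo_weight[OF Lc])
  qed
  have Zeq: "AE \<omega> in M. \<forall>t\<ge>0. Z t \<omega> = Z 0 \<omega> - lam * (LINT s:{0..t}|lborel. Z s \<omega>) - \<sigma> * (\<Sum>p\<in>?I. c p * J (fst p) (snd p) l t \<omega>)"
    using eq Xc
  proof eventually_elim
    case (elim \<omega>)
    show ?case
    proof (intro allI impI)
      fix t :: real assume t: "0 \<le> t"
      have Xt: "continuous_on {0..t} (\<lambda>t. X t \<omega>)" using elim(2) by (rule continuous_on_subset) auto
      let ?v = "\<lambda>m s. \<Sum>k\<in>UNIV. cbo_weight \<beta> L (X s \<omega>) k *\<^sub>R (X s \<omega> $ k - X s \<omega> $ m)"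
      have vi: "set_integrable lborel {0..t} (?v m)" for m
        by (rule borel_integrable_atLeastAtMost')
          (intro continuous_on_sum continuous_on_scaleR continuous_on_diff continuous_on_component continuous_on_cbo_weight[OF Lc] Xt)
      \<comment> \<open>Taking a coordinate is bounded linear and so commutes with the vector valued
        integral.\<close>
      have comp: "(LINT s:{0..t}|lborel. ?v m s) $ l = (LINT s:{0..t}|lborel. ?v m s $ l)"
        "set_integrable lborel {0..t} (\<lambda>s. ?v m s $ l)" for m
        using vi[of m] integral_bounded_linear[OF bounded_linear_vec_nth[of l], of lborel "\<lambda>s. indicator {0..t} s *\<^sub>R ?v m s"]
          integrable_bounded_linear[OF bounded_linear_vec_nth[of l], of lborel "\<lambda>s. indicator {0..t} s *\<^sub>R ?v m s"]
        unfolding set_lebesgue_integral_def set_integrable_def vector_scaleR_component by simp_all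
      have row: "X t \<omega> $ m $ l = X 0 \<omega> $ m $ l + lam * (LINT s:{0..t}|lborel. ?v m s $ l) + \<sigma> * (\<Sum>k\<in>UNIV. J m k l t \<omega>)" for m
      proof -
        have "(\<Sum>k\<in>UNIV. \<Sum>l\<in>UNIV. J m k l t \<omega> *\<^sub>R axis l (1::real)) $ l = (\<Sum>k\<in>UNIV. J m k l t \<omega>)"
          by (simp add: axis_def if_distrib cong: if_cong)
        then show ?thesis
          using arg_cong[OF elim(1)[rule_format, OF t, of m], of "\<lambda>x. x $ l"] by (simp add: comp)
      qed
      have "?v m s $ l = (\<Sum>k\<in>UNIV. cbo_weight \<beta> L (X s \<omega>) k * X s \<omega> $ k $ l) - X s \<omega> $ m $ l" for m s
        by (simp add: drift)
      then have "?v i s $ l - ?v j s $ l = - Z s \<omega>" for s by (simp add: Z_def)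
      then have "(LINT s:{0..t}|lborel. ?v i s $ l) - (LINT s:{0..t}|lborel. ?v j s $ l) = - (LINT s:{0..t}|lborel. Z s \<omega>)"
        using set_integral_diff(2)[OF comp(2)[of i] comp(2)[of j]] by (simp add: set_lebesgue_integral_def)
      \<comment> \<open>The row of particle \<open>j\<close> is subtracted from that of
        \<open>i\<close>: \<open>P\<close> and \<open>Q\<close> are their noise sums, and
        \<open>C\<close> is the integral of \<open>Z\<close>.\<close>
      moreover have "zt = z0 - lam * C - \<sigma> * (Q - P)"
        if "zt = a - b" "z0 = a0 - b0" "a = a0 + lam * A + \<sigma> * P" "b = b0 + lam * B + \<sigma> * Q" "A - B = - C"
        for zt z0 a b a0 b0 A B C P Q :: real
      proof -
        have "C = B - A" using that(5) by simp
        show ?thesis unfolding that(1-4) \<open>C = B - A\<close> by (simp add: algebra_simps)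
      qed
      note this[OF Z_def Z_def row row]
      ultimately show "Z t \<omega> = Z 0 \<omega> - lam * (LINT s:{0..t}|lborel. Z s \<omega>) - \<sigma> * (\<Sum>p\<in>?I. c p * J (fst p) (snd p) l t \<omega>)"
        unfolding sumI fst_conv snd_conv by blast
    qed
  qed
  have lim: "AE \<omega> in M. ((\<lambda>t. Z t \<omega>) \<longlongrightarrow> 0) at_top"
  proof (rule BM.linear_SDE_tendsto_zero[OF _ _ Hc ZH Zeq \<open>lam > 0\<close>])
    show "is_ito_integral M ?F (W l) (H p) (\<lambda>t \<omega>. J (fst p) (snd p) l t \<omega>)" for p
      unfolding H_def by (rule ito)
  qed simp
  have ZM: "Z t \<in> borel_measurable M" if "0 \<le> t" for t
  proof -
    have "X t \<in> borel_measurable M"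
      using Xa measurable_from_subalg[OF BM.subalg[OF that]] that by (auto simp: adapted_to_def)
    moreover have "(\<lambda>x::real^'d^'n. x $ i $ l - x $ j $ l) \<in> borel_measurable borel"
      by (intro borel_measurable_continuous_onI continuous_intros)
    ultimately show ?thesis unfolding Z_def by (rule measurable_compose)
  qed
  show "(AE \<omega> in M. ((\<lambda>t. \<bar>X t \<omega> $ i $ l - X t \<omega> $ j $ l\<bar>) \<longlongrightarrow> 0) at_top) \<and>
     (\<forall>\<epsilon>>0. ((\<lambda>t. measure M {\<omega> \<in> space M. \<bar>X t \<omega> $ i $ l - X t \<omega> $ j $ l\<bar>\<^sup>2 > \<epsilon>}) \<longlongrightarrow> 0) at_top)"
    unfolding Z_def[symmetric]
  proof (intro conjI allI impI)
    show "AE \<omega> in M. ((\<lambda>t. \<bar>Z t \<omega>\<bar>) \<longlongrightarrow> 0) at_top"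
      using lim by eventually_elim (rule tendsto_rabs_zero)
    fix \<epsilon> :: real assume "0 < \<epsilon>"
    then have "((\<lambda>t. prob {\<omega> \<in> space M. \<bar>Z t \<omega>\<bar> > sqrt \<epsilon>}) \<longlongrightarrow> 0) at_top"
      by (intro prob_zero_of_AE_tendsto ZM lim) auto
    \<comment> \<open>The threshold for the square is traded for its root, so the limit in
      probability for \<open>Z\<close> itself suffices.\<close>
    moreover have "\<bar>Z t \<omega>\<bar> > sqrt \<epsilon> \<longleftrightarrow> \<bar>Z t \<omega>\<bar>\<^sup>2 > \<epsilon>" for t \<omega>
      using \<open>0 < \<epsilon>\<close> real_sqrt_less_iff[of \<epsilon> "\<bar>Z t \<omega>\<bar>\<^sup>2"] by simp
    ultimately show "((\<lambda>t. prob {\<omega> \<in> space M. \<bar>Z t \<omega>\<bar>\<^sup>2 > \<epsilon>}) \<longlongrightarrow> 0) at_top" by simp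
  qed
qed

end
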